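(* Let $R$ be a commutative Noetherian ring, $n\geq 1$ an integer, $I$ a proper ideal of $R$ and $\mathfrak{p}\in\operatorname{Spec}(R)$ such that $\operatorname{grade}(I,R)=\operatorname{height}(I)$ and $\operatorname{grade}(\mathfrak{p},R)=\operatorname{height}(\mathfrak{p})$. Then the following hold: (1) $R$ is $I$-Cohen Macaulay if and only if the formal power series ring $R[[x_1,\dots,x_n]]$ is $I[[x_1,\dots,x_n]]$-Cohen Macaulay. (2) $R$ is $\mathfrak{p}$-Cohen Macaulay if and only if the polynomial ring $R[x_1,\dots,x_n]$ is $\mathfrak{p}[x_1,\dots,x_n]$-Cohen Macaulay.
   Context: For a proper ideal $J$ of a commutative Noetherian ring $A$, the ring $A$ is called $J$-Cohen Macaulay if $\operatorname{grade}(J,A)+\dim(A/J)=\dim(A)$, where $\operatorname{grade}(J,A)$ is the length of a maximal $A$-regular sequence contained in $J$ and $\dim$ denotes Krull dimension. $I[[x_1,\dots,x_n]]$ and $\mathfrak{p}[x_1,\dots,x_n]$ denote the ideals of formal power series with all coefficients in $I$, respectively polynomials with all coefficients in $\mathfrak{p}$. *)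

theory Defs
  imports "HOL-Library.Extended_Nat" "HOL-Library.Multiset" "HOL-Algebra.Algebra"
begin

section \<open>Krull dimension and height\<close>

text \<open>A list $P_0, \dots, P_r$ encodes the chain $P_0 \subset \dots \subset P_r$ of length $r$,
  i.e. one less than the length of the list.\<close>

definition prime_chain :: "('a, 'm) ring_scheme \<Rightarrow> 'a set list \<Rightarrow> bool" where
  "prime_chain A Ps \<longleftrightarrow> Ps \<noteq> [] \<and> (\<forall>P\<in>set Ps. primeideal P A) \<and> sorted_wrt (\<subset>) Ps"

text \<open>For the zero ring, which has no prime ideals, the value below is 0 rather than
  the customary minus infinity.\<close>

definition krull_dim :: "('a, 'm) ring_scheme \<Rightarrow> enat" where
  "krull_dim A = Sup {enat (length Ps - 1) | Ps. prime_chain A Ps}"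

definition prime_height :: "('a, 'm) ring_scheme \<Rightarrow> 'a set \<Rightarrow> enat" where
  "prime_height A P = Sup {enat (length Ps - 1) | Ps. prime_chain A Ps \<and> last Ps = P}"

definition height :: "('a, 'm) ring_scheme \<Rightarrow> 'a set \<Rightarrow> enat" where
  "height A J = Inf {prime_height A P | P. primeideal P A \<and> J \<subseteq> P}"

lemma prime_height_mono:
  assumes P: "primeideal P A" and Q: "primeideal Q A" and "P \<subseteq> Q"
  shows "prime_height A P \<le> prime_height A Q"
proof (cases "P = Q")
  case False
  with assms have PQ: "P \<subset> Q" by blast
  show ?thesis
    unfolding prime_height_def
  proof (rule Sup_least, clarify)
    fix Ps assume Ps: "prime_chain A Ps" "P = last Ps"
    have sub: "R \<subset> Q" if "R \<in> set Ps" for R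
    proof -
      have "Ps = butlast Ps @ [last Ps]" using Ps(1) by (simp add: prime_chain_def)
      moreover have "sorted_wrt (\<subset>) Ps" using Ps(1) by (simp add: prime_chain_def)
      ultimately have "sorted_wrt (\<subset>) (butlast Ps @ [last Ps])" by simp
      hence "\<forall>R\<in>set (butlast Ps). R \<subset> last Ps" by (simp add: sorted_wrt_append)
      moreover have "set Ps = set (butlast Ps) \<union> {last Ps}"
        using \<open>Ps = butlast Ps @ [last Ps]\<close> by (metis list.set(1,2) set_append)
      ultimately show ?thesis using that PQ Ps(2) by blast
    qed
    have "prime_chain A (Ps @ [Q])"
      using Ps Q sub by (auto simp: prime_chain_def sorted_wrt_append)
    hence "enat (length (Ps @ [Q]) - 1)
        \<le> Sup {enat (length Ps - 1) | Ps. prime_chain A Ps \<and> last Ps = Q}"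
      by (intro Sup_upper) force
    moreover have "enat (length Ps - 1) \<le> enat (length (Ps @ [Q]) - 1)" by simp
    ultimately show "enat (length Ps - 1)
        \<le> Sup {enat (length Ps - 1) | Ps. prime_chain A Ps \<and> last Ps = Q}"
      by (rule order_trans[rotated])
  qed
qed simp

lemma height_prime: "primeideal P A \<Longrightarrow> height A P = prime_height A P"
  unfolding height_def
  by (intro antisym Inf_lower Inf_greatest) (auto intro: prime_height_mono)


section \<open>Regular sequences, grade and relative Cohen--Macaulayness\<close>

definition nonzerodivisor :: "('a, 'm) ring_scheme \<Rightarrow> 'a \<Rightarrow> bool" where
  "nonzerodivisor A a \<longleftrightarrow> a \<in> carrier A \<and>
     (\<forall>b\<in>carrier A. a \<otimes>\<^bsub>A\<^esub> b = \<zero>\<^bsub>A\<^esub> \<longrightarrow> b = \<zero>\<^bsub>A\<^esub>)"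

definition regular_sequence :: "('a, 'm) ring_scheme \<Rightarrow> 'a list \<Rightarrow> bool" where
  "regular_sequence A xs \<longleftrightarrow> set xs \<subseteq> carrier A \<and> Idl\<^bsub>A\<^esub> (set xs) \<noteq> carrier A \<and>
     (\<forall>i<length xs. let K = Idl\<^bsub>A\<^esub> (set (take i xs))
        in nonzerodivisor (A Quot K) (K +>\<^bsub>A\<^esub> (xs ! i)))"

definition maximal_regular_sequence_in ::
    "('a, 'm) ring_scheme \<Rightarrow> 'a set \<Rightarrow> 'a list \<Rightarrow> bool" where
  "maximal_regular_sequence_in A J xs \<longleftrightarrow> regular_sequence A xs \<and> set xs \<subseteq> J \<and>
     (\<forall>y\<in>J. \<not> regular_sequence A (xs @ [y]))"

text \<open>For a proper ideal of a commutative Noetherian ring all maximal regular sequences in it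
  have the same length (Rees), so the supremum is over a one-element set.\<close>

definition grade :: "('a, 'm) ring_scheme \<Rightarrow> 'a set \<Rightarrow> enat" where
  "grade A J = Sup {enat (length xs) | xs. maximal_regular_sequence_in A J xs}"

definition cohen_macaulay_wrt :: "('a, 'm) ring_scheme \<Rightarrow> 'a set \<Rightarrow> bool" where
  "cohen_macaulay_wrt A J \<longleftrightarrow>
     cring A \<and> noetherian_ring A \<and> ideal J A \<and> J \<noteq> carrier A \<and>
     grade A J + krull_dim (A Quot J) = krull_dim A"


section \<open>Power series and polynomials in $n$ variables\<close>

text \<open>As in \<^theory>\<open>HOL-Algebra.Indexed_Polynomials\<close>, a monomial is a multiset of variables,
  here drawn from $\{0, \dots, n-1\}$, and a series maps each monomial to its coefficient.
  Coefficients at multisets containing other elements are required to vanish, so that each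
  series has a unique representation.\<close>

definition power_series_ring ::
    "('a, 'm) ring_scheme \<Rightarrow> nat \<Rightarrow> (nat multiset \<Rightarrow> 'a) ring" where
  "power_series_ring R n =
     \<lparr>carrier = {f. (\<forall>m. f m \<in> carrier R) \<and>
                    (\<forall>m. \<not> set_mset m \<subseteq> {..<n} \<longrightarrow> f m = \<zero>\<^bsub>R\<^esub>)},
      monoid.mult = (\<lambda>f g m. \<Oplus>\<^bsub>R\<^esub>k\<in>{k. k \<subseteq># m}. f k \<otimes>\<^bsub>R\<^esub> g (m - k)),
      one = (\<lambda>m. if m = {#} then \<one>\<^bsub>R\<^esub> else \<zero>\<^bsub>R\<^esub>),
      ring.zero = (\<lambda>m. \<zero>\<^bsub>R\<^esub>),
      add = (\<lambda>f g m. f m \<oplus>\<^bsub>R\<^esub> g m)\<rparr>"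

definition polynomial_ring ::
    "('a, 'm) ring_scheme \<Rightarrow> nat \<Rightarrow> (nat multiset \<Rightarrow> 'a) ring" where
  "polynomial_ring R n = power_series_ring R n
     \<lparr>carrier := {f \<in> carrier (power_series_ring R n). finite {m. f m \<noteq> \<zero>\<^bsub>R\<^esub>}}\<rparr>"

definition power_series_ideal ::
    "('a, 'm) ring_scheme \<Rightarrow> nat \<Rightarrow> 'a set \<Rightarrow> (nat multiset \<Rightarrow> 'a) set" where
  "power_series_ideal R n I = {f \<in> carrier (power_series_ring R n). \<forall>m. f m \<in> I}"

definition polynomial_ideal ::
    "('a, 'm) ring_scheme \<Rightarrow> nat \<Rightarrow> 'a set \<Rightarrow> (nat multiset \<Rightarrow> 'a) set" where
  "polynomial_ideal R n I = {f \<in> carrier (polynomial_ring R n). \<forall>m. f m \<in> I}"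

end

theory Submission
  imports Defs "HOL-Library.Multiset_Order"
begin

text \<open>Let \<open>S\<close> be the power series or the polynomial ring. Then \<open>dim S = dim R + n\<close> and
  \<open>dim (S/JS) = dim (R/J) + n\<close>, so it suffices that extending an ideal preserves its grade.
  For that, regular sequences stay regular in \<open>S\<close>, and the grade is at most the height; hence
  \<open>grade J \<le> grade JS \<le> height JS \<le> height J\<close>, and the hypothesis closes the circle.

  All dimension bounds rest on one consequence of Krull's principal ideal theorem: in a chain of
  primes of a Noetherian ring whose last member contains \<open>x\<close>, all members but the first can
  be changed so as to contain \<open>x\<close>, keeping the first and the last one. Applied to the \<open>n\<close>
  variables, this turns a chain in \<open>S\<close> ending in a prime that contains the variables into
  a chain in \<open>R\<close> at most \<open>n\<close> steps shorter. Variables lie in the Jacobson radical of a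
  power series ring; for polynomials one variable is adjoined at a time, and \<open>x\<close> is
  taken from the coefficient ring.\<close>

text \<open>Localizations are never formed: ideals of the local ring at a prime \<open>P\<close> are
  represented by the ideals of \<open>R\<close> that are saturated at \<open>P\<close>. The
  principal ideal theorem is therefore proved, and stated, entirely with primes of \<open>R\<close>;
  its ingredients, an Artinian chain condition and Nakayama's lemma, are recast for saturated
  ideals.

  Both kinds of series live in one ring of formal series in countably many variables, so that almost
  everything is done once for an abstract set of coefficient families. There the ideals
  \<open>avoiding j J\<close> interpolate between the extension of \<open>J\<close>
  (\<open>j = 0\<close>) and the ideal of series with constant coefficient in \<open>J\<close>
  (\<open>j = n\<close>), which provides \<open>n\<close> explicit extra steps in chains of primes.

  The two cases separate at the Noetherian property and at the upper bound for chains. A maximal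
  ideal of a polynomial ring need not contain the variables, so a chain there cannot simply be
  prolonged to reach them; instead a chain in one variable is shown to lose at most one step on
  contraction. Dimensions may be infinite, and only the finite number \<open>n\<close> is ever
  cancelled.\<close>

lemma (in cring) ideal_intro:
  assumes "I \<subseteq> carrier R" "\<zero> \<in> I"
    and "\<And>a b. a \<in> I \<Longrightarrow> b \<in> I \<Longrightarrow> a \<oplus> b \<in> I"
    and "\<And>a r. a \<in> I \<Longrightarrow> r \<in> carrier R \<Longrightarrow> r \<otimes> a \<in> I"
  shows "ideal I R"
proof (rule idealI)
  show "ring R" by (rule ring_axioms)
  show "subgroup I (add_monoid R)"
  proof (rule add.subgroupI)
    fix a assume a: "a \<in> I"
    hence "(\<ominus> \<one>) \<otimes> a \<in> I" using assms(4) by simp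
    moreover have "(\<ominus> \<one>) \<otimes> a = \<ominus> a" using a assms(1) by (auto simp: l_minus)
    ultimately show "\<ominus> a \<in> I" by simp
  qed (use assms in auto)
next
  fix a x assume "a \<in> I" "x \<in> carrier R"
  thus "x \<otimes> a \<in> I" "a \<otimes> x \<in> I" using assms(1,4) m_comm by (auto simp: subset_iff)
qed

lemma (in ring) minus_add_cancel: "a \<in> carrier R \<Longrightarrow> b \<in> carrier R \<Longrightarrow> (a \<ominus> b) \<oplus> b = a"
  by algebra

lemma (in ideal) minus_closed_ideal: "a \<in> I \<Longrightarrow> b \<in> I \<Longrightarrow> a \<ominus> b \<in> I"
  by (simp add: a_minus_def)

lemma (in ideal) add_cancel_ideal:
  assumes "a \<oplus> b \<in> I" "b \<in> I" "a \<in> carrier R"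
  shows "a \<in> I"
proof -
  have "(a \<oplus> b) \<ominus> b \<in> I" by (rule minus_closed_ideal[OF assms(1,2)])
  moreover have "(a \<oplus> b) \<ominus> b = a" using assms(3) Icarr[OF assms(2)] by algebra
  ultimately show ?thesis by simp
qed

lemma (in ideal) finsum_in_ideal: "finite A \<Longrightarrow> (\<And>k. k \<in> A \<Longrightarrow> h k \<in> I) \<Longrightarrow> finsum R h A \<in> I"
proof (induction A rule: finite_induct)
  case (insert k A)
  thus ?case using Icarr by (subst finsum_insert) auto
qed simp

lemma (in ring) genideal_of_ideal:
  assumes "ideal I R" shows "Idl I = I"
  using genideal_minimal[OF assms order_refl] genideal_self[of I] ideal.Icarr[OF assms]
  by (auto simp: subset_iff)

lemma (in ring) genideal_empty: "Idl {} = {\<zero>}"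
  using genideal_minimal[OF zeroideal, of "{}"]
    additive_subgroup.zero_closed[OF ideal.axioms(1)[OF genideal_ideal[of "{}"]]] by auto

lemma (in ring) add_ideals_superset:
  assumes "ideal I R" "ideal J R"
  shows "I \<subseteq> I <+>\<^bsub>R\<^esub> J" "J \<subseteq> I <+>\<^bsub>R\<^esub> J"
proof -
  interpret I: ideal I R by fact
  interpret J: ideal J R by fact
  show "I \<subseteq> I <+>\<^bsub>R\<^esub> J"
  proof
    fix x assume "x \<in> I"
    moreover from this have "x = x \<oplus> \<zero>" using I.Icarr by simp
    ultimately show "x \<in> I <+>\<^bsub>R\<^esub> J" using J.zero_closed unfolding set_add_def' by blast
  qed
  show "J \<subseteq> I <+>\<^bsub>R\<^esub> J"
  proof
    fix x assume "x \<in> J"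
    moreover from this have "x = \<zero> \<oplus> x" using J.Icarr by simp
    ultimately show "x \<in> I <+>\<^bsub>R\<^esub> J" using I.zero_closed unfolding set_add_def' by blast
  qed
qed

lemma primeideal_mult_iff:
  fixes R (structure)
  assumes "primeideal P R" "a \<in> carrier R" "b \<in> carrier R"
  shows "a \<otimes> b \<in> P \<longleftrightarrow> a \<in> P \<or> b \<in> P"
proof -
  interpret primeideal P R by fact
  show ?thesis using I_prime assms(2,3) I_l_closed I_r_closed by blast
qed

lemma primeideal_pow_iff:
  fixes R (structure)
  assumes "primeideal P R" "a \<in> carrier R" "a [^] (k::nat) \<in> P"
  shows "a \<in> P"
proof -
  interpret primeideal P R by fact
  show ?thesis using assms(3)
  proof (induction k)
    case 0
    thus ?case using I_notcarr one_imp_carrier by auto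
  next
    case (Suc k)
    thus ?case using I_prime[of "a [^] k" a] assms(2) by auto
  qed
qed

lemma primeideal_one_notin:
  fixes R (structure)
  assumes "primeideal P R" shows "\<one> \<notin> P"
proof -
  interpret primeideal P R by fact
  show ?thesis using I_notcarr one_imp_carrier by blast
qed

lemma (in cring) Idl_insert:
  assumes "a \<in> carrier R" "H \<subseteq> carrier R"
  shows "Idl (insert a H) = {r \<otimes> a \<oplus> k |r k. r \<in> carrier R \<and> k \<in> Idl H}" (is "_ = ?J")
proof
  interpret H: ideal "Idl H" R using genideal_ideal assms(2) .
  have "ideal ?J R"
  proof (rule ideal_intro)
    show "?J \<subseteq> carrier R" using assms H.Icarr by auto
    have "\<zero> = \<zero> \<otimes> a \<oplus> \<zero>" using assms by simp
    thus "\<zero> \<in> ?J" using zero_closed H.zero_closed by (intro CollectI exI conjI)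
  next
    fix u v assume "u \<in> ?J" "v \<in> ?J"
    then obtain r k r' k' where *: "u = r \<otimes> a \<oplus> k" "v = r' \<otimes> a \<oplus> k'" "r \<in> carrier R"
      "r' \<in> carrier R" "k \<in> Idl H" "k' \<in> Idl H" by blast
    have "u \<oplus> v = (r \<oplus> r') \<otimes> a \<oplus> (k \<oplus> k')"
      unfolding *(1,2) using *(3-6) assms(1) H.Icarr[of k] H.Icarr[of k'] by algebra
    thus "u \<oplus> v \<in> ?J" using * H.a_closed by blast
  next
    fix u s assume "u \<in> ?J" and s: "s \<in> carrier R"
    then obtain r k where *: "u = r \<otimes> a \<oplus> k" "r \<in> carrier R" "k \<in> Idl H" by blast
    have "s \<otimes> u = (s \<otimes> r) \<otimes> a \<oplus> s \<otimes> k"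
      unfolding *(1) using *(2,3) s assms(1) H.Icarr[of k] by algebra
    thus "s \<otimes> u \<in> ?J" using * s H.I_l_closed by blast
  qed
  moreover have "insert a H \<subseteq> ?J"
  proof (rule insert_subsetI)
    have "a = \<one> \<otimes> a \<oplus> \<zero>" using assms by simp
    thus "a \<in> ?J" using one_closed H.zero_closed by (intro CollectI exI conjI)
    show "H \<subseteq> ?J"
    proof
      fix x assume "x \<in> H"
      hence "x = \<zero> \<otimes> a \<oplus> x" "x \<in> Idl H" using assms genideal_self[OF assms(2)] by auto
      thus "x \<in> ?J" using zero_closed by (intro CollectI exI conjI)
    qed
  qed
  ultimately show "Idl (insert a H) \<subseteq> ?J" by (rule genideal_minimal)
  interpret Y: ideal "Idl (insert a H)" R using genideal_ideal assms by simp
  have "Idl H \<subseteq> Idl (insert a H)" using assms by (intro subset_Idl_subset genideal_self) auto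
  moreover have "a \<in> Idl (insert a H)" using genideal_self[of "insert a H"] assms by auto
  ultimately show "?J \<subseteq> Idl (insert a H)" using Y.I_l_closed Y.a_closed by blast
qed

section \<open>Maximal members of families of ideals, and associated primes\<close>

locale noetherian_cring = noetherian_ring R + cring R for R (structure)

context noetherian_cring
begin

lemma maximal_ideal_in_family:
  assumes "F \<noteq> {}" and "\<And>I. I \<in> F \<Longrightarrow> ideal I R"
  shows "\<exists>M\<in>F. \<forall>I\<in>F. M \<subseteq> I \<longrightarrow> I = M"
proof (rule subset_Zorn_nonempty[OF assms(1)])
  fix C assume "C \<noteq> {}" and C: "subset.chain F C"
  have "subset.chain {I. ideal I R} C"
    using C assms(2) unfolding subset.chain_def by blast
  hence "\<Union>C \<in> C" using ideal_chain_is_trivial[OF \<open>C \<noteq> {}\<close>] by blast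
  thus "\<Union>C \<in> F" using C unfolding subset.chain_def by blast
qed

text \<open>An ideal that is maximal among the annihilators of nonzero elements of
  \<open>R/K\<close> is prime, that is, an associated prime of \<open>R/K\<close>. New primes are
  obtained in this way throughout: above an ideal, below a prime containing a regular sequence, and
  in the chain condition for saturated ideals.\<close>

lemma exists_prime_colon:
  assumes "ideal K R" "K \<noteq> carrier R"
  obtains v where "v \<in> carrier R" "v \<notin> K" "primeideal {r \<in> carrier R. r \<otimes> v \<in> K} R"
proof -
  interpret K: ideal K R by fact
  define c where "c v = {r \<in> carrier R. r \<otimes> v \<in> K}" for v
  have ideal_c: "ideal (c v) R" if "v \<in> carrier R" for v
  proof (rule ideal_intro)
    fix a r assume "a \<in> c v" "r \<in> carrier R"
    thus "r \<otimes> a \<in> c v" using that K.I_l_closed[of "a \<otimes> v" r] by (auto simp: c_def m_assoc)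
  qed (use that in \<open>auto simp: c_def l_distr\<close>)
  have "c ` (carrier R - K) \<noteq> {}" using assms K.Icarr by blast
  hence "\<exists>M\<in>c ` (carrier R - K). \<forall>I\<in>c ` (carrier R - K). M \<subseteq> I \<longrightarrow> I = M"
    using ideal_c by (intro maximal_ideal_in_family) auto
  then obtain M where M: "M \<in> c ` (carrier R - K)"
    "\<forall>I\<in>c ` (carrier R - K). M \<subseteq> I \<longrightarrow> I = M" ..
  then obtain v where v: "v \<in> carrier R" "v \<notin> K" "M = c v" by blast
  have "primeideal (c v) R"
  proof (rule primeidealI[OF ideal_c[OF v(1)] is_cring])
    have "\<one> \<notin> c v" using v by (simp add: c_def)
    thus "carrier R \<noteq> c v" by blast
  next
    fix a b assume ab: "a \<in> carrier R" "b \<in> carrier R" "a \<otimes> b \<in> c v"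
    show "a \<in> c v \<or> b \<in> c v"
    proof (rule disjCI)
      assume "b \<notin> c v"
      hence bv: "b \<otimes> v \<in> carrier R - K" using ab v by (auto simp: c_def)
      \<comment> \<open>Since \<open>b \<otimes> v\<close> is outside \<open>K\<close>, its colon
        ideal competes with the maximal one and must coincide with it.\<close>
      have "c v \<subseteq> c (b \<otimes> v)"
      proof
        fix r assume "r \<in> c v"
        hence "r \<in> carrier R" "b \<otimes> (r \<otimes> v) \<in> K" using ab K.I_l_closed by (auto simp: c_def)
        thus "r \<in> c (b \<otimes> v)" using ab v by (simp add: c_def m_lcomm)
      qed
      hence "c (b \<otimes> v) = c v" using M(2)[THEN bspec, OF imageI[OF bv]] v(3) by simp
      moreover have "a \<in> c (b \<otimes> v)" using ab v by (simp add: c_def m_assoc)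
      ultimately show "a \<in> c v" by simp
    qed
  qed
  thus thesis using that v unfolding c_def by blast
qed

lemma exists_prime_above:
  assumes "ideal K R" "K \<noteq> carrier R"
  obtains Q where "primeideal Q R" "K \<subseteq> Q"
proof -
  interpret K: ideal K R by fact
  obtain v where v: "v \<in> carrier R" "v \<notin> K" "primeideal {r \<in> carrier R. r \<otimes> v \<in> K} R"
    using exists_prime_colon[OF assms] .
  moreover have "K \<subseteq> {r \<in> carrier R. r \<otimes> v \<in> K}" using v K.I_r_closed K.Icarr by blast
  ultimately show thesis using that by blast
qed

end

section \<open>Saturation at a prime\<close>

text \<open>For an ideal \<open>I\<close> and a prime \<open>P\<close> this is the preimage in
  \<open>A\<close> of the extension of \<open>I\<close> to the localization at
  \<open>P\<close>.\<close>

definition saturation :: "('a, 'm) ring_scheme \<Rightarrow> 'a set \<Rightarrow> 'a set \<Rightarrow> 'a set" where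
  "saturation A P I = {r \<in> carrier A. \<exists>s\<in>carrier A - P. s \<otimes>\<^bsub>A\<^esub> r \<in> I}"

locale prime_of_noetherian_cring = noetherian_cring R + P: primeideal P R
  for R (structure) and P
begin

abbreviation sat where "sat \<equiv> saturation R P"

lemma sat_ideal: assumes "ideal I R" shows "ideal (sat I) R"
proof -
  interpret I: ideal I R by fact
  show ?thesis
  proof (rule ideal_intro)
    show "sat I \<subseteq> carrier R" by (auto simp: saturation_def)
    show "\<zero> \<in> sat I" using primeideal_one_notin[OF P.primeideal]
      by (auto simp: saturation_def intro!: bexI[of _ \<one>])
  next
    fix a b assume "a \<in> sat I" "b \<in> sat I"
    then obtain s t where *: "a \<in> carrier R" "b \<in> carrier R" "s \<in> carrier R" "t \<in> carrier R"
      "s \<notin> P" "t \<notin> P" "s \<otimes> a \<in> I" "t \<otimes> b \<in> I" by (auto simp: saturation_def)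
    have "t \<otimes> (s \<otimes> a) \<oplus> s \<otimes> (t \<otimes> b) \<in> I" using * by (simp add: I.I_l_closed)
    moreover have "(s \<otimes> t) \<otimes> (a \<oplus> b) = t \<otimes> (s \<otimes> a) \<oplus> s \<otimes> (t \<otimes> b)" using * by algebra
    moreover have "s \<otimes> t \<notin> P" using * P.I_prime by blast
    ultimately show "a \<oplus> b \<in> sat I" using * by (auto simp: saturation_def intro!: bexI[of _ "s \<otimes> t"])
  next
    fix a r assume "a \<in> sat I" and r: "r \<in> carrier R"
    then obtain s where *: "a \<in> carrier R" "s \<in> carrier R" "s \<notin> P" "s \<otimes> a \<in> I"
      by (auto simp: saturation_def)
    have "r \<otimes> (s \<otimes> a) \<in> I" using * r I.I_l_closed by simp
    moreover have "r \<otimes> (s \<otimes> a) = s \<otimes> (r \<otimes> a)" using * r by algebra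
    ultimately show "r \<otimes> a \<in> sat I" using * r by (auto simp: saturation_def)
  qed
qed

lemma sat_superset: "I \<subseteq> carrier R \<Longrightarrow> I \<subseteq> sat I"
  using primeideal_one_notin[OF P.primeideal] by (auto simp: saturation_def subset_iff intro!: bexI[of _ \<one>])

lemma sat_mono: "I \<subseteq> J \<Longrightarrow> sat I \<subseteq> sat J"
  by (auto simp: saturation_def)

lemma sat_cancel:
  assumes "s \<in> carrier R" "s \<notin> P" "r \<in> carrier R" "s \<otimes> r \<in> sat I"
  shows "r \<in> sat I"
proof -
  obtain t where t: "t \<in> carrier R" "t \<notin> P" "t \<otimes> (s \<otimes> r) \<in> I"
    using assms by (auto simp: saturation_def)
  moreover have "t \<otimes> s \<notin> P" using t assms P.I_prime by blast
  ultimately show ?thesis using assms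
    by (auto simp: saturation_def m_assoc intro!: bexI[of _ "t \<otimes> s"])
qed

lemma sat_proper: "I \<subseteq> P \<Longrightarrow> sat I \<subseteq> P"
  using primeideal_mult_iff[OF P.primeideal] by (auto simp: saturation_def)

text \<open>Ideals with this property correspond one to one to the ideals of the localization at
  \<open>P\<close>, because elements outside \<open>P\<close> can be cancelled.\<close>

definition saturated where
  "saturated I \<longleftrightarrow> (\<forall>s\<in>carrier R - P. \<forall>r\<in>carrier R. s \<otimes> r \<in> I \<longrightarrow> r \<in> I)"

lemma saturatedD: "saturated I \<Longrightarrow> s \<in> carrier R \<Longrightarrow> s \<notin> P \<Longrightarrow> r \<in> carrier R \<Longrightarrow> s \<otimes> r \<in> I \<Longrightarrow> r \<in> I"
  unfolding saturated_def by blast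

lemma saturated_sat: "saturated (sat I)"
  unfolding saturated_def using sat_cancel by blast

lemma sat_eq_if_saturated: "saturated I \<Longrightarrow> I \<subseteq> carrier R \<Longrightarrow> sat I = I"
  using sat_superset unfolding saturated_def saturation_def by blast

lemma sat_minimal: "saturated J \<Longrightarrow> I \<subseteq> J \<Longrightarrow> sat I \<subseteq> J"
  unfolding saturated_def saturation_def by blast

text \<open>A descending chain condition: if no prime lies properly between \<open>K\<close> and \<open>P\<close>, then the
  localization of \<open>R/K\<close> at \<open>P\<close> is Artinian. The proof climbs from \<open>K\<close> by saturated ideals
  with simple successive quotients.\<close>

lemma saturated_chain_stabilizes:
  assumes K: "ideal K R" "saturated K"
    and min: "\<And>Q. primeideal Q R \<Longrightarrow> K \<subseteq> Q \<Longrightarrow> Q \<subseteq> P \<Longrightarrow> Q = P"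
    and I: "\<And>n. ideal (I n) R" "\<And>n. saturated (I n)" "\<And>n. K \<subseteq> I n" "\<And>n. I (Suc n) \<subseteq> I n"
  shows "\<exists>N. \<forall>n\<ge>N. I n = I N"
proof (rule ccontr)
  assume contra: "\<not> ?thesis"
  \<comment> \<open>Noetherian induction: above a maximal bad ideal \<open>L\<close> some descending
    chain is unstable, while above the slightly larger \<open>L'\<close> constructed below every
    chain becomes constant.\<close>
  define bad where "bad L \<longleftrightarrow> ideal L R \<and> saturated L \<and> K \<subseteq> L \<and>
    (\<exists>I :: nat \<Rightarrow> 'a set. (\<forall>n. ideal (I n) R \<and> saturated (I n) \<and> L \<subseteq> I n \<and> I (Suc n) \<subseteq> I n)
       \<and> \<not> (\<exists>N. \<forall>n\<ge>N. I n = I N))" for L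
  have "bad K" unfolding bad_def using K I contra by blast
  hence "\<exists>L\<in>Collect bad. \<forall>M\<in>Collect bad. L \<subseteq> M \<longrightarrow> M = L"
    by (intro maximal_ideal_in_family) (blast, simp add: bad_def)
  then obtain L where L: "bad L" "\<And>M. bad M \<Longrightarrow> L \<subseteq> M \<Longrightarrow> M = L" by auto
  then obtain J :: "nat \<Rightarrow> 'a set" where J: "\<And>n. ideal (J n) R" "\<And>n. saturated (J n)" "\<And>n. L \<subseteq> J n"
    "\<And>n. J (Suc n) \<subseteq> J n" and unstable: "\<not> (\<exists>N. \<forall>n\<ge>N. J n = J N)"
    unfolding bad_def by blast
  interpret L: ideal L R using L unfolding bad_def by blast
  have Ls: "saturated L" "K \<subseteq> L" using L unfolding bad_def by auto
  have antiJ: "J n \<subseteq> J m" if "m \<le> n" for m n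
    using J(4) that by (metis lift_Suc_antimono_le)
  have "L \<noteq> carrier R"
  proof
    assume "L = carrier R"
    hence "J n = L" for n using J(3)[of n] ideal.Icarr[OF J(1)] by blast
    thus False using unstable by blast
  qed
  then obtain v where v: "v \<in> carrier R" "v \<notin> L" "primeideal {r \<in> carrier R. r \<otimes> v \<in> L} R"
    using exists_prime_colon[OF L.is_ideal] by blast
  \<comment> \<open>By minimality the associated prime of \<open>R/L\<close> can only be
    \<open>P\<close>. Hence, after localization, \<open>v\<close> generates a copy of the residue
    field at \<open>P\<close>, and \<open>L'/L\<close> is simple.\<close>
  have "{r \<in> carrier R. r \<otimes> v \<in> L} = P"
  proof (rule min[OF v(3)])
    show "K \<subseteq> {r \<in> carrier R. r \<otimes> v \<in> L}" using Ls L.Icarr v L.I_r_closed by blast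
    show "{r \<in> carrier R. r \<otimes> v \<in> L} \<subseteq> P" using saturatedD[OF Ls(1)] v by blast
  qed
  hence Pv: "a \<in> P \<Longrightarrow> a \<otimes> v \<in> L" for a by blast
  define L' where "L' = sat (Idl (insert v L))"
  let ?W = "\<lambda>n. J n <+>\<^bsub>R\<^esub> L'"
  have carr: "insert v L \<subseteq> carrier R" using v L.Icarr by blast
  have L': "ideal L' R" "saturated L'" "insert v L \<subseteq> L'"
    unfolding L'_def using sat_ideal genideal_ideal[OF carr] saturated_sat genideal_self[OF carr]
      sat_superset[of "Idl (insert v L)"] ideal.Icarr[OF genideal_ideal[OF carr]] by blast+
  interpret L': ideal L' R by (rule L')
  have IdlL: "Idl L = L" by (rule genideal_of_ideal[OF L.is_ideal])
  \<comment> \<open>Up to a factor outside \<open>P\<close>, an element of \<open>L'\<close> is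
    \<open>a \<otimes> v\<close> modulo \<open>L\<close>. If \<open>a\<close> is in
    \<open>P\<close>, this is in \<open>L\<close>; otherwise \<open>a\<close> may be cancelled,
    which puts \<open>v\<close> into \<open>J n\<close>.\<close>
  have memL': "w \<in> L \<or> (v \<in> J n)" if w: "w \<in> J n" "w \<in> L'" for n w
  proof -
    interpret Jn: ideal "J n" R by (rule J)
    obtain s where s: "s \<in> carrier R" "s \<notin> P" "s \<otimes> w \<in> Idl (insert v L)" "w \<in> carrier R"
      using w(2) unfolding L'_def by (auto simp: saturation_def)
    then obtain a k where ak: "a \<in> carrier R" "k \<in> L" "s \<otimes> w = a \<otimes> v \<oplus> k"
      using v L.Icarr Idl_insert[of v L] IdlL by blast
    show ?thesis
    proof (cases "a \<in> P")
      case True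
      hence "s \<otimes> w \<in> L" using ak Pv by simp
      thus ?thesis using saturatedD[OF Ls(1)] s by blast
    next
      case False
      have "a \<otimes> v \<oplus> k \<in> J n" using w s ak(3) Jn.I_l_closed by metis
      hence "a \<otimes> v \<in> J n" using Jn.add_cancel_ideal ak v J(3) by blast
      thus ?thesis using saturatedD[OF J(2)] False ak v by blast
    qed
  qed
  have not_bad: "\<not> bad L'" using L(2)[of L'] L' v by blast
  have step: "ideal (sat (?W n)) R \<and> saturated (sat (?W n)) \<and>
     L' \<subseteq> sat (?W n) \<and> sat (?W (Suc n)) \<subseteq> sat (?W n)" for n
  proof (intro conjI)
    interpret Jn: ideal "J n" R by (rule J)
    have id: "ideal (?W n) R" using add_ideals[OF J(1) L'(1)] .
    show "ideal (sat (?W n)) R" using sat_ideal[OF id] .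
    have "?W n \<subseteq> sat (?W n)"
      using sat_superset ideal.Icarr[OF id] by blast
    thus "L' \<subseteq> sat (?W n)" using add_ideals_superset(2)[OF J(1) L'(1)] by (rule subset_trans[rotated])
    show "sat (?W (Suc n)) \<subseteq> sat (?W n)"
      using J(4)[of n] by (intro sat_mono) (auto simp: set_add_def')
  qed (rule saturated_sat)
  have "\<exists>N. \<forall>n\<ge>N. sat (?W n) = sat (?W N)"
  proof (rule ccontr)
    assume *: "\<not> ?thesis"
    have "bad L'" unfolding bad_def
    proof (intro conjI exI[of _ "\<lambda>n. sat (?W n)"] allI)
      show "K \<subseteq> L'" using L'(3) Ls(2) by blast
    qed (use step L'(1,2) * in simp_all)
    thus False using not_bad by blast
  qed
  then obtain N where N: "\<And>n. n \<ge> N \<Longrightarrow> sat (?W n) = sat (?W N)" by blast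
  \<comment> \<open>The chain descends, so \<open>v\<close> either lies in all members or is missing
    from some index on. This makes the intersections with \<open>L'\<close> constant after
    localization.\<close>
  obtain N' where N': "N' \<ge> N" "(\<forall>n. v \<in> J n) \<or> v \<notin> J N'"
  proof (cases "\<forall>n. v \<in> J n")
    case False
    then obtain n where "v \<notin> J n" by blast
    thus thesis using that[of "max n N"] antiJ[of n "max n N"] by auto
  qed (use that in blast)
  \<comment> \<open>Modular law: the sums with \<open>L'\<close> and the intersections with
    \<open>L'\<close> no longer change, so neither does the chain. The component \<open>l\<close> in
    \<open>L'\<close> is a difference of members of \<open>J N'\<close> and thus falls under
    \<open>memL'\<close>.\<close>
  have "J N' \<subseteq> J n" if n: "n \<ge> N'" for n
  proof
    fix w assume w: "w \<in> J N'"
    interpret Jn: ideal "J n" R by (rule J)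
    interpret JN: ideal "J N'" R by (rule J)
    have wc: "w \<in> carrier R" using w JN.Icarr by blast
    have "w \<in> ?W N'" using w add_ideals_superset(1)[OF J(1) L'(1)] by blast
    hence "w \<in> sat (?W N')"
      using sat_superset[of "?W N'"] ideal.Icarr[OF add_ideals[OF J(1) L'(1)]] by blast
    hence "w \<in> sat (?W n)" using N[of N'] N[of n] N' n by simp
    then obtain s j l where s: "s \<in> carrier R" "s \<notin> P" "j \<in> J n" "l \<in> L'" "s \<otimes> w = j \<oplus> l"
      by (auto simp: saturation_def set_add_def')
    have jN: "j \<in> J N'" using antiJ[OF n] s by blast
    have "l \<oplus> j = s \<otimes> w" using s(5) a_comm Jn.Icarr[OF s(3)] L'.Icarr[OF s(4)] by simp
    hence "l \<oplus> j \<in> J N'" using s(1) w JN.I_l_closed by simp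
    hence l: "l \<in> J N'" using JN.add_cancel_ideal jN L'.Icarr s by blast
    have "l \<in> J n"
    proof (cases "\<forall>n. v \<in> J n")
      case True
      have "insert v L \<subseteq> J n" using True J(3) by blast
      hence "L' \<subseteq> J n" unfolding L'_def using sat_minimal[OF J(2)] genideal_minimal[OF J(1)] by blast
      thus ?thesis using s by blast
    next
      case False
      thus ?thesis using memL'[OF l s(4)] N' J(3) by blast
    qed
    hence "s \<otimes> w \<in> J n" using s by simp
    thus "w \<in> J n" using saturatedD[OF J(2)] s wc by blast
  qed
  hence "J n = J N'" if "n \<ge> N'" for n using antiJ[OF that] that by blast
  thus False using unstable by blast
qed

text \<open>Nakayama's lemma at \<open>P\<close>: locally \<open>M\<close> is contained in
  \<open>N + xM\<close> with \<open>x\<close> in \<open>P\<close>. Take a saturated \<open>L\<close>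
  maximal among those containing \<open>N\<close> but not \<open>M\<close>. If \<open>xM\<close>
  lies in \<open>L\<close>, so does \<open>M\<close>. Otherwise adjoining some
  \<open>x \<otimes> m\<close> outside \<open>L\<close> swallows \<open>M\<close>, in particular
  \<open>m\<close>; this gives \<open>(s \<ominus> a \<otimes> x) \<otimes> m \<in> L\<close>, where
  the factor is outside \<open>P\<close> and can be cancelled.\<close>

lemma saturated_Nakayama:
  assumes M: "M \<subseteq> carrier R" and N: "ideal N R" and x: "x \<in> P"
    and MN: "\<And>r. r \<in> M \<Longrightarrow> \<exists>s\<in>carrier R - P. \<exists>b\<in>N. \<exists>a\<in>M. s \<otimes> r = b \<oplus> x \<otimes> a"
  shows "M \<subseteq> sat N"
proof (rule ccontr)
  assume "\<not> M \<subseteq> sat N"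
  define F where "F = {L. ideal L R \<and> saturated L \<and> N \<subseteq> L \<and> \<not> M \<subseteq> L}"
  interpret N: ideal N R by fact
  have "sat N \<in> F" unfolding F_def
    using sat_ideal[OF N] saturated_sat sat_superset[of N] N.Icarr \<open>\<not> M \<subseteq> sat N\<close> by blast
  hence "\<exists>L\<in>F. \<forall>J\<in>F. L \<subseteq> J \<longrightarrow> J = L"
    by (intro maximal_ideal_in_family) (auto simp: F_def)
  then obtain L where L: "L \<in> F" "\<And>J. J \<in> F \<Longrightarrow> L \<subseteq> J \<Longrightarrow> J = L" by blast
  hence L': "ideal L R" "saturated L" "N \<subseteq> L" "\<not> M \<subseteq> L" unfolding F_def by auto
  interpret L: ideal L R by (rule L')
  have xc: "x \<in> carrier R" using x P.Icarr by blast
  show False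
  proof (cases "\<forall>m\<in>M. x \<otimes> m \<in> L")
    case True
    have "r \<in> L" if r: "r \<in> M" for r
    proof -
      obtain s b a where "s \<in> carrier R - P" "b \<in> N" "a \<in> M" "s \<otimes> r = b \<oplus> x \<otimes> a"
        using MN[OF r] by blast
      moreover from this have "s \<otimes> r \<in> L" using True L'(3) by auto
      ultimately show "r \<in> L" using saturatedD[OF L'(2)] r M by blast
    qed
    thus False using L'(4) by blast
  next
    case False
    then obtain m where m: "m \<in> M" "x \<otimes> m \<notin> L" by blast
    have mc: "m \<in> carrier R" using m M by blast
    define J where "J = sat (Idl (insert (x \<otimes> m) L))"
    have carr: "insert (x \<otimes> m) L \<subseteq> carrier R" using mc xc L.Icarr by blast
    have J: "ideal J R" "saturated J" "insert (x \<otimes> m) L \<subseteq> J"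
      unfolding J_def using sat_ideal genideal_ideal[OF carr] saturated_sat genideal_self[OF carr]
        sat_superset[of "Idl (insert (x \<otimes> m) L)"] ideal.Icarr[OF genideal_ideal[OF carr]] by blast+
    have "J \<notin> F" using L(2)[of J] J(3) m by blast
    hence "m \<in> J" using J m L'(3) unfolding F_def by blast
    then obtain s where s: "s \<in> carrier R" "s \<notin> P" "s \<otimes> m \<in> Idl (insert (x \<otimes> m) L)"
      unfolding J_def by (auto simp: saturation_def)
    have "Idl L = L" by (rule genideal_of_ideal[OF L.is_ideal])
    then obtain a k where ak: "a \<in> carrier R" "k \<in> L" "s \<otimes> m = a \<otimes> (x \<otimes> m) \<oplus> k"
      using s(3) Idl_insert[of "x \<otimes> m" L] carr by auto
    have kc: "k \<in> carrier R" using ak L.Icarr by blast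
    have "(s \<ominus> a \<otimes> x) \<otimes> m = s \<otimes> m \<ominus> a \<otimes> (x \<otimes> m)" using s(1) ak(1) mc xc by algebra
    also have "\<dots> = k" unfolding ak(3) using ak(1) mc xc kc by algebra
    finally have "(s \<ominus> a \<otimes> x) \<otimes> m \<in> L" using ak by simp
    moreover have "s \<ominus> a \<otimes> x \<notin> P"
    proof
      assume "s \<ominus> a \<otimes> x \<in> P"
      moreover have "a \<otimes> x \<in> P" using P.I_l_closed x ak by blast
      ultimately have "(s \<ominus> a \<otimes> x) \<oplus> a \<otimes> x \<in> P" by simp
      moreover have "(s \<ominus> a \<otimes> x) \<oplus> a \<otimes> x = s" using s ak xc by algebra
      ultimately show False using s by simp
    qed
    moreover have "s \<ominus> a \<otimes> x \<in> carrier R" using s(1) ak(1) xc by simp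
    ultimately have "m \<in> L" using saturatedD[OF L'(2)] mc by blast
    thus False using m L.I_l_closed xc by blast
  qed
qed

end

section \<open>Prime chains through prescribed elements\<close>

context noetherian_cring
begin

text \<open>Krull's principal ideal theorem in disguise. With \<open>y \<in> Q - Q\<^sub>0\<close>, the contractions \<open>J n\<close>
  to \<open>R\<close> of the ideals \<open>y\<^sup>n\<close> in the localization of \<open>R/Q\<^sub>0\<close> at \<open>Q\<close> play the role of symbolic
  powers.\<close>

lemma prime_between_containing:
  assumes Q0: "primeideal Q0 R" and Q: "primeideal Q R" and P: "primeideal P R"
    and "Q0 \<subset> Q" "Q \<subset> P" and x: "x \<in> P"
  shows "\<exists>Q'. primeideal Q' R \<and> Q0 \<subset> Q' \<and> Q' \<subset> P \<and> x \<in> Q'"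
proof (rule ccontr)
  assume none: "\<not> ?thesis"
  interpret Q0: primeideal Q0 R by fact
  interpret Q: primeideal Q R by fact
  interpret P: prime_of_noetherian_cring R P
    using P noetherian_cring_axioms by (simp add: prime_of_noetherian_cring_def)
  have xQ: "x \<notin> Q" using none Q assms by blast
  have xc: "x \<in> carrier R" using x P.P.Icarr by blast
  obtain y where y: "y \<in> Q" "y \<notin> Q0" using assms by blast
  have yc: "y \<in> carrier R" using y Q.Icarr by blast
  define J where "J n = {r \<in> carrier R. \<exists>t\<in>carrier R - Q. \<exists>a\<in>carrier R. \<exists>q\<in>Q0.
    t \<otimes> r = a \<otimes> y [^] n \<oplus> q}" for n :: nat
  have J_I: "r \<in> J n" if "r \<in> carrier R" "t \<in> carrier R" "t \<notin> Q" "a \<in> carrier R" "q \<in> Q0"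
    "t \<otimes> r = a \<otimes> y [^] n \<oplus> q" for r t a q n
    using that unfolding J_def by blast
  have J_E: "\<exists>t a q. t \<in> carrier R \<and> t \<notin> Q \<and> a \<in> carrier R \<and> q \<in> Q0 \<and>
    t \<otimes> r = a \<otimes> y [^] n \<oplus> q" if "r \<in> J n" for r n
    using that unfolding J_def by blast
  have J_carrier: "J n \<subseteq> carrier R" for n by (auto simp: J_def)
  have J_ideal: "ideal (J n) R" for n
  proof (rule ideal_intro)
    show "J n \<subseteq> carrier R" by (auto simp: J_def)
    have "\<one> \<otimes> \<zero> = \<zero> \<otimes> y [^] n \<oplus> \<zero>" using yc by simp
    thus "\<zero> \<in> J n"
      by (rule J_I[OF zero_closed one_closed primeideal_one_notin[OF Q] zero_closed Q0.zero_closed])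
  next
    fix r r' assume r: "r \<in> J n" "r' \<in> J n"
    obtain t a q where 1: "t \<in> carrier R" "t \<notin> Q" "a \<in> carrier R" "q \<in> Q0"
      "t \<otimes> r = a \<otimes> y [^] n \<oplus> q" using J_E[OF r(1)] by blast
    obtain t' a' q' where 2: "t' \<in> carrier R" "t' \<notin> Q" "a' \<in> carrier R" "q' \<in> Q0"
      "t' \<otimes> r' = a' \<otimes> y [^] n \<oplus> q'" using J_E[OF r(2)] by blast
    have rr: "r \<in> carrier R" "r' \<in> carrier R" using r J_carrier by blast+
    note * = rr 1(1) 2(1) 1(3) 2(3) 1(2) 2(2) 1(4) 2(4) 1(5) 2(5)
    have qc: "q \<in> carrier R" "q' \<in> carrier R" "y [^] n \<in> carrier R" using * Q0.Icarr yc by auto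
    have "(t' \<otimes> t) \<otimes> (r \<oplus> r') = t' \<otimes> (t \<otimes> r) \<oplus> t \<otimes> (t' \<otimes> r')" using *(1-4) by algebra
    also have "\<dots> = (t' \<otimes> a \<oplus> t \<otimes> a') \<otimes> y [^] n \<oplus> (t' \<otimes> q \<oplus> t \<otimes> q')"
      unfolding *(11,12) using *(1-6) qc by algebra
    finally have "(t' \<otimes> t) \<otimes> (r \<oplus> r') = (t' \<otimes> a \<oplus> t \<otimes> a') \<otimes> y [^] n \<oplus> (t' \<otimes> q \<oplus> t \<otimes> q')" .
    moreover have "t' \<otimes> t \<in> carrier R" "t' \<otimes> t \<notin> Q" using * primeideal_mult_iff[OF Q] by simp_all
    moreover have "t' \<otimes> a \<oplus> t \<otimes> a' \<in> carrier R" using * by simp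
    moreover have "t' \<otimes> q \<oplus> t \<otimes> q' \<in> Q0" using * by (simp add: Q0.I_l_closed)
    moreover have "r \<oplus> r' \<in> carrier R" using * by simp
    ultimately show "r \<oplus> r' \<in> J n" by (intro J_I)
  next
    fix r s assume "r \<in> J n" and s: "s \<in> carrier R"
    then obtain t a q where *: "r \<in> carrier R" "t \<in> carrier R" "a \<in> carrier R"
      "t \<notin> Q" "q \<in> Q0" "t \<otimes> r = a \<otimes> y [^] n \<oplus> q"
      using J_E[of r n] J_carrier by blast
    have qc: "q \<in> carrier R" "y [^] n \<in> carrier R" using * Q0.Icarr yc by auto
    have "t \<otimes> (s \<otimes> r) = s \<otimes> (t \<otimes> r)" using *(1-3) s by algebra
    also have "\<dots> = (s \<otimes> a) \<otimes> y [^] n \<oplus> s \<otimes> q" unfolding *(6) using *(1-3) qc s by algebra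
    finally have "t \<otimes> (s \<otimes> r) = (s \<otimes> a) \<otimes> y [^] n \<oplus> s \<otimes> q" .
    moreover have "s \<otimes> q \<in> Q0" using * s by (simp add: Q0.I_l_closed)
    moreover have "s \<otimes> r \<in> carrier R" "s \<otimes> a \<in> carrier R" using * s by auto
    ultimately show "s \<otimes> r \<in> J n" using *(2,4) by (intro J_I)
  qed
  have J_sat: "r \<in> J n" if "s \<in> carrier R" "s \<notin> Q" "r \<in> carrier R" and sr: "s \<otimes> r \<in> J n" for s r n
  proof -
    obtain t a q where *: "t \<in> carrier R" "t \<notin> Q" "a \<in> carrier R" "q \<in> Q0"
      "t \<otimes> (s \<otimes> r) = a \<otimes> y [^] n \<oplus> q" using J_E[OF sr] by blast
    have "(t \<otimes> s) \<otimes> r = a \<otimes> y [^] n \<oplus> q" using * that by (simp add: m_assoc)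
    moreover have "t \<otimes> s \<in> carrier R" "t \<otimes> s \<notin> Q" using * that primeideal_mult_iff[OF Q] by simp_all
    ultimately show ?thesis using *(3,4) that(3) by (intro J_I)
  qed
  have J_saturated: "P.saturated (J n)" for n
    unfolding P.saturated_def using J_sat assms(5) by blast
  have J_Suc: "J (Suc n) \<subseteq> J n" for n
  proof
    fix r assume "r \<in> J (Suc n)"
    then obtain t a q where *: "r \<in> carrier R" "t \<in> carrier R" "t \<notin> Q" "a \<in> carrier R" "q \<in> Q0"
      "t \<otimes> r = a \<otimes> y [^] Suc n \<oplus> q" using J_E[of r "Suc n"] J_carrier by blast
    have "t \<otimes> r = (a \<otimes> y) \<otimes> y [^] n \<oplus> q" using * yc by (simp add: m_ac)
    moreover have "a \<otimes> y \<in> carrier R" using * yc by simp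
    ultimately show "r \<in> J n" using *(1-3,5) by (intro J_I)
  qed
  have Q0_J: "Q0 \<subseteq> J n" for n
  proof
    fix q assume q: "q \<in> Q0"
    hence "\<one> \<otimes> q = \<zero> \<otimes> y [^] n \<oplus> q" "q \<in> carrier R" using yc Q0.Icarr by auto
    thus "q \<in> J n"
      using primeideal_one_notin[OF Q] one_closed zero_closed q by (intro J_I)
  qed
  let ?W = "\<lambda>K. K <+>\<^bsub>R\<^esub> Idl {x}"
  have Px: "ideal (Idl {x}) R" using genideal_ideal xc by simp
  define K where "K = P.sat (?W Q0)"
  define I where "I n = P.sat (?W (J n))" for n
  have sumQ0: "ideal (?W Q0) R" using add_ideals[OF Q0.is_ideal Px] .
  have sumJ: "ideal (?W (J n)) R" for n using add_ideals[OF J_ideal Px] .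
  have ideal_sub: "U \<subseteq> carrier R" if "ideal U R" for U using ideal.Icarr[OF that] by (rule subsetI)
  have add_mono: "U <+>\<^bsub>R\<^esub> W \<subseteq> V <+>\<^bsub>R\<^esub> W" if "U \<subseteq> V" for U V W
    using that by (auto simp: set_add_def')
  \<comment> \<open>If no prime as claimed exists, then \<open>P\<close> is the only prime between
    \<open>K\<close> and \<open>P\<close>: such a prime contains \<open>Q0\<close> and
    \<open>x\<close>, and differs from \<open>Q0\<close> because \<open>x\<close> is not even in
    \<open>Q\<close>. So the chain condition applies to the symbolic powers modulo
    \<open>x\<close>.\<close>
  have "\<exists>N. \<forall>n\<ge>N. I n = I N"
  proof (rule P.saturated_chain_stabilizes)
    show "ideal K R" "P.saturated K" "ideal (I n) R" "P.saturated (I n)" for n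
      unfolding K_def I_def using P.sat_ideal sumQ0 sumJ P.saturated_sat by blast+
    show "K \<subseteq> I n" "I (Suc n) \<subseteq> I n" for n
      unfolding K_def I_def by (intro P.sat_mono add_mono Q0_J J_Suc)+
    fix Q' assume Q': "primeideal Q' R" "K \<subseteq> Q'" "Q' \<subseteq> P"
    have "?W Q0 \<subseteq> Q'"
      using Q'(2) P.sat_superset[of "?W Q0"] ideal.Icarr[OF sumQ0] unfolding K_def by blast
    hence "Q0 \<subseteq> Q'" "x \<in> Q'"
      using add_ideals_superset[OF Q0.is_ideal Px] genideal_self'[OF xc] by blast+
    moreover from this have "Q0 \<noteq> Q'" using xQ assms(4) by blast
    ultimately show "Q' = P" using none Q' by blast
  qed
  then obtain n where n: "I (Suc n) = I n" by (metis le_Suc_eq order_refl)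
  \<comment> \<open>Stability modulo \<open>x\<close> says that, up to a factor outside
    \<open>P\<close>, an element of \<open>J n\<close> is \<open>j \<oplus> a \<otimes> x\<close>
    with \<open>j\<close> in \<open>J (Suc n)\<close>. As \<open>x\<close> is outside
    \<open>Q\<close>, it can be cancelled from \<open>a \<otimes> x \<in> J n\<close>; hence
    \<open>a\<close> is again in \<open>J n\<close> and Nakayama applies.\<close>
  have "J n \<subseteq> P.sat (J (Suc n))"
  proof (rule P.saturated_Nakayama[OF _ J_ideal x])
    show "J n \<subseteq> carrier R" by (auto simp: J_def)
    fix r assume r: "r \<in> J n"
    interpret Jn: ideal "J n" R by (rule J_ideal)
    have "J n \<subseteq> I n" unfolding I_def
      using add_ideals_superset(1)[OF J_ideal Px] P.sat_superset[OF ideal_sub[OF sumJ]]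
      by (rule subset_trans)
    hence "r \<in> I (Suc n)" using r n by blast
    then obtain s j b where s: "s \<in> carrier R" "s \<notin> P" "j \<in> J (Suc n)" "b \<in> Idl {x}"
      "s \<otimes> r = j \<oplus> b"
      unfolding I_def by (auto simp: saturation_def set_add_def')
    then obtain a where a: "a \<in> carrier R" "b = a \<otimes> x"
      using cgenideal_eq_genideal[OF xc] unfolding cgenideal_def by auto
    have jn: "j \<in> J n" using s J_Suc by blast
    have bc: "b \<in> carrier R" using a xc by simp
    have "b \<oplus> j \<in> J n" using s(5) Jn.I_l_closed[OF r s(1)] a_comm[OF bc Jn.Icarr[OF jn]] by simp
    hence "b \<in> J n" using Jn.add_cancel_ideal jn bc by blast
    hence "a \<in> J n" using J_sat[OF xc xQ, of a n] a xc by (simp add: m_comm)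
    moreover have "s \<otimes> r = j \<oplus> x \<otimes> a" using s(5) a xc by (simp add: m_comm)
    ultimately show "\<exists>s\<in>carrier R - P. \<exists>b\<in>J (Suc n). \<exists>a\<in>J n. s \<otimes> r = b \<oplus> x \<otimes> a"
      using s by blast
  qed
  also have "P.sat (J (Suc n)) = J (Suc n)"
    by (rule P.sat_eq_if_saturated[OF J_saturated]) (auto simp: J_def)
  finally have Jn: "J n \<subseteq> J (Suc n)" .
  \<comment> \<open>Equality of two consecutive symbolic powers is absurd: it yields
    \<open>y [^] n \<otimes> (t \<ominus> a \<otimes> y) \<in> Q0\<close> with \<open>t\<close>
    outside \<open>Q\<close>, and since \<open>y\<close> is not in the prime \<open>Q0\<close>, the
    second factor is in \<open>Q0\<close>, which forces \<open>t\<close> into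
    \<open>Q\<close>.\<close>
  have "\<one> \<otimes> y [^] n = \<one> \<otimes> y [^] n \<oplus> \<zero>" "y [^] n \<in> carrier R" using yc by auto
  hence "y [^] n \<in> J n"
    using primeideal_one_notin[OF Q] one_closed Q0.zero_closed by (intro J_I)
  hence "y [^] n \<in> J (Suc n)" using Jn by blast
  then obtain t a q where *: "t \<in> carrier R" "t \<notin> Q" "a \<in> carrier R" "q \<in> Q0"
      "t \<otimes> y [^] n = a \<otimes> y [^] Suc n \<oplus> q" using J_E by blast
  have pc: "y [^] n \<in> carrier R" "q \<in> carrier R" using yc * Q0.Icarr by auto
  have "y [^] n \<otimes> (t \<ominus> a \<otimes> y) = t \<otimes> y [^] n \<ominus> a \<otimes> (y [^] n \<otimes> y)" using *(1,3) pc yc by algebra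
  also have "\<dots> = (a \<otimes> (y [^] n \<otimes> y) \<oplus> q) \<ominus> a \<otimes> (y [^] n \<otimes> y)" using *(5) by simp
  also have "\<dots> = q" using *(3) pc yc by algebra
  finally have "y [^] n \<otimes> (t \<ominus> a \<otimes> y) \<in> Q0" using * by simp
  hence "y [^] n \<in> Q0 \<or> t \<ominus> a \<otimes> y \<in> Q0"
    using primeideal_mult_iff[OF Q0] pc * yc by simp
  hence "t \<ominus> a \<otimes> y \<in> Q" using primeideal_pow_iff[OF Q0 yc] y(2) assms(4) by blast
  hence "(t \<ominus> a \<otimes> y) \<oplus> a \<otimes> y \<in> Q" using y *(3) by (simp add: Q.I_l_closed)
  moreover have "(t \<ominus> a \<otimes> y) \<oplus> a \<otimes> y = t" using *(1,3) yc by algebra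
  ultimately show False using * by simp
qed

end

section \<open>Modifying chains of primes\<close>

lemma primeideal_subset: "primeideal P A \<Longrightarrow> P \<subseteq> carrier A"
  using ideal.Icarr[of P A] by (auto simp: primeideal_def)

lemma prime_chain_singleton: "primeideal P A \<Longrightarrow> prime_chain A [P]"
  by (simp add: prime_chain_def)

lemma prime_chain_Cons:
  "prime_chain A (P # Q # Ps) \<longleftrightarrow> primeideal P A \<and> P \<subset> Q \<and> prime_chain A (Q # Ps)"
  by (fastforce simp: prime_chain_def)

lemma prime_chain_snoc:
  assumes "prime_chain A Ps" "primeideal Q A" "last Ps \<subset> Q"
  shows "prime_chain A (Ps @ [Q])"
proof -
  obtain Qs L where Ps: "Ps = Qs @ [L]" using assms(1) by (cases Ps rule: rev_cases) (auto simp: prime_chain_def)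
  thus ?thesis using assms by (fastforce simp: prime_chain_def sorted_wrt_append)
qed

lemma prime_chain_hd_subset:
  assumes "prime_chain A Ps" "P \<in> set Ps" shows "hd Ps \<subseteq> P"
  using assms by (cases Ps) (auto simp: prime_chain_def)

lemma prime_chain_subset_last:
  assumes "prime_chain A Ps" "P \<in> set Ps" shows "P \<subseteq> last Ps"
proof -
  obtain Qs L where Ps: "Ps = Qs @ [L]" using assms(1) by (cases Ps rule: rev_cases) (auto simp: prime_chain_def)
  thus ?thesis using assms by (auto simp: prime_chain_def sorted_wrt_append)
qed

lemma prime_chain_map:
  assumes "prime_chain A Ps" "\<And>P. P \<in> set Ps \<Longrightarrow> primeideal (f P) B"
    and "\<And>P Q. P \<in> set Ps \<Longrightarrow> Q \<in> set Ps \<Longrightarrow> P \<subset> Q \<Longrightarrow> f P \<subset> f Q"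
  shows "prime_chain B (map f Ps)"
proof -
  have "sorted_wrt (\<lambda>x y. f x \<subset> f y) Ps"
    using assms(1) sorted_wrt_mono_rel[of Ps "(\<subset>)" "\<lambda>x y. f x \<subset> f y"] assms(3)
    unfolding prime_chain_def by blast
  thus ?thesis using assms(1,2) by (auto simp: prime_chain_def sorted_wrt_map)
qed

context noetherian_cring
begin

text \<open>The element \<open>x\<close> is pushed down from the top: once the third member contains
  it, the second can be exchanged for a prime between its neighbours that contains it as
  well.\<close>

lemma prime_chain_second_contains:
  assumes "prime_chain R (P # Q # Ps)" "x \<in> last (Q # Ps)"
  shows "\<exists>Q' Ps'. prime_chain R (P # Q' # Ps') \<and> length Ps' = length Ps \<and>
    last (Q' # Ps') = last (Q # Ps) \<and> x \<in> Q'"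
  using assms
proof (induction Ps arbitrary: P Q)
  case Nil
  thus ?case by (intro exI[of _ Q] exI[of _ "[]"]) simp
next
  case (Cons L Ps)
  have PQ: "primeideal P R" "P \<subset> Q" "prime_chain R (Q # L # Ps)" "x \<in> last (L # Ps)"
    using Cons.prems unfolding prime_chain_Cons[of R P] by simp_all
  obtain L' Ps' where *: "prime_chain R (Q # L' # Ps')" "length Ps' = length Ps"
    "last (L' # Ps') = last (L # Ps)" "x \<in> L'"
    using Cons.IH[OF PQ(3,4)] by blast
  hence "primeideal Q R" "primeideal L' R" "Q \<subset> L'"
    unfolding prime_chain_Cons by (auto simp: prime_chain_def)
  then obtain Q' where "primeideal Q' R" "P \<subset> Q'" "Q' \<subset> L'" "x \<in> Q'"
    using prime_between_containing PQ(1,2) *(4) by meson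
  thus ?case using * PQ
    by (intro exI[of _ Q'] exI[of _ "L' # Ps'"]) (simp add: prime_chain_Cons)
qed

text \<open>Each element of \<open>B\<close> costs at most one member: when the second member has
  been made to contain \<open>x\<close>, the first one is dropped. The new head still contains the
  old one and hence the elements treated before.\<close>

lemma prime_chain_containing:
  assumes "prime_chain R Ps" "finite B" "B \<subseteq> last Ps"
  shows "\<exists>Qs. prime_chain R Qs \<and> last Qs = last Ps \<and> length Ps \<le> length Qs + card B \<and>
    hd Ps \<subseteq> hd Qs \<and> B \<subseteq> hd Qs"
  using assms(2,3)
proof (induction B)
  case empty
  thus ?case using assms(1) by auto
next
  case (insert x B)
  then obtain Qs where Qs: "prime_chain R Qs" "last Qs = last Ps"
    "length Ps \<le> length Qs + card B" "hd Ps \<subseteq> hd Qs" "B \<subseteq> hd Qs" by auto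
  have x: "x \<in> last Qs" using insert Qs by simp
  consider P where "Qs = [P]" | P Q Ps' where "Qs = P # Q # Ps'"
    using Qs by (metis prime_chain_def remdups_adj.cases)
  thus ?case
  proof cases
    \<comment> \<open>A single prime is the last member and contains \<open>x\<close> already;
      nothing is dropped.\<close>
    case 1
    thus ?thesis using Qs x insert by (intro exI[of _ Qs]) auto
  next
    case 2
    then obtain Q' Ps'' where *: "prime_chain R (P # Q' # Ps'')" "length Ps'' = length Ps'"
      "last (Q' # Ps'') = last Qs" "x \<in> Q'"
      using prime_chain_second_contains[of P Q Ps' x] Qs x by auto
    hence "P \<subset> Q'" "prime_chain R (Q' # Ps'')" by (auto simp: prime_chain_Cons)
    thus ?thesis using * 2 Qs insert by (intro exI[of _ "Q' # Ps''"]) auto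
  qed
qed

end

section \<open>Regular sequences and heights\<close>

lemma (in ideal) carrier_Quot: "carrier (R Quot I) = (+>) I ` carrier R"
  by (auto simp: FactRing_simps)

lemma (in ideal) zero_Quot: "\<zero>\<^bsub>R Quot I\<^esub> = I"
  by (simp add: FactRing_def)

lemma (in ideal) nonzerodivisor_Quot_iff:
  assumes "cring R" "a \<in> carrier R"
  shows "nonzerodivisor (R Quot I) (I +> a) \<longleftrightarrow> (\<forall>b\<in>carrier R. a \<otimes> b \<in> I \<longrightarrow> b \<in> I)"
proof -
  have eq: "I +> b = I \<longleftrightarrow> b \<in> I" if "b \<in> carrier R" for b
    using that a_rcos_zero[OF is_ideal] rcos_const_imp_mem by blast
  have carr: "carrier (R Quot I) = (+>) I ` carrier R"
    by (rule carrier_Quot)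
  have "I +> a \<in> carrier (R Quot I)" using carr assms(2) by simp
  moreover have "(I +> a) \<otimes>\<^bsub>R Quot I\<^esub> (I +> b) = I +> (a \<otimes> b)" if "b \<in> carrier R" for b
    using that assms(2) rcos_ring_hom by (simp add: ring_hom_mult)
  ultimately show ?thesis unfolding nonzerodivisor_def carr zero_Quot using assms(2) by (simp add: eq)
qed

lemma (in cring) regular_sequence_iff:
  "regular_sequence R xs \<longleftrightarrow> set xs \<subseteq> carrier R \<and> Idl (set xs) \<noteq> carrier R \<and>
     (\<forall>i<length xs. \<forall>b\<in>carrier R. xs ! i \<otimes> b \<in> Idl (set (take i xs)) \<longrightarrow> b \<in> Idl (set (take i xs)))"
proof (cases "set xs \<subseteq> carrier R")
  case True
  have "nonzerodivisor (R Quot Idl (set (take i xs))) (Idl (set (take i xs)) +> xs ! i) \<longleftrightarrow>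
    (\<forall>b\<in>carrier R. xs ! i \<otimes> b \<in> Idl (set (take i xs)) \<longrightarrow> b \<in> Idl (set (take i xs)))"
    if "i < length xs" for i
  proof (rule ideal.nonzerodivisor_Quot_iff[OF genideal_ideal is_cring])
    show "set (take i xs) \<subseteq> carrier R" using True set_take_subset by fast
    show "xs ! i \<in> carrier R" using that True nth_mem by blast
  qed
  thus ?thesis unfolding regular_sequence_def Let_def by auto
qed (simp add: regular_sequence_def)

lemma (in cring) regular_sequence_snocD:
  assumes "regular_sequence R (xs @ [a])"
  shows "regular_sequence R xs"
    and "b \<in> carrier R \<Longrightarrow> a \<otimes> b \<in> Idl (set xs) \<Longrightarrow> b \<in> Idl (set xs)"
proof -
  have *: "set (xs @ [a]) \<subseteq> carrier R" "Idl (set (xs @ [a])) \<noteq> carrier R"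
    "\<And>i b. i < length (xs @ [a]) \<Longrightarrow> b \<in> carrier R \<Longrightarrow> (xs @ [a]) ! i \<otimes> b \<in> Idl (set (take i (xs @ [a])))
      \<Longrightarrow> b \<in> Idl (set (take i (xs @ [a])))"
    using assms unfolding regular_sequence_iff by blast+
  show "b \<in> carrier R \<Longrightarrow> a \<otimes> b \<in> Idl (set xs) \<Longrightarrow> b \<in> Idl (set xs)"
    using *(3)[of "length xs" b] by simp
  have "Idl (set xs) \<noteq> carrier R"
  proof
    assume "Idl (set xs) = carrier R"
    moreover have "Idl (set xs) \<subseteq> Idl (set (xs @ [a]))"
      using *(1) genideal_self[OF *(1)] by (intro subset_Idl_subset) auto
    ultimately show False using *(2) ideal.Icarr[OF genideal_ideal[OF *(1)]] by blast
  qed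
  moreover have "xs ! i \<otimes> b \<in> Idl (set (take i xs)) \<longrightarrow> b \<in> Idl (set (take i xs))"
    if "i < length xs" "b \<in> carrier R" for i b
    using *(3)[of i b] that by (simp add: nth_append)
  ultimately show "regular_sequence R xs" unfolding regular_sequence_iff using *(1) by auto
qed

context noetherian_cring
begin

text \<open>The last term \<open>a\<close> is a nonzerodivisor modulo its predecessors and so avoids
  the associated primes of the ideal they generate. Saturating this ideal at \<open>P\<close> first
  forces the associated prime found to lie inside \<open>P\<close>; as it misses \<open>a\<close>,
  it is strictly smaller, and the induction continues below it.\<close>

lemma prime_chain_of_regular_sequence:
  assumes "regular_sequence R xs" "primeideal P R" "set xs \<subseteq> P"
  shows "\<exists>Ps. prime_chain R Ps \<and> last Ps = P \<and> length Ps = Suc (length xs)"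
  using assms
proof (induction xs arbitrary: P rule: rev_induct)
  case Nil
  thus ?case by (intro exI[of _ "[P]"]) (simp add: prime_chain_singleton)
next
  case (snoc a xs)
  interpret P: prime_of_noetherian_cring R P
    using snoc.prems noetherian_cring_axioms by (simp add: prime_of_noetherian_cring_def)
  note reg = regular_sequence_snocD[OF snoc.prems(1)]
  have carr: "set xs \<subseteq> carrier R" "a \<in> carrier R" and aP: "a \<in> P"
    using snoc.prems by (auto simp: regular_sequence_def)
  define K where "K = P.sat (Idl (set xs))"
  have K: "ideal K R" "P.saturated K" "Idl (set xs) \<subseteq> K"
    unfolding K_def using P.sat_ideal genideal_ideal[OF carr(1)] P.saturated_sat P.sat_superset
      ideal.Icarr[OF genideal_ideal[OF carr(1)]] by blast+
  interpret K: ideal K R by (rule K)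
  have "K \<subseteq> P" unfolding K_def
    using snoc.prems(3) by (intro P.sat_proper genideal_minimal P.P.is_ideal) auto
  hence "K \<noteq> carrier R" using P.P.I_notcarr P.P.Icarr by blast
  then obtain v where v: "v \<in> carrier R" "v \<notin> K" "primeideal {r \<in> carrier R. r \<otimes> v \<in> K} R"
    using exists_prime_colon[OF K(1)] by blast
  let ?Q = "{r \<in> carrier R. r \<otimes> v \<in> K}"
  have "?Q \<subseteq> P" using P.saturatedD[OF K(2)] v by blast
  moreover have "a \<notin> ?Q"
  proof
    assume "a \<in> ?Q"
    then obtain s where s: "s \<in> carrier R" "s \<notin> P" "s \<otimes> (a \<otimes> v) \<in> Idl (set xs)"
      unfolding K_def by (auto simp: saturation_def)
    hence "a \<otimes> (s \<otimes> v) \<in> Idl (set xs)" using carr v by (simp add: m_lcomm)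
    hence "s \<otimes> v \<in> Idl (set xs)" using reg(2)[of "s \<otimes> v"] s v by simp
    hence "s \<otimes> v \<in> K" using K by blast
    thus False using P.saturatedD[OF K(2)] s v by blast
  qed
  ultimately have "?Q \<subset> P" using aP by blast
  moreover have "set xs \<subseteq> ?Q"
    using K.I_r_closed K(3) genideal_self[OF carr(1)] carr v by blast
  then obtain Ps where "prime_chain R Ps" "last Ps = ?Q" "length Ps = Suc (length xs)"
    using snoc.IH[OF reg(1) v(3)] by blast
  ultimately show ?case using prime_chain_snoc[of R Ps P] snoc.prems(2)
    by (intro exI[of _ "Ps @ [P]"]) auto
qed

lemma regular_sequence_length_le_height:
  assumes "regular_sequence R xs" "set xs \<subseteq> J"
  shows "enat (length xs) \<le> height R J"
  unfolding height_def
proof (rule Inf_greatest, clarify)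
  fix P assume P: "primeideal P R" "J \<subseteq> P"
  then obtain Ps where "prime_chain R Ps" "last Ps = P" "length Ps = Suc (length xs)"
    using prime_chain_of_regular_sequence[OF assms(1)] assms(2) by blast
  thus "enat (length xs) \<le> prime_height R P"
    unfolding prime_height_def by (intro Sup_upper) force
qed

lemma grade_le_height: "grade R J \<le> height R J"
  unfolding grade_def maximal_regular_sequence_in_def
  by (rule Sup_least) (auto intro: regular_sequence_length_le_height)

text \<open>This is needed because \<open>grade\<close> looks at maximal sequences only. Every
  extension of a regular sequence strictly enlarges the generated ideal: if the new term
  \<open>y\<close> were in the old ideal, regularity applied to \<open>y \<otimes> \<one>\<close>
  would put \<open>\<one>\<close> there. So a sequence whose ideal is maximal cannot be
  extended.\<close>

lemma regular_sequence_extends_to_maximal: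
  assumes "regular_sequence R xs" "set xs \<subseteq> J"
  shows "\<exists>ys. maximal_regular_sequence_in R J ys \<and> length xs \<le> length ys"
proof -
  define F where "F = {Idl (set ys) |ys. regular_sequence R ys \<and> set ys \<subseteq> J \<and> length xs \<le> length ys}"
  have "F \<noteq> {}" using assms unfolding F_def by blast
  hence "\<exists>M\<in>F. \<forall>I\<in>F. M \<subseteq> I \<longrightarrow> I = M"
    by (intro maximal_ideal_in_family) (auto simp: F_def regular_sequence_def intro: genideal_ideal)
  then obtain M where M: "M \<in> F" "\<forall>I\<in>F. M \<subseteq> I \<longrightarrow> I = M" ..
  then obtain ys where ys: "M = Idl (set ys)" "regular_sequence R ys" "set ys \<subseteq> J"
    "length xs \<le> length ys" unfolding F_def by blast
  have "\<not> regular_sequence R (ys @ [y])" if y: "y \<in> J" for y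
  proof
    assume reg: "regular_sequence R (ys @ [y])"
    hence carr: "set (ys @ [y]) \<subseteq> carrier R" by (simp add: regular_sequence_def)
    hence cs: "set ys \<subseteq> carrier R" "y \<in> carrier R" by auto
    have "Idl (set (ys @ [y])) \<in> F" unfolding F_def using reg ys y
      by (intro CollectI exI[of _ "ys @ [y]"]) auto
    moreover have "M \<subseteq> Idl (set (ys @ [y]))" unfolding ys
      using genideal_self[OF carr] carr by (intro subset_Idl_subset) auto
    ultimately have "Idl (set (ys @ [y])) = M" using M(2) by blast
    hence "y \<in> Idl (set ys)" using genideal_self[OF carr] ys(1) by auto
    hence "\<one> \<in> Idl (set ys)" using regular_sequence_snocD(2)[OF reg, of \<one>] cs by simp
    hence "Idl (set ys) = carrier R" using ideal.one_imp_carrier[OF genideal_ideal[OF cs(1)]] by simp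
    thus False using ys(2) by (simp add: regular_sequence_def)
  qed
  thus ?thesis using ys unfolding maximal_regular_sequence_in_def by blast
qed

lemma regular_sequence_length_le_grade:
  assumes "regular_sequence R xs" "set xs \<subseteq> J"
  shows "enat (length xs) \<le> grade R J"
proof -
  obtain ys where ys: "maximal_regular_sequence_in R J ys" "length xs \<le> length ys"
    using regular_sequence_extends_to_maximal[OF assms] by blast
  have "enat (length xs) \<le> enat (length ys)" using ys by simp
  also have "\<dots> \<le> grade R J" unfolding grade_def using ys(1) by (intro Sup_upper) blast
  finally show ?thesis .
qed

end

section \<open>The dimension of a quotient\<close>

text \<open>The dimension of the quotient by an ideal \<open>J\<close>, read off from the primes of
  \<open>A\<close> itself. The zero ideal gives the dimension of \<open>A\<close>, so one formula
  for coheights covers both dimensions in the definition of relative Cohen-Macaulayness.\<close>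

definition coheight :: "('a, 'm) ring_scheme \<Rightarrow> 'a set \<Rightarrow> enat" where
  "coheight A J = Sup {enat (length Ps - 1) |Ps. prime_chain A Ps \<and> J \<subseteq> hd Ps}"

lemma (in cring) coheight_zero: "coheight R {\<zero>} = krull_dim R"
proof -
  have "{\<zero>} \<subseteq> hd Ps" if "prime_chain R Ps" for Ps
  proof -
    have "primeideal (hd Ps) R" using that by (auto simp: prime_chain_def)
    then interpret primeideal "hd Ps" R .
    show ?thesis by simp
  qed
  thus ?thesis unfolding coheight_def krull_dim_def by (metis (no_types, lifting))
qed

lemma (in ideal) primeideal_image_Quot:
  assumes "cring R" "primeideal P R" "I \<subseteq> P"
  shows "primeideal ((+>) I ` P) (R Quot I)"
    and "a \<in> carrier R \<Longrightarrow> I +> a \<in> (+>) I ` P \<longleftrightarrow> a \<in> P"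
proof -
  interpret cring R by fact
  interpret P: primeideal P R by fact
  interpret hom: ring_hom_ring R "R Quot I" "(+>) I" by (rule rcos_ring_hom_ring)
  interpret Q: cring "R Quot I" by (rule quotient_is_cring[OF is_cring])
  have carr: "carrier (R Quot I) = (+>) I ` carrier R"
    by (rule carrier_Quot)
  show mem: "I +> a \<in> (+>) I ` P \<longleftrightarrow> a \<in> P" if a: "a \<in> carrier R" for a
  proof
    assume "I +> a \<in> (+>) I ` P"
    then obtain p where p: "p \<in> P" "I +> a = I +> p" by blast
    hence "a \<ominus> p \<in> P" using quotient_eq_iff_same_a_r_cos[OF is_ideal a] P.Icarr assms(3) by blast
    hence "(a \<ominus> p) \<oplus> p \<in> P" using p by simp
    moreover have "(a \<ominus> p) \<oplus> p = a" using a P.Icarr[OF p(1)] by algebra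
    ultimately show "a \<in> P" by simp
  qed blast
  have "ideal ((+>) I ` P) (R Quot I)"
  proof (rule Q.ideal_intro)
    show "(+>) I ` P \<subseteq> carrier (R Quot I)" unfolding carr using P.Icarr by blast
    show "\<zero>\<^bsub>R Quot I\<^esub> \<in> (+>) I ` P" using hom.hom_zero P.zero_closed by (metis imageI)
  next
    fix a b assume "a \<in> (+>) I ` P" "b \<in> (+>) I ` P"
    then obtain p q where *: "p \<in> P" "q \<in> P" "a = I +> p" "b = I +> q" by blast
    hence "a \<oplus>\<^bsub>R Quot I\<^esub> b = I +> (p \<oplus> q)" using hom.hom_add P.Icarr by simp
    thus "a \<oplus>\<^bsub>R Quot I\<^esub> b \<in> (+>) I ` P" using * P.a_closed by blast
  next
    fix a r assume "a \<in> (+>) I ` P" "r \<in> carrier (R Quot I)"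
    then obtain p s where *: "p \<in> P" "s \<in> carrier R" "a = I +> p" "r = I +> s" unfolding carr by blast
    hence "r \<otimes>\<^bsub>R Quot I\<^esub> a = I +> (s \<otimes> p)" using hom.hom_mult P.Icarr by simp
    thus "r \<otimes>\<^bsub>R Quot I\<^esub> a \<in> (+>) I ` P" using * P.I_l_closed by blast
  qed
  thus "primeideal ((+>) I ` P) (R Quot I)"
  proof (rule primeidealI[OF _ Q.is_cring])
    have "I +> \<one> \<notin> (+>) I ` P" using mem[OF one_closed] primeideal_one_notin[OF assms(2)] by blast
    thus "carrier (R Quot I) \<noteq> (+>) I ` P" unfolding carr by (metis imageI one_closed)
  next
    fix a b assume "a \<in> carrier (R Quot I)" "b \<in> carrier (R Quot I)" and
      ab: "a \<otimes>\<^bsub>R Quot I\<^esub> b \<in> (+>) I ` P"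
    then obtain p q where *: "p \<in> carrier R" "q \<in> carrier R" "a = I +> p" "b = I +> q"
      by (auto simp: carr)
    hence "I +> (p \<otimes> q) \<in> (+>) I ` P" using ab unfolding *(3,4) by (simp only: hom.hom_mult)
    hence "p \<otimes> q \<in> P" using mem[OF m_closed] *(1,2) by blast
    thus "a \<in> (+>) I ` P \<or> b \<in> (+>) I ` P" using * P.I_prime by blast
  qed
qed

lemma (in ideal) krull_dim_Quot:
  assumes "cring R"
  shows "krull_dim (R Quot I) = coheight R I"
proof -
  interpret cring R by fact
  interpret hom: ring_hom_ring R "R Quot I" "(+>) I" by (rule rcos_ring_hom_ring)
  have carr: "carrier (R Quot I) = (+>) I ` carrier R"
    by (rule carrier_Quot)
  have "\<exists>Qs. prime_chain R Qs \<and> I \<subseteq> hd Qs \<and> length Qs = length Ps"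
    if Ps: "prime_chain (R Quot I) Ps" for Ps
  proof (intro exI conjI)
    define f where "f P = {r \<in> carrier R. I +> r \<in> P}" for P
    have prime: "primeideal P (R Quot I)" if "P \<in> set Ps" for P
      using Ps that by (auto simp: prime_chain_def)
    show "prime_chain R (map f Ps)"
    proof (rule prime_chain_map[OF Ps])
      fix P assume "P \<in> set Ps"
      thus "primeideal (f P) R" unfolding f_def
        using hom.primeideal_vimage[OF is_cring prime] by simp
    next
      fix P Q assume "P \<in> set Ps" "Q \<in> set Ps" "P \<subset> Q"
      moreover from this have "Q \<subseteq> (+>) I ` carrier R"
        using primeideal_subset[OF prime] unfolding carr by blast
      ultimately show "f P \<subset> f Q" unfolding f_def by blast
    qed
    have "Ps \<noteq> []" using Ps by (simp add: prime_chain_def)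
    moreover from this have "additive_subgroup (hd Ps) (R Quot I)"
      using prime[of "hd Ps"] by (simp add: primeideal_def ideal_def)
    hence "\<zero>\<^bsub>R Quot I\<^esub> \<in> hd Ps" by (rule additive_subgroup.zero_closed)
    hence "I \<in> hd Ps" by (simp only: zero_Quot)
    hence "I \<subseteq> f (hd Ps)" unfolding f_def using a_rcos_zero[OF is_ideal] Icarr by auto
    ultimately show "I \<subseteq> hd (map f Ps)" by (simp add: hd_map)
  qed simp
  moreover have "\<exists>Qs. prime_chain (R Quot I) Qs \<and> length Qs = length Ps"
    if Ps: "prime_chain R Ps" "I \<subseteq> hd Ps" for Ps
  proof (intro exI conjI)
    have prime: "primeideal P R" "I \<subseteq> P" if "P \<in> set Ps" for P
      using Ps that prime_chain_hd_subset[OF Ps(1) that] by (auto simp: prime_chain_def)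
    show "prime_chain (R Quot I) (map ((`) ((+>) I)) Ps)"
    proof (rule prime_chain_map[OF Ps(1)])
      fix P assume "P \<in> set Ps"
      thus "primeideal ((+>) I ` P) (R Quot I)"
        using primeideal_image_Quot(1)[OF is_cring] prime by blast
    next
      fix P Q assume *: "P \<in> set Ps" "Q \<in> set Ps" "P \<subset> Q"
      then obtain q where q: "q \<in> Q" "q \<notin> P" by blast
      hence "q \<in> carrier R" using primeideal_subset[OF prime(1)[OF *(2)]] by blast
      hence "I +> q \<notin> (+>) I ` P" using primeideal_image_Quot(2)[OF is_cring prime[OF *(1)]] q by simp
      thus "(+>) I ` P \<subset> (+>) I ` Q" using q * by blast
    qed
  qed simp
  ultimately show ?thesis unfolding krull_dim_def coheight_def
    by (intro antisym Sup_mono; elim CollectE exE conjE; metis (mono_tags, lifting) CollectI order_refl)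
qed

section \<open>Rings of formal series\<close>

lemma finite_submultisets: "finite {k. k \<subseteq># (m :: 'b multiset)}"
proof (induction m)
  case (add a m)
  have "{k. k \<subseteq># add_mset a m} \<subseteq> {k. k \<subseteq># m} \<union> add_mset a ` {k. k \<subseteq># m}"
  proof
    fix k assume "k \<in> {k. k \<subseteq># add_mset a m}"
    hence k: "k \<subseteq># add_mset a m" by simp
    show "k \<in> {k. k \<subseteq># m} \<union> add_mset a ` {k. k \<subseteq># m}"
    proof (cases "a \<in># k")
      case True
      then obtain l where l: "k = add_mset a l" by (metis insert_DiffM)
      thus ?thesis using k by auto
    next
      case False
      hence "k \<subseteq># m" using k by (metis add_mset_remove_trivial diff_single_trivial subseteq_mset_def
        diff_subset_eq_self in_diff_count subset_eq_diff_conv add_mset_add_single)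
      thus ?thesis by simp
    qed
  qed
  thus ?case using add.IH by (meson finite_UnI finite_imageI finite_subset)
qed simp

lemma diff_diff_submultiset: "k \<subseteq># m \<Longrightarrow> m - (m - k) = k"
  by (simp add: multiset_eq_iff subseteq_mset_def)

lemma (in abelian_monoid) finsum_Sigma:
  assumes "finite A" "\<And>i. i \<in> A \<Longrightarrow> finite (B i)"
    and "\<And>i j. i \<in> A \<Longrightarrow> j \<in> B i \<Longrightarrow> f i j \<in> carrier G"
  shows "(\<Oplus>i\<in>A. \<Oplus>j\<in>B i. f i j) = (\<Oplus>p\<in>Sigma A B. f (fst p) (snd p))"
proof -
  have "(\<Oplus>p\<in>Sigma A B. f (fst p) (snd p)) = (\<Oplus>p\<in>(\<Union>i\<in>A. Pair i ` B i). f (fst p) (snd p))"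
    by (rule arg_cong[where f = "finsum G (\<lambda>p. f (fst p) (snd p))"]) auto
  also have "\<dots> = (\<Oplus>i\<in>A. \<Oplus>p\<in>Pair i ` B i. f (fst p) (snd p))"
    using assms by (intro add.finprod_UN_disjoint) (auto simp: pairwise_def disjnt_def)
  also have "\<dots> = (\<Oplus>i\<in>A. \<Oplus>j\<in>B i. f i j)"
  proof (rule add.finprod_cong')
    fix i assume i: "i \<in> A"
    have "(\<Oplus>p\<in>Pair i ` B i. f (fst p) (snd p)) = (\<Oplus>j\<in>B i. f (fst (i, j)) (snd (i, j)))"
      using assms i by (intro add.finprod_reindex) (auto simp: inj_on_def)
    thus "(\<Oplus>p\<in>Pair i ` B i. f (fst p) (snd p)) = (\<Oplus>j\<in>B i. f i j)" by simp
  qed (use assms in \<open>auto intro!: finsum_closed\<close>)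
  finally show ?thesis by simp
qed

text \<open>Series in countably many variables, a common overring of the power series and polynomial
  rings for all \<open>n\<close>. The number \<open>0\<close> is arbitrary: \<open>n\<close> enters
  only the carrier, which is replaced.\<close>

definition formal_series_ring :: "('a, 'm) ring_scheme \<Rightarrow> (nat multiset \<Rightarrow> 'a) ring" where
  "formal_series_ring R = power_series_ring R 0 \<lparr>carrier := {f. \<forall>m. f m \<in> carrier R}\<rparr>"

definition monomial :: "('a, 'm) ring_scheme \<Rightarrow> nat multiset \<Rightarrow> 'a \<Rightarrow> nat multiset \<Rightarrow> 'a" where
  "monomial R d r = (\<lambda>m. if m = d then r else \<zero>\<^bsub>R\<^esub>)"

lemma formal_series_ring_simps:
  "carrier (formal_series_ring R) = {f. \<forall>m. f m \<in> carrier R}"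
  "f \<otimes>\<^bsub>formal_series_ring R\<^esub> g = (\<lambda>m. \<Oplus>\<^bsub>R\<^esub>k\<in>{k. k \<subseteq># m}. f k \<otimes>\<^bsub>R\<^esub> g (m - k))"
  "\<one>\<^bsub>formal_series_ring R\<^esub> = monomial R {#} \<one>\<^bsub>R\<^esub>"
  "\<zero>\<^bsub>formal_series_ring R\<^esub> = (\<lambda>m. \<zero>\<^bsub>R\<^esub>)"
  "f \<oplus>\<^bsub>formal_series_ring R\<^esub> g = (\<lambda>m. f m \<oplus>\<^bsub>R\<^esub> g m)"
  by (simp_all add: formal_series_ring_def power_series_ring_def monomial_def)

context cring
begin

lemma monomial_mult:
  assumes "r \<in> carrier R" "\<And>m. g m \<in> carrier R"
  shows "monomial R d r \<otimes>\<^bsub>formal_series_ring R\<^esub> g =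
    (\<lambda>m. if d \<subseteq># m then r \<otimes> g (m - d) else \<zero>)"
proof
  fix m :: "nat multiset"
  have "(\<Oplus>k\<in>{k. k \<subseteq># m}. monomial R d r k \<otimes> g (m - k)) =
    (\<Oplus>k\<in>{k. k \<subseteq># m}. if k = d then r \<otimes> g (m - k) else \<zero>)"
    using assms by (intro finsum_cong') (auto simp: monomial_def)
  also have "\<dots> = (if d \<subseteq># m then r \<otimes> g (m - d) else \<zero>)"
  proof (cases "d \<subseteq># m")
    case True
    thus ?thesis using assms finite_submultisets[of m]
      by (subst add.finprod_singleton_swap) auto
  next
    case False
    hence "(\<Oplus>k\<in>{k. k \<subseteq># m}. if k = d then r \<otimes> g (m - k) else \<zero>) = (\<Oplus>k\<in>{k. k \<subseteq># m}. \<zero>)"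
      by (intro finsum_cong') auto
    thus ?thesis using False by simp
  qed
  finally show "(monomial R d r \<otimes>\<^bsub>formal_series_ring R\<^esub> g) m =
    (if d \<subseteq># m then r \<otimes> g (m - d) else \<zero>)" by (simp add: formal_series_ring_simps)
qed

lemma formal_series_ring_cring: "cring (formal_series_ring R)"
proof (rule cringI)
  let ?S = "formal_series_ring R"
  have in_carrier: "f m \<in> carrier R" if "f \<in> carrier ?S" for f m
    using that by (simp add: formal_series_ring_simps)
  show "abelian_group ?S"
  proof (rule abelian_groupI)
    fix f assume f: "f \<in> carrier ?S"
    thus "\<exists>g\<in>carrier ?S. g \<oplus>\<^bsub>?S\<^esub> f = \<zero>\<^bsub>?S\<^esub>"
      by (intro bexI[of _ "\<lambda>m. \<ominus> f m"]) (auto simp: formal_series_ring_simps l_neg)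
  qed (auto simp: formal_series_ring_simps a_assoc, auto simp: fun_eq_iff a_comm)
  have m_closed: "f \<otimes>\<^bsub>?S\<^esub> g \<in> carrier ?S" if "f \<in> carrier ?S" "g \<in> carrier ?S" for f g
    using in_carrier[OF that(1)] in_carrier[OF that(2)]
    by (auto simp: formal_series_ring_simps intro!: finsum_closed)
  show "comm_monoid ?S"
  proof (rule comm_monoidI)
    fix f g assume fg: "f \<in> carrier ?S" "g \<in> carrier ?S"
    note fg_carrier = in_carrier[OF fg(1)] in_carrier[OF fg(2)]
    show "f \<otimes>\<^bsub>?S\<^esub> g = g \<otimes>\<^bsub>?S\<^esub> f"
    proof
      fix m :: "nat multiset"
      let ?K = "{k. k \<subseteq># m}"
      have im: "(\<lambda>k. m - k) ` ?K = ?K"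
      proof
        show "?K \<subseteq> (\<lambda>k. m - k) ` ?K"
        proof
          fix k assume "k \<in> ?K"
          hence "k = m - (m - k)" by (simp add: diff_diff_submultiset)
          thus "k \<in> (\<lambda>k. m - k) ` ?K" by (intro image_eqI[of _ _ "m - k"]) auto
        qed
      qed auto
      have "inj_on (\<lambda>k. m - k) ?K" by (rule inj_onI) (metis mem_Collect_eq diff_diff_submultiset)
      hence "(\<Oplus>k\<in>(\<lambda>k. m - k) ` ?K. f k \<otimes> g (m - k)) = (\<Oplus>k\<in>?K. f (m - k) \<otimes> g (m - (m - k)))"
        using fg_carrier by (intro finsum_reindex) auto
      also have "\<dots> = (\<Oplus>k\<in>?K. g k \<otimes> f (m - k))"
        using fg_carrier by (intro finsum_cong') (auto simp: diff_diff_submultiset m_comm)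
      finally show "(f \<otimes>\<^bsub>?S\<^esub> g) m = (g \<otimes>\<^bsub>?S\<^esub> f) m"
        by (simp add: formal_series_ring_simps im)
    qed
  next
    fix f g h assume fgh: "f \<in> carrier ?S" "g \<in> carrier ?S" "h \<in> carrier ?S"
    note fgh_carrier = in_carrier[OF fgh(1)] in_carrier[OF fgh(2)] in_carrier[OF fgh(3)]
    show "(f \<otimes>\<^bsub>?S\<^esub> g) \<otimes>\<^bsub>?S\<^esub> h = f \<otimes>\<^bsub>?S\<^esub> (g \<otimes>\<^bsub>?S\<^esub> h)"
    proof
      fix m :: "nat multiset"
      let ?K = "{k. k \<subseteq># m}"
      \<comment> \<open>\<open>?A\<close> indexes the left bracketing by pairs \<open>(k, l)\<close>
        with \<open>l\<close> contained in \<open>k\<close>, and \<open>?B\<close> the right one by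
        pairs \<open>(l, j)\<close> with \<open>j\<close> contained in \<open>m - l\<close>; they
        match through \<open>k = l + j\<close>.\<close>
      let ?A = "Sigma ?K (\<lambda>k. {l. l \<subseteq># k})" and ?B = "Sigma ?K (\<lambda>k. {l. l \<subseteq># m - k})"
      let ?t = "\<lambda>a b c. f a \<otimes> (g b \<otimes> h c)"
      let ?\<phi> = "\<lambda>(l, j). (l + j, l)"
      have tc: "?t a b c \<in> carrier R" for a b c using fgh_carrier by simp
      have im: "?\<phi> ` ?B = ?A"
      proof
        show "?\<phi> ` ?B \<subseteq> ?A" by (auto simp: subset_mset.le_diff_conv2 add.commute)
        show "?A \<subseteq> ?\<phi> ` ?B"
        proof
          fix p assume "p \<in> ?A"
          then obtain k l where kl: "p = (k, l)" "k \<subseteq># m" "l \<subseteq># k" by auto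
          moreover have "k - l \<subseteq># m - l" using kl(2) by (simp add: subseteq_mset_def diff_le_mono)
          ultimately have "p = ?\<phi> (l, k - l)" "(l, k - l) \<in> ?B"
            using subset_mset.order_trans[OF kl(3,2)] by auto
          thus "p \<in> ?\<phi> ` ?B" by blast
        qed
      qed
      have inj: "inj_on ?\<phi> ?B" by (auto simp: inj_on_def)
      have "((f \<otimes>\<^bsub>?S\<^esub> g) \<otimes>\<^bsub>?S\<^esub> h) m =
        (\<Oplus>k\<in>?K. \<Oplus>l\<in>{l. l \<subseteq># k}. ?t l (k - l) (m - k))"
        unfolding formal_series_ring_simps
      proof (rule finsum_cong')
        fix k assume "k \<in> ?K"
        have "(\<Oplus>l\<in>{l. l \<subseteq># k}. f l \<otimes> g (k - l)) \<otimes> h (m - k) =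
          (\<Oplus>l\<in>{l. l \<subseteq># k}. (f l \<otimes> g (k - l)) \<otimes> h (m - k))"
          using fgh_carrier finite_submultisets[of k] by (intro finsum_ldistr) auto
        also have "\<dots> = (\<Oplus>l\<in>{l. l \<subseteq># k}. ?t l (k - l) (m - k))"
          using fgh_carrier by (intro finsum_cong') (auto simp: m_assoc)
        finally show "(\<Oplus>l\<in>{l. l \<subseteq># k}. f l \<otimes> g (k - l)) \<otimes> h (m - k) =
          (\<Oplus>l\<in>{l. l \<subseteq># k}. ?t l (k - l) (m - k))" .
      qed (use tc in \<open>auto intro!: finsum_closed\<close>)
      also have "\<dots> = (\<Oplus>p\<in>?A. ?t (snd p) (fst p - snd p) (m - fst p))"
        using tc finite_submultisets by (intro finsum_Sigma) auto
      also have "\<dots> = (\<Oplus>p\<in>?\<phi> ` ?B. ?t (snd p) (fst p - snd p) (m - fst p))"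
        by (simp only: im)
      also have "\<dots> = (\<Oplus>p\<in>?B. ?t (snd (?\<phi> p)) (fst (?\<phi> p) - snd (?\<phi> p)) (m - fst (?\<phi> p)))"
        using tc inj by (intro finsum_reindex) auto
      also have "\<dots> = (\<Oplus>p\<in>?B. ?t (fst p) (snd p) (m - fst p - snd p))"
        using tc by (intro finsum_cong') auto
      also have "\<dots> = (\<Oplus>l\<in>?K. \<Oplus>j\<in>{j. j \<subseteq># m - l}. ?t l j (m - l - j))"
        using tc finite_submultisets by (intro finsum_Sigma[symmetric]) auto
      also have "\<dots> = (f \<otimes>\<^bsub>?S\<^esub> (g \<otimes>\<^bsub>?S\<^esub> h)) m"
        unfolding formal_series_ring_simps
      proof (rule finsum_cong')
        fix l assume "l \<in> ?K"
        show "(\<Oplus>j\<in>{j. j \<subseteq># m - l}. ?t l j (m - l - j)) =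
          f l \<otimes> (\<Oplus>k\<in>{k. k \<subseteq># m - l}. g k \<otimes> h (m - l - k))"
          using fgh_carrier finite_submultisets[of "m - l"] by (intro finsum_rdistr[symmetric]) auto
      qed (use fgh_carrier in \<open>auto intro!: finsum_closed\<close>)
      finally show "((f \<otimes>\<^bsub>?S\<^esub> g) \<otimes>\<^bsub>?S\<^esub> h) m = (f \<otimes>\<^bsub>?S\<^esub> (g \<otimes>\<^bsub>?S\<^esub> h)) m" .
    qed
  next
    fix f assume f: "f \<in> carrier ?S"
    show "\<one>\<^bsub>?S\<^esub> \<otimes>\<^bsub>?S\<^esub> f = f"
      unfolding formal_series_ring_simps(3) using in_carrier[OF f] by (subst monomial_mult) auto
  qed (use m_closed in \<open>auto simp: formal_series_ring_simps monomial_def\<close>)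
  fix f g h assume fgh: "f \<in> carrier ?S" "g \<in> carrier ?S" "h \<in> carrier ?S"
  note fgh_carrier = in_carrier[OF fgh(1)] in_carrier[OF fgh(2)] in_carrier[OF fgh(3)]
  show "(f \<oplus>\<^bsub>?S\<^esub> g) \<otimes>\<^bsub>?S\<^esub> h = f \<otimes>\<^bsub>?S\<^esub> h \<oplus>\<^bsub>?S\<^esub> g \<otimes>\<^bsub>?S\<^esub> h"
  proof
    fix m :: "nat multiset"
    have "(\<Oplus>k\<in>{k. k \<subseteq># m}. (f k \<oplus> g k) \<otimes> h (m - k)) =
      (\<Oplus>k\<in>{k. k \<subseteq># m}. f k \<otimes> h (m - k) \<oplus> g k \<otimes> h (m - k))"
      using fgh_carrier by (intro finsum_cong') (auto simp: l_distr)
    also have "\<dots> = (\<Oplus>k\<in>{k. k \<subseteq># m}. f k \<otimes> h (m - k)) \<oplus> (\<Oplus>k\<in>{k. k \<subseteq># m}. g k \<otimes> h (m - k))"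
      using fgh_carrier by (intro finsum_addf) auto
    finally show "((f \<oplus>\<^bsub>?S\<^esub> g) \<otimes>\<^bsub>?S\<^esub> h) m = (f \<otimes>\<^bsub>?S\<^esub> h \<oplus>\<^bsub>?S\<^esub> g \<otimes>\<^bsub>?S\<^esub> h) m"
      by (simp add: formal_series_ring_simps)
  qed
qed

lemma formal_series_ring_a_inv:
  assumes "f \<in> carrier (formal_series_ring R)"
  shows "\<ominus>\<^bsub>formal_series_ring R\<^esub> f = (\<lambda>m. \<ominus> f m)"
proof -
  interpret S: cring "formal_series_ring R" by (rule formal_series_ring_cring)
  show ?thesis using assms
    by (intro S.minus_equality) (auto simp: formal_series_ring_simps l_neg)
qed

end

text \<open>The properties shared by power series and polynomials in the first \<open>n\<close> variables;
  \<open>C\<close> is the set of admissible coefficient families.\<close>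

locale series_subring = cring R for R (structure) +
  fixes n :: nat and C :: "(nat multiset \<Rightarrow> 'a) set"
  assumes coeff_closed: "f \<in> C \<Longrightarrow> f m \<in> carrier R"
    and coeff_vars: "f \<in> C \<Longrightarrow> \<not> set_mset m \<subseteq> {..<n} \<Longrightarrow> f m = \<zero>"
    and C_add: "f \<in> C \<Longrightarrow> g \<in> C \<Longrightarrow> (\<lambda>m. f m \<oplus> g m) \<in> C"
    and C_mult: "f \<in> C \<Longrightarrow> g \<in> C \<Longrightarrow> f \<otimes>\<^bsub>formal_series_ring R\<^esub> g \<in> C"
    and C_one: "monomial R {#} \<one> \<in> C"
    and C_var: "j < n \<Longrightarrow> monomial R {#j#} \<one> \<in> C"
    and C_solid: "f \<in> C \<Longrightarrow> (\<And>m. g m \<in> carrier R) \<Longrightarrow> (\<And>m. f m = \<zero> \<Longrightarrow> g m = \<zero>) \<Longrightarrow> g \<in> C"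
    and C_shift: "f \<in> C \<Longrightarrow> (\<lambda>m. f (add_mset j m)) \<in> C"
begin

definition S :: "(nat multiset \<Rightarrow> 'a) ring" where
  "S = formal_series_ring R \<lparr>carrier := C\<rparr>"

lemma S_simps:
  "carrier S = C"
  "f \<otimes>\<^bsub>S\<^esub> g = (\<lambda>m. \<Oplus>\<^bsub>R\<^esub>k\<in>{k. k \<subseteq># m}. f k \<otimes>\<^bsub>R\<^esub> g (m - k))"
  "\<one>\<^bsub>S\<^esub> = monomial R {#} \<one>\<^bsub>R\<^esub>"
  "\<zero>\<^bsub>S\<^esub> = (\<lambda>m. \<zero>\<^bsub>R\<^esub>)"
  "f \<oplus>\<^bsub>S\<^esub> g = (\<lambda>m. f m \<oplus>\<^bsub>R\<^esub> g m)"
  by (simp_all add: S_def formal_series_ring_simps)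

lemma C_subset: "C \<subseteq> carrier (formal_series_ring R)"
  by (auto simp: formal_series_ring_simps intro: coeff_closed)

lemma C_subcring: "subcring C (formal_series_ring R)"
proof -
  interpret F: cring "formal_series_ring R" by (rule formal_series_ring_cring)
  show ?thesis
  proof (rule F.subcringI', rule F.subringI)
    fix f assume f: "f \<in> C"
    hence "(\<lambda>m. \<ominus> f m) \<in> C" using coeff_closed[OF f] by (intro C_solid[OF f]) auto
    thus "\<ominus>\<^bsub>formal_series_ring R\<^esub> f \<in> C" using f C_subset by (subst formal_series_ring_a_inv) auto
  qed (use C_subset C_add C_mult C_one in \<open>auto simp: formal_series_ring_simps\<close>)
qed

end

sublocale series_subring \<subseteq> S: cring S
  using cring.axioms(1)[OF formal_series_ring_cring] ring.subcring_iff[OF _ C_subset] C_subcring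
  unfolding S_def by blast

context series_subring
begin

lemma S_a_inv:
  assumes "f \<in> C" shows "\<ominus>\<^bsub>S\<^esub> f = (\<lambda>m. \<ominus> f m)"
proof (rule S.minus_equality)
  show "(\<lambda>m. \<ominus> f m) \<in> carrier S"
    unfolding S_simps using coeff_closed[OF assms] by (intro C_solid[OF assms]) auto
qed (use assms coeff_closed[OF assms] in \<open>auto simp: S_simps l_neg\<close>)

lemma S_minus: "f \<in> C \<Longrightarrow> g \<in> C \<Longrightarrow> f \<ominus>\<^bsub>S\<^esub> g = (\<lambda>m. f m \<ominus> g m)"
  by (simp add: a_minus_def S_a_inv S_simps)

lemma S_monomial_mult:
  assumes "r \<in> carrier R" "g \<in> C"
  shows "monomial R d r \<otimes>\<^bsub>S\<^esub> g = (\<lambda>m. if d \<subseteq># m then r \<otimes> g (m - d) else \<zero>)"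
  using monomial_mult[OF assms(1) coeff_closed[OF assms(2)]]
  unfolding S_simps(2) formal_series_ring_simps(2) .

lemma const_in_C: "r \<in> carrier R \<Longrightarrow> monomial R {#} r \<in> C"
  by (rule C_solid[OF C_one]) (auto simp: monomial_def dest: arg_cong[where f = "\<lambda>u. r \<otimes> u"])

lemma const_mult:
  "r \<in> carrier R \<Longrightarrow> g \<in> C \<Longrightarrow> monomial R {#} r \<otimes>\<^bsub>S\<^esub> g = (\<lambda>m. r \<otimes> g m)"
  by (simp add: S_monomial_mult)

lemma var_mult:
  assumes "g \<in> C"
  shows "monomial R {#j#} \<one> \<otimes>\<^bsub>S\<^esub> g = (\<lambda>m. if j \<in># m then g (m - {#j#}) else \<zero>)"
  unfolding S_monomial_mult[OF one_closed assms] using coeff_closed[OF assms] by (auto simp: fun_eq_iff)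

lemma const_hom: "monomial R {#} \<in> ring_hom R S"
  by (rule ring_hom_memI) (auto simp: const_in_C const_mult S_simps(1,3,5), auto simp: monomial_def)

text \<open>The ideal generated by the first \<open>j\<close> variables and the series with coefficients
  in \<open>J\<close>.\<close>

definition avoiding :: "nat \<Rightarrow> 'a set \<Rightarrow> (nat multiset \<Rightarrow> 'a) set" where
  "avoiding j J = {f \<in> C. \<forall>m. set_mset m \<inter> {..<j} = {} \<longrightarrow> f m \<in> J}"

lemma avoidingI:
  "f \<in> C \<Longrightarrow> (\<And>m. set_mset m \<inter> {..<j} = {} \<Longrightarrow> f m \<in> J) \<Longrightarrow> f \<in> avoiding j J"
  unfolding avoiding_def by blast

lemma avoidingD:
  assumes "f \<in> avoiding j J"
  shows "f \<in> C" "set_mset m \<inter> {..<j} = {} \<Longrightarrow> f m \<in> J"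
  using assms unfolding avoiding_def by blast+

lemma avoiding_ideal:
  assumes "ideal J R" shows "ideal (avoiding j J) S"
proof -
  interpret J: ideal J R by fact
  show ?thesis
  proof (rule S.ideal_intro)
    fix f g assume f: "f \<in> avoiding j J" and g: "g \<in> carrier S"
    have "(g \<otimes>\<^bsub>S\<^esub> f) m \<in> J" if "set_mset m \<inter> {..<j} = {}" for m
    proof -
      have "g k \<otimes> f (m - k) \<in> J" if "k \<subseteq># m" for k
      proof (rule J.I_l_closed)
        have "set_mset (m - k) \<inter> {..<j} = {}"
          using \<open>set_mset m \<inter> {..<j} = {}\<close> in_diffD by fastforce
        thus "f (m - k) \<in> J" using f by (auto simp: avoiding_def)
        show "g k \<in> carrier R" using g coeff_closed[of g] by (auto simp: S_simps)
      qed
      thus ?thesis unfolding S_simps by (intro J.finsum_in_ideal finite_submultisets) simp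
    qed
    thus "g \<otimes>\<^bsub>S\<^esub> f \<in> avoiding j J" using f g S.m_closed
      by (auto simp: avoiding_def S_simps(1))
  next
    show "\<zero>\<^bsub>S\<^esub> \<in> avoiding j J" using S.zero_closed by (simp add: avoiding_def S_simps)
  qed (auto simp: avoiding_def S_simps C_add)
qed

lemma const_in_avoiding: "r \<in> carrier R \<Longrightarrow> \<zero> \<in> J \<Longrightarrow> monomial R {#} r \<in> avoiding j J \<longleftrightarrow> r \<in> J"
  using const_in_C[of r] by (auto simp: avoiding_def monomial_def)

text \<open>The product of the terms with the least monomials outside \<open>P\<close> is not cancelled.\<close>

lemma avoiding_prime:
  assumes "primeideal P R" shows "primeideal (avoiding j P) S"
proof -
  interpret P: primeideal P R by fact
  interpret E: ideal "avoiding j P" S by (rule avoiding_ideal[OF P.is_ideal])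
  show ?thesis
  proof (rule primeidealI[OF E.is_ideal S.is_cring])
    have "\<one>\<^bsub>S\<^esub> \<notin> avoiding j P"
      using primeideal_one_notin[OF assms] by (simp add: S_simps const_in_avoiding)
    thus "carrier S \<noteq> avoiding j P" using S.one_closed by blast
  next
    fix f g assume fg: "f \<in> carrier S" "g \<in> carrier S" "f \<otimes>\<^bsub>S\<^esub> g \<in> avoiding j P"
    hence fgC: "f \<in> C" "g \<in> C" by (simp_all add: S_simps)
    note fg_carrier = coeff_closed[OF fgC(1)] coeff_closed[OF fgC(2)]
    show "f \<in> avoiding j P \<or> g \<in> avoiding j P"
    proof (rule ccontr)
      assume neg: "\<not> ?thesis"
      define U where "U h m \<longleftrightarrow> set_mset m \<inter> {..<j} = {} \<and> h m \<notin> P" for h :: "nat multiset \<Rightarrow> 'a" and m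
      obtain a0 b0 where "U f a0" "U g b0" using neg fgC unfolding avoiding_def U_def by auto
      \<comment> \<open>The least elements refer to the multiset order, a well-order on multisets of
        natural numbers that is compatible with addition.\<close>
      define a where "a = (LEAST m. U f m)"
      define b where "b = (LEAST m. U g m)"
      have a: "U f a" and amin: "\<And>m. m < a \<Longrightarrow> \<not> U f m"
        unfolding a_def using \<open>U f a0\<close> by (auto intro: LeastI dest: not_less_Least)
      have b: "U g b" and bmin: "\<And>m. m < b \<Longrightarrow> \<not> U g m"
        unfolding b_def using \<open>U g b0\<close> by (auto intro: LeastI dest: not_less_Least)
      let ?K = "{k. k \<subseteq># a + b}"
      have ab: "set_mset (a + b) \<inter> {..<j} = {}" using a b by (auto simp: U_def)
      \<comment> \<open>If \<open>k\<close> is not \<open>a\<close>, then either \<open>k\<close> is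
        below \<open>a\<close> or its complement is below \<open>b\<close>. Both divide the monomial
        \<open>a + b\<close>, so they avoid the first \<open>j\<close> variables and minimality
        applies to them.\<close>
      have other: "f k \<otimes> g (a + b - k) \<in> P" if k: "k \<subseteq># a + b" "k \<noteq> a" for k
      proof (cases "k < a")
        case True
        moreover have "set_mset k \<inter> {..<j} = {}" using ab set_mset_mono[OF k(1)] by blast
        ultimately have "f k \<in> P" using amin by (auto simp: U_def)
        thus ?thesis using fg_carrier by (simp add: P.I_r_closed)
      next
        case False
        hence "a < k" using k by simp
        have eq: "k + (a + b - k) = a + b" using k by simp
        have "a + b - k < b"
        proof (rule ccontr)
          assume "\<not> a + b - k < b"
          hence "a + b < k + (a + b - k)" using \<open>a < k\<close> by (intro add_less_le_mono) auto
          thus False using eq by simp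
        qed
        moreover have "set_mset (a + b - k) \<inter> {..<j} = {}" using ab in_diffD by fastforce
        ultimately have "g (a + b - k) \<in> P" using bmin by (auto simp: U_def)
        thus ?thesis using fg_carrier by (simp add: P.I_l_closed)
      qed
      have "?K = insert a (?K - {a})" by auto
      hence "(f \<otimes>\<^bsub>S\<^esub> g) (a + b) = (\<Oplus>k\<in>insert a (?K - {a}). f k \<otimes> g (a + b - k))"
        unfolding S_simps by simp
      also have "\<dots> = f a \<otimes> g b \<oplus> (\<Oplus>k\<in>?K - {a}. f k \<otimes> g (a + b - k))"
        using finite_submultisets[of "a + b"] fg_carrier by (subst finsum_insert) auto
      finally have "f a \<otimes> g b \<oplus> (\<Oplus>k\<in>?K - {a}. f k \<otimes> g (a + b - k)) \<in> P"
        using fg(3) ab unfolding avoiding_def by (metis (mono_tags, lifting) mem_Collect_eq)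
      moreover have "(\<Oplus>k\<in>?K - {a}. f k \<otimes> g (a + b - k)) \<in> P"
        using finite_submultisets[of "a + b"] other by (intro P.finsum_in_ideal) auto
      ultimately have "f a \<otimes> g b \<in> P" using P.add_cancel_ideal fg_carrier by blast
      thus False using P.I_prime a b fg_carrier unfolding U_def by blast
    qed
  qed
qed

lemma avoiding_mono:
  assumes "P \<subseteq> Q" "i \<le> j" shows "avoiding i P \<subseteq> avoiding j Q"
proof
  fix f assume f: "f \<in> avoiding i P"
  have "f m \<in> Q" if m: "set_mset m \<inter> {..<j} = {}" for m
  proof -
    have "set_mset m \<inter> {..<i} = {}" using m assms(2) by (auto simp: disjoint_iff)
    hence "f m \<in> P" by (rule avoidingD(2)[OF f])
    thus ?thesis using assms(1) by blast
  qed
  with avoidingD(1)[OF f] show "f \<in> avoiding j Q" by (rule avoidingI)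
qed

lemma avoiding_strict_mono:
  assumes "primeideal P R" "primeideal Q R" "P \<subset> Q"
  shows "avoiding j P \<subset> avoiding j Q"
proof -
  interpret P: primeideal P R by fact
  interpret Q: primeideal Q R by fact
  obtain q where q: "q \<in> Q" "q \<notin> P" using assms by blast
  hence "monomial R {#} q \<in> avoiding j Q - avoiding j P"
    using Q.Icarr by (simp add: const_in_avoiding)
  thus ?thesis using avoiding_mono[of P Q j j] assms by blast
qed

lemma var_in_avoiding:
  assumes "ideal J R" "J \<noteq> carrier R" "i < n"
  shows "monomial R {#i#} \<one> \<in> avoiding j J \<longleftrightarrow> i < j"
proof -
  interpret J: ideal J R by fact
  have "\<one> \<notin> J" using assms J.one_imp_carrier by blast
  thus ?thesis using C_var[OF assms(3)] by (auto simp: avoiding_def monomial_def)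
qed

lemma avoiding_Suc_strict:
  assumes "primeideal P R" "j < n"
  shows "avoiding j P \<subset> avoiding (Suc j) P"
proof -
  interpret P: primeideal P R by fact
  have "monomial R {#j#} \<one> \<in> avoiding (Suc j) P - avoiding j P"
    using var_in_avoiding[OF P.is_ideal _ assms(2)] P.I_notcarr by simp
  thus ?thesis using avoiding_mono[of P P j "Suc j"] by fastforce
qed

end

section \<open>Contraction to the constants\<close>

context series_subring
begin

abbreviation var :: "nat \<Rightarrow> nat multiset \<Rightarrow> 'a" where
  "var j \<equiv> monomial R {#j#} \<one>"

abbreviation const :: "'a \<Rightarrow> nat multiset \<Rightarrow> 'a" where
  "const \<equiv> monomial R {#}"

lemma var_decomposition:
  assumes f: "f \<in> C"
  shows "f = var j \<otimes>\<^bsub>S\<^esub> (\<lambda>m. f (add_mset j m)) \<oplus>\<^bsub>S\<^esub> (\<lambda>m. if j \<in># m then \<zero> else f m)"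
  unfolding var_mult[OF C_shift[OF f]] unfolding S_simps
  using coeff_closed[OF f] by (auto simp: fun_eq_iff)

text \<open>The terms divisible by the last of the \<open>j\<close> variables are split off as a
  multiple of it, and the rest falls under the induction hypothesis. Splitting by variables instead
  of by terms keeps the sum finite even for infinite series.\<close>

lemma mem_ideal_of_vars:
  assumes Q: "ideal Q S" and f: "f \<in> C" and "\<And>i. i < j \<Longrightarrow> var i \<in> Q"
    and "\<And>m. set_mset m \<inter> {..<j} = {} \<Longrightarrow> f m = \<zero>"
  shows "f \<in> Q"
  using assms(2-)
proof (induction j arbitrary: f)
  case 0
  hence "f = \<zero>\<^bsub>S\<^esub>" by (auto simp: S_simps)
  thus ?case using Q by (simp add: additive_subgroup.zero_closed ideal.axioms(1))
next
  case (Suc j)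
  interpret Q: ideal Q S by fact
  let ?g = "\<lambda>m. f (add_mset j m)" and ?h = "\<lambda>m. if j \<in># m then \<zero> else f m"
  have g: "?g \<in> C" using C_shift Suc.prems(1) .
  have h: "?h \<in> C" using coeff_closed[OF Suc.prems(1)] by (intro C_solid[OF Suc.prems(1)]) auto
  have "?h \<in> Q"
  proof (rule Suc.IH[OF h])
    fix m assume m: "set_mset m \<inter> {..<j} = {}"
    show "?h m = \<zero>"
    proof (cases "j \<in># m")
      case False
      hence "set_mset m \<inter> {..<Suc j} = {}" using m by (auto simp: lessThan_Suc)
      thus ?thesis using Suc.prems(3) by simp
    qed simp
  qed (use Suc.prems(2) in simp)
  moreover have "var j \<otimes>\<^bsub>S\<^esub> ?g \<in> Q"
    using Suc.prems(2)[of j] g by (intro Q.I_r_closed) (auto simp: S_simps(1))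
  ultimately have "var j \<otimes>\<^bsub>S\<^esub> ?g \<oplus>\<^bsub>S\<^esub> ?h \<in> Q" by (rule Q.a_closed[rotated])
  thus ?case by (subst var_decomposition[OF Suc.prems(1), of j])
qed

definition contraction :: "(nat multiset \<Rightarrow> 'a) set \<Rightarrow> 'a set" where
  "contraction Q = {r \<in> carrier R. const r \<in> Q}"

lemma contraction_prime:
  assumes "primeideal Q S" shows "primeideal (contraction Q) R"
proof -
  interpret ring_hom_ring R S const
    by (rule ring_hom_ringI2[OF ring_axioms S.ring_axioms const_hom])
  show ?thesis unfolding contraction_def by (rule primeideal_vimage[OF is_cring assms])
qed

lemma contraction_mono: "P \<subseteq> Q \<Longrightarrow> contraction P \<subseteq> contraction Q"
  by (auto simp: contraction_def)

lemma contraction_avoiding: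
  assumes "ideal J R" shows "contraction (avoiding j J) = J"
proof -
  interpret J: ideal J R by fact
  show ?thesis unfolding contraction_def using const_in_avoiding[of _ J j] J.Icarr by auto
qed

text \<open>Modulo the variables a series equals its constant coefficient. Hence an ideal containing
  all variables is determined by its contraction, which makes contraction injective on such
  ideals.\<close>

lemma mem_iff_const_coeff:
  assumes Q: "ideal Q S" and "\<And>i. i < n \<Longrightarrow> var i \<in> Q" and f: "f \<in> C"
  shows "f \<in> Q \<longleftrightarrow> f {#} \<in> contraction Q"
proof -
  interpret Q: ideal Q S by fact
  have c: "const (f {#}) \<in> C" using const_in_C[OF coeff_closed[OF f]] .
  have diff: "f \<ominus>\<^bsub>S\<^esub> const (f {#}) \<in> Q"
  proof (rule mem_ideal_of_vars[OF Q _ assms(2)])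
    show "f \<ominus>\<^bsub>S\<^esub> const (f {#}) \<in> C" using S.minus_closed[of f "const (f {#})"] f c by (simp add: S_simps(1))
    fix m assume m: "set_mset m \<inter> {..<n} = {}"
    show "(f \<ominus>\<^bsub>S\<^esub> const (f {#})) m = \<zero>"
    proof (cases "m = {#}")
      case True
      thus ?thesis unfolding S_minus[OF f c] using coeff_closed[OF f, of "{#}"]
        by (simp add: monomial_def r_neg a_minus_def)
    next
      case False
      hence "\<not> set_mset m \<subseteq> {..<n}" using m by auto
      thus ?thesis unfolding S_minus[OF f c] using coeff_vars[OF f] False
        by (simp add: monomial_def a_minus_def)
    qed
  qed
  have sum: "(f \<ominus>\<^bsub>S\<^esub> const (f {#})) \<oplus>\<^bsub>S\<^esub> const (f {#}) = f"
    using f c by (intro S.minus_add_cancel) (simp_all add: S_simps(1))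
  have "f \<in> Q \<longleftrightarrow> const (f {#}) \<in> Q"
  proof
    assume "f \<in> Q"
    hence "const (f {#}) \<oplus>\<^bsub>S\<^esub> (f \<ominus>\<^bsub>S\<^esub> const (f {#})) \<in> Q"
      using sum S.a_comm[of "const (f {#})" "f \<ominus>\<^bsub>S\<^esub> const (f {#})"] c Q.Icarr[OF diff]
      by (simp add: S_simps(1))
    thus "const (f {#}) \<in> Q" by (rule Q.add_cancel_ideal[OF _ diff]) (simp add: S_simps(1) c)
  next
    assume "const (f {#}) \<in> Q"
    hence "(f \<ominus>\<^bsub>S\<^esub> const (f {#})) \<oplus>\<^bsub>S\<^esub> const (f {#}) \<in> Q" by (rule Q.a_closed[OF diff])
    thus "f \<in> Q" unfolding sum .
  qed
  thus ?thesis using coeff_closed[OF f, of "{#}"] by (simp add: contraction_def)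
qed

lemma contraction_strict_mono:
  assumes "ideal P S" "ideal Q S" "\<And>i. i < n \<Longrightarrow> var i \<in> P" "P \<subset> Q"
  shows "contraction P \<subset> contraction Q"
proof -
  obtain f where f: "f \<in> Q" "f \<notin> P" using assms by blast
  have fC: "f \<in> C" using ideal.Icarr[OF assms(2) f(1)] by (simp add: S_simps)
  have "\<And>i. i < n \<Longrightarrow> var i \<in> Q" using assms(3,4) by blast
  hence "f {#} \<in> contraction Q" "f {#} \<notin> contraction P"
    using mem_iff_const_coeff[OF assms(2) _ fC] mem_iff_const_coeff[OF assms(1) assms(3) fC] f by simp_all
  thus ?thesis using contraction_mono[of P Q] assms(4) by blast
qed

text \<open>These steps are used twice: they lengthen lifted chains, which bounds dimensions from
  below, and they carry a chain ending in an extended prime up to a prime with all variables, which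
  bounds heights from above.\<close>

lemma prime_chain_extend_by_vars:
  assumes "prime_chain S Qs" "primeideal P R" "last Qs = avoiding 0 P" "j \<le> n"
  shows "\<exists>Qs'. prime_chain S Qs' \<and> last Qs' = avoiding j P \<and> hd Qs' = hd Qs \<and>
    length Qs' = length Qs + j"
  using assms(4)
proof (induction j)
  case (Suc j)
  then obtain Qs' where Qs': "prime_chain S Qs'" "last Qs' = avoiding j P" "hd Qs' = hd Qs"
    "length Qs' = length Qs + j" by auto
  hence "prime_chain S (Qs' @ [avoiding (Suc j) P])"
    using Suc.prems avoiding_Suc_strict[OF assms(2), of j] avoiding_prime[OF assms(2), of "Suc j"]
    by (intro prime_chain_snoc) auto
  moreover have "Qs' \<noteq> []" using Qs'(1) by (simp add: prime_chain_def)
  ultimately show ?case using Qs' by (intro exI[of _ "Qs' @ [avoiding (Suc j) P]"]) auto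
qed (use assms in auto)

lemma prime_chain_lift:
  assumes Ps: "prime_chain R Ps"
  shows "\<exists>Qs. prime_chain S Qs \<and> hd Qs = avoiding 0 (hd Ps) \<and> length Qs = length Ps + n"
proof -
  have ne: "Ps \<noteq> []" using Ps by (simp add: prime_chain_def)
  have prime: "primeideal P R" if "P \<in> set Ps" for P using that Ps by (simp add: prime_chain_def)
  have "prime_chain S (map (avoiding 0) Ps)"
    using Ps by (rule prime_chain_map) (simp_all add: avoiding_prime avoiding_strict_mono prime)
  moreover have "last (map (avoiding 0) Ps) = avoiding 0 (last Ps)" using ne by (simp add: last_map)
  ultimately obtain Qs where "prime_chain S Qs" "hd Qs = hd (map (avoiding 0) Ps)"
    "length Qs = length Ps + n"
    using prime_chain_extend_by_vars[of "map (avoiding 0) Ps" "last Ps" n] prime[of "last Ps"] ne by auto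
  thus ?thesis using ne by (auto simp: hd_map)
qed

lemma avoiding_0_zero: "avoiding 0 {\<zero>} = {\<zero>\<^bsub>S\<^esub>}"
  using S.zero_closed by (auto simp: avoiding_def S_simps)

text \<open>The extension of a finitely generated ideal consists of all admissible series with
  coefficients in it: each coefficient is written through the same finitely many generators, and the
  multipliers are collected into series. By \<open>C_solid\<close> these are admissible if they
  vanish wherever \<open>f\<close> does.\<close>

lemma Idl_const_image:
  assumes "finite F" "F \<subseteq> carrier R"
  shows "Idl\<^bsub>S\<^esub> (const ` F) = avoiding 0 (Idl F)"
  using assms
proof (induction F rule: finite_induct)
  case empty
  show ?case using avoiding_0_zero by (simp add: genideal_empty S.genideal_empty)
next
  case (insert a F)
  hence a: "a \<in> carrier R" and F: "F \<subseteq> carrier R" by auto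
  interpret I: ideal "Idl F" R using genideal_ideal F .
  have cF: "const ` F \<subseteq> carrier S" "const a \<in> carrier S" and ca: "const a \<in> C"
    using const_in_C a F by (auto simp: S_simps(1))
  have comm: "r \<otimes>\<^bsub>S\<^esub> const a = (\<lambda>m. a \<otimes> r m)" if "r \<in> C" for r
    using S.m_comm[of r "const a"] const_mult[OF a that] that ca by (simp add: S_simps(1))
  have "Idl\<^bsub>S\<^esub> (const ` insert a F) =
    {r \<otimes>\<^bsub>S\<^esub> const a \<oplus>\<^bsub>S\<^esub> k |r k. r \<in> carrier S \<and> k \<in> avoiding 0 (Idl F)}"
    using S.Idl_insert[OF cF(2,1)] insert.IH[OF F] by simp
  also have "\<dots> = avoiding 0 (Idl (insert a F))"
  proof (intro subset_antisym subsetI)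
    fix f assume "f \<in> {r \<otimes>\<^bsub>S\<^esub> const a \<oplus>\<^bsub>S\<^esub> k |r k. r \<in> carrier S \<and> k \<in> avoiding 0 (Idl F)}"
    then obtain r k where f: "f = r \<otimes>\<^bsub>S\<^esub> const a \<oplus>\<^bsub>S\<^esub> k" "r \<in> C" "k \<in> avoiding 0 (Idl F)"
      by (auto simp: S_simps(1))
    have k: "k \<in> C" "k m \<in> Idl F" for m using avoidingD[OF f(3)] by simp_all
    have rc: "r m \<in> carrier R" for m using coeff_closed[OF f(2)] .
    have fm: "f m = r m \<otimes> a \<oplus> k m" for m
      unfolding f(1) comm[OF f(2)] S_simps(5) m_comm[OF a rc] ..
    have "r m \<otimes> a \<oplus> k m \<in> Idl (insert a F)" for m
      unfolding Idl_insert[OF a F] using rc k(2) by blast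
    moreover have "f \<in> C"
      unfolding f(1) using f(2) ca k(1) S.a_closed[of "r \<otimes>\<^bsub>S\<^esub> const a" k] S.m_closed[of r "const a"]
      by (simp only: S_simps(1))
    ultimately show "f \<in> avoiding 0 (Idl (insert a F))" by (intro avoidingI) (simp_all only: fm)
  next
    fix f assume "f \<in> avoiding 0 (Idl (insert a F))"
    hence f: "f \<in> C" "\<And>m. f m \<in> Idl (insert a F)" by (auto simp: avoiding_def)
    \<comment> \<open>The extra clause for \<open>f m = \<zero>\<close> makes the chosen multipliers
      respect the support of \<open>f\<close>, so that they remain polynomials if \<open>f\<close>
      is one.\<close>
    have "\<exists>r k. f m = r \<otimes> a \<oplus> k \<and> r \<in> carrier R \<and> k \<in> Idl F \<and> (f m = \<zero> \<longrightarrow> r = \<zero> \<and> k = \<zero>)" for m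
    proof (cases "f m = \<zero>")
      case True
      thus ?thesis using a I.zero_closed by (intro exI[of _ \<zero>]) auto
    next
      case False
      thus ?thesis using f(2)[of m] unfolding Idl_insert[OF a F] by blast
    qed
    then obtain r k where rk: "\<And>m. f m = r m \<otimes> a \<oplus> k m" "\<And>m. r m \<in> carrier R"
      "\<And>m. k m \<in> Idl F" "\<And>m. f m = \<zero> \<Longrightarrow> r m = \<zero>" "\<And>m. f m = \<zero> \<Longrightarrow> k m = \<zero>" by metis
    have rC: "r \<in> C" using rk(2,4) by (rule C_solid[OF f(1)])
    have kC: "k \<in> C" using I.Icarr[OF rk(3)] rk(5) by (rule C_solid[OF f(1)])
    have "f = r \<otimes>\<^bsub>S\<^esub> const a \<oplus>\<^bsub>S\<^esub> k"
      unfolding comm[OF rC] S_simps(5) m_comm[OF a rk(2)] using rk(1) by (rule ext)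
    moreover have "k \<in> avoiding 0 (Idl F)" using kC rk(3) by (rule avoidingI)
    ultimately show "f \<in> {r \<otimes>\<^bsub>S\<^esub> const a \<oplus>\<^bsub>S\<^esub> k |r k. r \<in> carrier S \<and> k \<in> avoiding 0 (Idl F)}"
      using rC unfolding S_simps(1) by blast
  qed
  finally show ?case .
qed

text \<open>A constant multiplies coefficientwise, and membership in an ideal generated by finitely
  many constants is also tested coefficientwise, so regularity reduces to each coefficient
  separately.\<close>

lemma regular_sequence_lift:
  assumes reg: "regular_sequence R xs" shows "regular_sequence S (map const xs)"
proof -
  have carr: "set xs \<subseteq> carrier R" and ne: "Idl (set xs) \<noteq> carrier R"
    and nzd: "\<And>i b. i < length xs \<Longrightarrow> b \<in> carrier R \<Longrightarrow> xs ! i \<otimes> b \<in> Idl (set (take i xs)) \<Longrightarrow>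
      b \<in> Idl (set (take i xs))"
    using reg unfolding regular_sequence_iff by auto
  have Idl_eq: "Idl\<^bsub>S\<^esub> (set (map const ys)) = avoiding 0 (Idl (set ys))" if "set ys \<subseteq> carrier R" for ys
    using Idl_const_image[of "set ys"] that by simp
  show ?thesis unfolding S.regular_sequence_iff
  proof (intro conjI allI impI ballI)
    show "set (map const xs) \<subseteq> carrier S" using carr const_in_C by (auto simp: S_simps(1))
    have "\<one> \<notin> Idl (set xs)" using ideal.one_imp_carrier[OF genideal_ideal[OF carr]] ne by blast
    hence "\<one>\<^bsub>S\<^esub> \<notin> avoiding 0 (Idl (set xs))"
      using additive_subgroup.zero_closed[OF ideal.axioms(1)[OF genideal_ideal[OF carr]]]
      unfolding S_simps(3) by (simp add: const_in_avoiding)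
    thus "Idl\<^bsub>S\<^esub> (set (map const xs)) \<noteq> carrier S" using Idl_eq[OF carr] S.one_closed by metis
  next
    fix i g assume i: "i < length (map const xs)" and g: "g \<in> carrier S"
      and mem: "map const xs ! i \<otimes>\<^bsub>S\<^esub> g \<in> Idl\<^bsub>S\<^esub> (set (take i (map const xs)))"
    have sub: "set (take i xs) \<subseteq> carrier R" using carr set_take_subset[of i xs] by blast
    have xi: "xs ! i \<in> carrier R" using i carr by auto
    have gC: "g \<in> C" using g by (simp add: S_simps(1))
    have "(\<lambda>m. xs ! i \<otimes> g m) \<in> avoiding 0 (Idl (set (take i xs)))"
      using mem i unfolding take_map Idl_eq[OF sub] by (simp add: const_mult[OF xi gC])
    hence "xs ! i \<otimes> g m \<in> Idl (set (take i xs))" for m by (auto dest: avoidingD)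
    hence "g m \<in> Idl (set (take i xs))" for m
      using nzd[of i "g m"] i coeff_closed[OF gC] by simp
    thus "g \<in> Idl\<^bsub>S\<^esub> (set (take i (map const xs)))"
      unfolding take_map Idl_eq[OF sub] using gC by (intro avoidingI)
  qed
qed

end

section \<open>Transfer of grade, height and dimension\<close>

locale noetherian_series_subring = series_subring + noetherian_ring R +
  assumes noetherian_S: "noetherian_ring S"
begin

sublocale noetherian_cring R
  by (rule noetherian_cring.intro) (rule noetherian_ring_axioms, rule is_cring)

sublocale S: noetherian_cring S
  by (rule noetherian_cring.intro) (rule noetherian_S, rule S.is_cring)

text \<open>At the cost of at most one member for each variable, all remaining primes contain all
  variables; on these, contraction is strictly monotone and nothing more is lost.\<close>

lemma prime_chain_descend:
  assumes Qs: "prime_chain S Qs" and vars: "\<And>i. i < n \<Longrightarrow> var i \<in> last Qs"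
  shows "\<exists>Ps. prime_chain R Ps \<and> last Ps = contraction (last Qs) \<and>
    contraction (hd Qs) \<subseteq> hd Ps \<and> length Qs \<le> length Ps + n"
proof -
  have "\<exists>Qs'. prime_chain S Qs' \<and> last Qs' = last Qs \<and>
    length Qs \<le> length Qs' + card (var ` {..<n}) \<and> hd Qs \<subseteq> hd Qs' \<and> var ` {..<n} \<subseteq> hd Qs'"
    using vars by (intro S.prime_chain_containing[OF Qs]) auto
  then obtain Qs' where Qs': "prime_chain S Qs'" "last Qs' = last Qs"
    "length Qs \<le> length Qs' + card (var ` {..<n})" "hd Qs \<subseteq> hd Qs'" "var ` {..<n} \<subseteq> hd Qs'"
    by auto
  have ne: "Qs' \<noteq> []" using Qs'(1) by (simp add: prime_chain_def)
  have prime: "primeideal Q S" if "Q \<in> set Qs'" for Q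
    using that Qs'(1) by (auto simp: prime_chain_def)
  have ideal: "ideal Q S" if "Q \<in> set Qs'" for Q
    using prime[OF that] by (rule primeideal.axioms(1))
  have var_mem: "var i \<in> Q" if "Q \<in> set Qs'" "i < n" for Q i
    using prime_chain_hd_subset[OF Qs'(1) that(1)] Qs'(5) that(2) by auto
  have "prime_chain R (map contraction Qs')"
  proof (rule prime_chain_map[OF Qs'(1)])
    fix P Q assume "P \<in> set Qs'" "Q \<in> set Qs'" "P \<subset> Q"
    thus "contraction P \<subset> contraction Q"
      by (intro contraction_strict_mono ideal var_mem)
  qed (simp add: contraction_prime prime)
  moreover have "card (var ` {..<n}) \<le> n" using card_image_le[of "{..<n}" var] by simp
  ultimately show ?thesis using Qs'(2,3) contraction_mono[OF Qs'(4)] ne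
    by (intro exI[of _ "map contraction Qs'"]) (auto simp: last_map hd_map)
qed

text \<open>A chain below \<open>avoiding 0 P\<close> continues through \<open>avoiding 1 P\<close>, \<open>\<dots>\<close>, \<open>avoiding n P\<close>,
  so that descending to \<open>R\<close> costs nothing.\<close>

lemma prime_height_avoiding_le:
  assumes P: "primeideal P R"
  shows "prime_height S (avoiding 0 P) \<le> prime_height R P"
  unfolding prime_height_def[of S]
proof (rule Sup_least, clarify)
  fix Qs assume Qs: "prime_chain S Qs" "last Qs = avoiding 0 P"
  obtain Qs' where Qs': "prime_chain S Qs'" "last Qs' = avoiding n P" "length Qs' = length Qs + n"
    using prime_chain_extend_by_vars[OF Qs(1) P Qs(2), of n] by auto
  have "ideal P R" "P \<noteq> carrier R" using P by (auto simp: primeideal_def primeideal_axioms_def)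
  then obtain Ps where Ps: "prime_chain R Ps" "last Ps = P" "length Qs' \<le> length Ps + n"
    using prime_chain_descend[OF Qs'(1)] Qs'(2) var_in_avoiding[of P _ n] contraction_avoiding[of P n] by auto
  have "enat (length Qs - 1) \<le> enat (length Ps - 1)" using Ps Qs' by simp
  also have "\<dots> \<le> prime_height R P" unfolding prime_height_def using Ps by (intro Sup_upper) auto
  finally show "enat (length Qs - 1) \<le> prime_height R P" .
qed

lemma height_avoiding_le: "height S (avoiding 0 J) \<le> height R J"
  unfolding height_def[of R]
proof (rule Inf_greatest, clarify)
  fix P assume P: "primeideal P R" "J \<subseteq> P"
  have "height S (avoiding 0 J) \<le> prime_height S (avoiding 0 P)"
    unfolding height_def using avoiding_prime[OF P(1)] avoiding_mono[OF P(2), of 0 0]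
    by (intro Inf_lower) auto
  also have "\<dots> \<le> prime_height R P" by (rule prime_height_avoiding_le[OF P(1)])
  finally show "height S (avoiding 0 J) \<le> prime_height R P" .
qed

lemma grade_avoiding_ge:
  assumes "ideal J R" shows "grade R J \<le> grade S (avoiding 0 J)"
  unfolding grade_def[of R]
proof (rule Sup_least, clarify)
  interpret J: ideal J R by fact
  fix xs assume "maximal_regular_sequence_in R J xs"
  hence xs: "regular_sequence R xs" "set xs \<subseteq> J" by (auto simp: maximal_regular_sequence_in_def)
  have "set (map const xs) \<subseteq> avoiding 0 J" using xs(2) J.Icarr by (auto simp: const_in_avoiding)
  hence "enat (length (map const xs)) \<le> grade S (avoiding 0 J)"
    by (rule S.regular_sequence_length_le_grade[OF regular_sequence_lift[OF xs(1)]])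
  thus "enat (length xs) \<le> grade S (avoiding 0 J)" by simp
qed

lemma grade_avoiding_eq:
  assumes "ideal J R" "grade R J = height R J"
  shows "grade S (avoiding 0 J) = grade R J"
proof (rule antisym)
  have "grade S (avoiding 0 J) \<le> height S (avoiding 0 J)" by (rule S.grade_le_height)
  also have "\<dots> \<le> grade R J" unfolding assms(2) by (rule height_avoiding_le)
  finally show "grade S (avoiding 0 J) \<le> grade R J" .
qed (rule grade_avoiding_ge[OF assms(1)])

text \<open>The lower bound comes from lifting chains in the same way for both kinds of series. The
  upper bound is left as the hypothesis \<open>bound\<close>, since power series and polynomials
  reach it by different routes.\<close>

lemma coheight_avoiding:
  assumes J: "ideal J R" "J \<noteq> carrier R"
    and bound: "\<And>Qs. prime_chain S Qs \<Longrightarrow> avoiding 0 J \<subseteq> hd Qs \<Longrightarrow>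
      \<exists>Ps. prime_chain R Ps \<and> J \<subseteq> hd Ps \<and> length Qs \<le> length Ps + n"
  shows "coheight S (avoiding 0 J) = coheight R J + enat n"
proof (rule antisym)
  show "coheight S (avoiding 0 J) \<le> coheight R J + enat n"
    unfolding coheight_def[of S]
  proof (rule Sup_least, clarify)
    fix Qs assume "prime_chain S Qs" "avoiding 0 J \<subseteq> hd Qs"
    from bound[OF this] obtain Ps
      where Ps: "prime_chain R Ps" "J \<subseteq> hd Ps" "length Qs \<le> length Ps + n" by auto
    hence "Ps \<noteq> []" by (simp add: prime_chain_def)
    hence "enat (length Qs - 1) \<le> enat (length Ps - 1) + enat n"
      using Ps(3) by (cases Ps) auto
    also have "enat (length Ps - 1) \<le> coheight R J"
      unfolding coheight_def using Ps by (intro Sup_upper) auto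
    finally show "enat (length Qs - 1) \<le> coheight R J + enat n" by (simp add: add_right_mono)
  qed
next
  have lift: "enat (length Ps - 1) + enat n \<le> coheight S (avoiding 0 J)"
    if Ps: "prime_chain R Ps" "J \<subseteq> hd Ps" for Ps
  proof -
    obtain Qs where Qs: "prime_chain S Qs" "hd Qs = avoiding 0 (hd Ps)" "length Qs = length Ps + n"
      using prime_chain_lift[OF Ps(1)] by auto
    have "Ps \<noteq> []" using Ps by (simp add: prime_chain_def)
    hence "enat (length Ps - 1) + enat n = enat (length Qs - 1)" using Qs(3) by (cases Ps) auto
    also have "\<dots> \<le> coheight S (avoiding 0 J)"
      unfolding coheight_def using Qs avoiding_mono[OF Ps(2), of 0 0]
      by (intro Sup_upper CollectI exI[of _ Qs]) simp
    finally show ?thesis .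
  qed
  \<comment> \<open>A chain consisting of one prime above \<open>J\<close> already lifts to
    \<open>n\<close> steps. So \<open>n\<close> is at most the coheight upstairs, and subtracting it
    there does not truncate.\<close>
  obtain P where P: "primeideal P R" "J \<subseteq> P" using exists_prime_above[OF J] .
  have n_le: "enat n \<le> coheight S (avoiding 0 J)"
    using lift[of "[P]"] P prime_chain_singleton[OF P(1)] by (simp add: zero_enat_def[symmetric])
  have "coheight R J \<le> coheight S (avoiding 0 J) - enat n"
    unfolding coheight_def[of R]
  proof (rule Sup_least, clarify)
    fix Ps assume "prime_chain R Ps" "J \<subseteq> hd Ps"
    thus "enat (length Ps - 1) \<le> coheight S (avoiding 0 J) - enat n"
      using lift[of Ps] by (cases "coheight S (avoiding 0 J)") auto
  qed
  thus "coheight R J + enat n \<le> coheight S (avoiding 0 J)"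
    using n_le by (cases "coheight S (avoiding 0 J)"; cases "coheight R J") auto
qed

text \<open>The grade stays the same and both dimensions grow by \<open>n\<close>, which is finite
  and therefore cancels even if the dimensions are infinite. The hypothesis \<open>bound\<close>
  speaks of all ideals because it is applied to the given ideal for the quotient and to the zero
  ideal for the whole ring.\<close>

lemma cohen_macaulay_avoiding_iff:
  assumes J: "ideal J R" "J \<noteq> carrier R" and grade: "grade R J = height R J"
    and bound: "\<And>J Qs. ideal J R \<Longrightarrow> prime_chain S Qs \<Longrightarrow> avoiding 0 J \<subseteq> hd Qs \<Longrightarrow>
      \<exists>Ps. prime_chain R Ps \<and> J \<subseteq> hd Ps \<and> length Qs \<le> length Ps + n"
  shows "cohen_macaulay_wrt R J \<longleftrightarrow> cohen_macaulay_wrt S (avoiding 0 J)"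
proof -
  interpret J: ideal J R by fact
  interpret E: ideal "avoiding 0 J" S by (rule avoiding_ideal[OF J(1)])
  have one: "\<one> \<notin> J" using J J.one_imp_carrier by metis
  hence ne: "{\<zero>} \<noteq> carrier R" using J.zero_closed one_closed by (metis singletonD)
  have "\<one>\<^bsub>S\<^esub> \<notin> avoiding 0 J" using one by (simp add: S_simps(3) const_in_avoiding)
  hence proper: "avoiding 0 J \<noteq> carrier S" using S.one_closed by metis
  have dims: "krull_dim (S Quot avoiding 0 J) = krull_dim (R Quot J) + enat n"
    unfolding E.krull_dim_Quot[OF S.is_cring] J.krull_dim_Quot[OF is_cring]
    by (rule coheight_avoiding[OF J bound[OF J(1)]])
  have dimS: "krull_dim S = krull_dim R + enat n"
    using coheight_avoiding[OF zeroideal ne bound[OF zeroideal]]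
    unfolding avoiding_0_zero S.coheight_zero coheight_zero .
  have cancel: "x + enat n = y + enat n \<longleftrightarrow> x = y" for x y :: enat
    by (cases x; cases y) auto
  have "grade R J + krull_dim (R Quot J) = krull_dim R \<longleftrightarrow>
    grade S (avoiding 0 J) + krull_dim (S Quot avoiding 0 J) = krull_dim S"
    unfolding grade_avoiding_eq[OF J(1) grade] dims dimS add.assoc[symmetric] cancel ..
  thus ?thesis unfolding cohen_macaulay_wrt_def
    using J proper is_cring noetherian_ring_axioms S.is_cring noetherian_S E.is_ideal by simp
qed

end

section \<open>Noetherian rings from completeness\<close>

text \<open>The explicit coefficients are what the completeness argument assembles into series in
  \<open>x\<close>.\<close>

lemma (in cring) Idl_eq_finsum:
  assumes "finite F" "F \<subseteq> carrier R"
  shows "Idl F = {\<Oplus>i\<in>F. a i \<otimes> i |a. a \<in> F \<rightarrow> carrier R}"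
  using assms
proof (induction F rule: finite_induct)
  case empty
  show ?case by (auto simp: genideal_empty)
next
  case (insert x F)
  hence x: "x \<in> carrier R" and F: "F \<subseteq> carrier R" by auto
  have IH: "Idl F = {\<Oplus>i\<in>F. a i \<otimes> i |a. a \<in> F \<rightarrow> carrier R}" by (rule insert.IH[OF F])
  have split: "(\<Oplus>i\<in>insert x F. a i \<otimes> i) = a x \<otimes> x \<oplus> (\<Oplus>i\<in>F. a i \<otimes> i)"
    if "a \<in> insert x F \<rightarrow> carrier R" for a
    using that x F insert.hyps by (intro finsum_insert) (auto simp: Pi_iff subset_iff)
  show ?case
  proof (intro subset_antisym subsetI)
    fix u assume "u \<in> Idl (insert x F)"
    then obtain r k where rk: "u = r \<otimes> x \<oplus> k" "r \<in> carrier R" "k \<in> Idl F"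
      unfolding Idl_insert[OF x F] by blast
    then obtain a where a: "a \<in> F \<rightarrow> carrier R" "k = (\<Oplus>i\<in>F. a i \<otimes> i)" unfolding IH by blast
    let ?a = "a(x := r)"
    have a': "?a \<in> insert x F \<rightarrow> carrier R" using a rk by auto
    have "(\<Oplus>i\<in>F. ?a i \<otimes> i) = k"
      unfolding a(2) using a F insert.hyps by (intro finsum_cong') (auto simp: Pi_iff subset_iff)
    hence "u = (\<Oplus>i\<in>insert x F. ?a i \<otimes> i)" using split[OF a'] rk by simp
    thus "u \<in> {\<Oplus>i\<in>insert x F. a i \<otimes> i |a. a \<in> insert x F \<rightarrow> carrier R}" using a' by blast
  next
    fix u assume "u \<in> {\<Oplus>i\<in>insert x F. a i \<otimes> i |a. a \<in> insert x F \<rightarrow> carrier R}"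
    then obtain a where a: "u = (\<Oplus>i\<in>insert x F. a i \<otimes> i)" "a \<in> insert x F \<rightarrow> carrier R" by blast
    have "(\<Oplus>i\<in>F. a i \<otimes> i) \<in> Idl F" unfolding IH using a(2) by blast
    thus "u \<in> Idl (insert x F)" unfolding Idl_insert[OF x F] a(1) split[OF a(2)] using a(2) by blast
  qed
qed

lemma (in cring) colon_ideal:
  assumes "ideal K R" "x \<in> carrier R" shows "ideal {h \<in> carrier R. x \<otimes> h \<in> K} R"
proof -
  interpret K: ideal K R by fact
  show ?thesis
  proof (rule ideal_intro)
    fix a r assume "a \<in> {h \<in> carrier R. x \<otimes> h \<in> K}" "r \<in> carrier R"
    thus "r \<otimes> a \<in> {h \<in> carrier R. x \<otimes> h \<in> K}"
      using assms(2) K.I_l_closed[of "x \<otimes> a" r] by (auto simp: m_lcomm)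
  qed (use assms(2) in \<open>auto simp: r_distr\<close>)
qed

definition (in ring) finitely_generated where
  "finitely_generated K \<longleftrightarrow> (\<exists>F\<subseteq>carrier R. finite F \<and> K = Idl F)"

text \<open>Every ideal \<open>I\<close> is finitely generated if this holds for the colon ideal by all powers
  of \<open>x\<close>, for which the generators modulo \<open>x\<close> are already generators by completeness.\<close>

locale adically_complete_ring = cring R for R (structure) +
  fixes x
  assumes x_closed: "x \<in> carrier R"
    and generators_mod: "ideal J R \<Longrightarrow>
      \<exists>F. finite F \<and> F \<subseteq> J \<and> (\<forall>f\<in>J. \<exists>g\<in>Idl F. \<exists>h\<in>carrier R. f = g \<oplus> x \<otimes> h)"
    and complete: "range a \<subseteq> carrier R \<Longrightarrow>
      \<exists>h. range h \<subseteq> carrier R \<and> (\<forall>j::nat. h j = a j \<oplus> x \<otimes> h (Suc j))"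
    and separated: "range g \<subseteq> carrier R \<Longrightarrow> (\<And>j::nat. g j = x \<otimes> g (Suc j)) \<Longrightarrow> g 0 = \<zero>"
begin

text \<open>Successive approximation: an element of \<open>J\<close> is a combination of
  \<open>F\<close> plus \<open>x\<close> times a remainder, and the hypothesis on division by
  \<open>x\<close> returns the remainder to \<open>J\<close>. The coefficients of all rounds are
  summed by \<open>complete\<close>. That axiom delivers every tail \<open>h j\<close> of the series
  at once, so that no topology or limit is involved.\<close>

lemma finitely_generated_if_colon_closed:
  assumes J: "ideal J R" and colon: "\<And>h. h \<in> carrier R \<Longrightarrow> x \<otimes> h \<in> J \<Longrightarrow> h \<in> J"
  shows "finitely_generated J"
proof -
  interpret J: ideal J R by fact
  obtain F where F: "finite F" "F \<subseteq> J" and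
    gens: "\<And>f. f \<in> J \<Longrightarrow> \<exists>g\<in>Idl F. \<exists>h\<in>carrier R. f = g \<oplus> x \<otimes> h"
    using generators_mod[OF J] by auto
  have Fc: "F \<subseteq> carrier R" using F(2) J.Icarr by auto
  have FJ: "Idl F \<subseteq> J" by (rule genideal_minimal[OF J F(2)])
  have Idl: "Idl F = {\<Oplus>i\<in>F. a i \<otimes> i |a. a \<in> F \<rightarrow> carrier R}" by (rule Idl_eq_finsum[OF F(1) Fc])
  have "\<exists>a h. a \<in> F \<rightarrow> carrier R \<and> h \<in> J \<and> f = (\<Oplus>i\<in>F. a i \<otimes> i) \<oplus> x \<otimes> h" if f: "f \<in> J" for f
  proof -
    obtain g h where gh: "g \<in> Idl F" "h \<in> carrier R" "f = g \<oplus> x \<otimes> h" using gens[OF f] by auto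
    have g: "g \<in> J" using gh FJ by auto
    have "x \<otimes> h \<oplus> g \<in> J"
      using f unfolding gh(3) a_comm[OF J.Icarr[OF g] m_closed[OF x_closed gh(2)]] .
    hence "x \<otimes> h \<in> J" using g m_closed[OF x_closed gh(2)] by (rule J.add_cancel_ideal)
    hence "h \<in> J" using colon gh by simp
    thus ?thesis using gh unfolding Idl by auto
  qed
  hence "\<forall>f\<in>J. \<exists>p. fst p \<in> F \<rightarrow> carrier R \<and> snd p \<in> J \<and>
    f = (\<Oplus>i\<in>F. fst p i \<otimes> i) \<oplus> x \<otimes> snd p" by force
  from bchoice[OF this] obtain p where p: "\<forall>f\<in>J. fst (p f) \<in> F \<rightarrow> carrier R \<and> snd (p f) \<in> J \<and>
    f = (\<Oplus>i\<in>F. fst (p f) i \<otimes> i) \<oplus> x \<otimes> snd (p f)" ..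
  define A H where "A f = fst (p f)" and "H f = snd (p f)" for f
  have AH: "A f \<in> F \<rightarrow> carrier R" "H f \<in> J" "f = (\<Oplus>i\<in>F. A f i \<otimes> i) \<oplus> x \<otimes> H f" if "f \<in> J" for f
    unfolding A_def H_def using p that by blast+
  have "J \<subseteq> Idl F"
  proof
    fix f assume f: "f \<in> J"
    \<comment> \<open>\<open>g j\<close> is the remainder after \<open>j\<close> rounds;
      \<open>t j\<close> below is the combination of the generators, with tails of the series as
      coefficients, that it should equal.\<close>
    define g where "g j = (H ^^ j) f" for j
    have gJ: "g j \<in> J" for j unfolding g_def by (induction j) (use f AH(2) in auto)
    have gS: "g (Suc j) = H (g j)" for j by (simp add: g_def)
    have gc: "g j \<in> carrier R" for j using gJ J.Icarr by auto
    have "\<exists>h. range h \<subseteq> carrier R \<and> (\<forall>j. h j = A (g j) i \<oplus> x \<otimes> h (Suc j))" if i: "i \<in> F" for i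
      using AH(1)[OF gJ] i by (intro complete) auto
    hence "\<forall>i\<in>F. \<exists>h. range h \<subseteq> carrier R \<and> (\<forall>j. h j = A (g j) i \<oplus> x \<otimes> h (Suc j))" ..
    from bchoice[OF this] obtain h where
      h': "\<forall>i\<in>F. range (h i) \<subseteq> carrier R \<and> (\<forall>j. h i j = A (g j) i \<oplus> x \<otimes> h i (Suc j))" ..
    have h: "h i j \<in> carrier R" "h i j = A (g j) i \<oplus> x \<otimes> h i (Suc j)" if "i \<in> F" for i j
      using h' that by blast+
    define t where "t j = (\<Oplus>i\<in>F. h i j \<otimes> i)" for j
    define s where "s j = (\<Oplus>i\<in>F. A (g j) i \<otimes> i)" for j
    have Ac: "A (g j) i \<in> carrier R" if "i \<in> F" for i j using AH(1)[OF gJ] that by auto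
    have tc: "t j \<in> carrier R" and sc: "s j \<in> carrier R" for j
      unfolding t_def s_def using h(1) Ac Fc by (auto intro!: finsum_closed)
    have t: "t j = s j \<oplus> x \<otimes> t (Suc j)" for j
    proof -
      have "t j = (\<Oplus>i\<in>F. A (g j) i \<otimes> i \<oplus> x \<otimes> (h i (Suc j) \<otimes> i))"
        unfolding t_def
      proof (rule finsum_cong')
        fix i assume i: "i \<in> F"
        show "h i j \<otimes> i = A (g j) i \<otimes> i \<oplus> x \<otimes> (h i (Suc j) \<otimes> i)"
          unfolding h(2)[OF i, of j] using h(1)[OF i, of "Suc j"] Ac[OF i] x_closed Fc i
          by (simp add: l_distr m_assoc subset_iff)
      qed (use h(1) Ac x_closed Fc in \<open>auto simp: subset_iff\<close>)
      also have "\<dots> = s j \<oplus> (\<Oplus>i\<in>F. x \<otimes> (h i (Suc j) \<otimes> i))"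
        unfolding s_def using h(1) Ac x_closed Fc by (intro finsum_addf) (auto simp: subset_iff)
      also have "(\<Oplus>i\<in>F. x \<otimes> (h i (Suc j) \<otimes> i)) = x \<otimes> t (Suc j)"
        unfolding t_def using h(1) x_closed Fc F(1) by (intro finsum_rdistr[symmetric]) (auto simp: subset_iff)
      finally show ?thesis .
    qed
    \<comment> \<open>Remainders and tails obey the same recursion, so each difference is
      \<open>x\<close> times the next one and the first vanishes by separatedness.\<close>
    have "(\<lambda>j. g j \<ominus> t j) 0 = \<zero>"
    proof (rule separated)
      show "range (\<lambda>j. g j \<ominus> t j) \<subseteq> carrier R" using gc tc by auto
      fix j
      have gj: "g j = s j \<oplus> x \<otimes> g (Suc j)" unfolding s_def gS by (rule AH(3)[OF gJ])
      have "g j \<ominus> t j = (s j \<oplus> x \<otimes> g (Suc j)) \<ominus> (s j \<oplus> x \<otimes> t (Suc j))"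
        by (subst gj, subst t[of j]) (rule refl)
      also have "\<dots> = x \<otimes> (g (Suc j) \<ominus> t (Suc j))"
        using sc gc[of "Suc j"] tc[of "Suc j"] x_closed by algebra
      finally show "g j \<ominus> t j = x \<otimes> (g (Suc j) \<ominus> t (Suc j))" .
    qed
    hence "f = t 0" using gc[of 0] tc[of 0] by (simp add: g_def)
    moreover have "t 0 \<in> Idl F" unfolding Idl t_def using h(1) by auto
    ultimately show "f \<in> Idl F" by simp
  qed
  thus ?thesis using FJ F(1) Fc unfolding finitely_generated_def by auto
qed

text \<open>Generators modulo \<open>x\<close> approximate an element of \<open>K\<close> by an
  element of \<open>K\<close>, so the error \<open>x \<otimes> h\<close> is in \<open>K\<close> too;
  it is accounted for by \<open>x\<close> times the generators of the colon ideal.\<close>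

lemma finitely_generated_if_colon:
  assumes K: "ideal K R" and fg: "finitely_generated {h \<in> carrier R. x \<otimes> h \<in> K}"
  shows "finitely_generated K"
proof -
  interpret K: ideal K R by fact
  obtain F where F: "finite F" "F \<subseteq> K" and
    gens: "\<And>f. f \<in> K \<Longrightarrow> \<exists>g\<in>Idl F. \<exists>h\<in>carrier R. f = g \<oplus> x \<otimes> h"
    using generators_mod[OF K] by auto
  obtain F' where F': "F' \<subseteq> carrier R" "finite F'" "{h \<in> carrier R. x \<otimes> h \<in> K} = Idl F'"
    using fg unfolding finitely_generated_def by auto
  let ?G = "F \<union> (\<otimes>) x ` F'"
  have GK: "?G \<subseteq> K" using F(2) F'(3) genideal_self[OF F'(1)] by auto
  have Gc: "?G \<subseteq> carrier R" using GK K.Icarr by auto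
  interpret G: ideal "Idl ?G" R by (rule genideal_ideal[OF Gc])
  have "Idl F' \<subseteq> {h \<in> carrier R. x \<otimes> h \<in> Idl ?G}"
    using genideal_self[OF Gc] F'(1)
    by (intro genideal_minimal colon_ideal G.is_ideal x_closed) auto
  hence colon: "x \<otimes> h \<in> Idl ?G" if "h \<in> carrier R" "x \<otimes> h \<in> K" for h using that F'(3) by auto
  have FG: "Idl F \<subseteq> Idl ?G" using genideal_self[OF Gc] by (intro genideal_minimal G.is_ideal) auto
  have FK: "Idl F \<subseteq> K" by (rule genideal_minimal[OF K F(2)])
  have "K \<subseteq> Idl ?G"
  proof
    fix f assume f: "f \<in> K"
    obtain g h where gh: "g \<in> Idl F" "h \<in> carrier R" "f = g \<oplus> x \<otimes> h" using gens[OF f] by auto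
    have g: "g \<in> K" using gh FK by auto
    have "x \<otimes> h \<oplus> g \<in> K"
      using f unfolding gh(3) a_comm[OF K.Icarr[OF g] m_closed[OF x_closed gh(2)]] .
    hence "x \<otimes> h \<in> K" using g m_closed[OF x_closed gh(2)] by (rule K.add_cancel_ideal)
    hence "x \<otimes> h \<in> Idl ?G" using colon gh by simp
    thus "f \<in> Idl ?G" using gh FG by auto
  qed
  hence "K = Idl ?G" using genideal_minimal[OF K GK] by auto
  moreover have "finite ?G" using F(1) F'(2) by simp
  ultimately show ?thesis unfolding finitely_generated_def using Gc by metis
qed

lemma noetherian: "noetherian_ring R"
proof (rule noetherian_ringI)
  fix I assume I: "ideal I R"
  define K where "K d = {h \<in> carrier R. x [^] d \<otimes> h \<in> I}" for d :: nat
  have K_ideal: "ideal (K d) R" for d unfolding K_def using I x_closed by (intro colon_ideal) auto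
  have K_Suc: "{h \<in> carrier R. x \<otimes> h \<in> K d} = K (Suc d)" for d
    unfolding K_def using x_closed by (auto simp: m_assoc)
  have "K d \<subseteq> K (Suc d)" for d
    unfolding K_Suc[symmetric] using ideal.I_l_closed[OF K_ideal _ x_closed] ideal.Icarr[OF K_ideal] by auto
  hence K_mono: "K d \<subseteq> K e" if "d \<le> e" for d e using that by (metis lift_Suc_mono_le)
  have "ideal (\<Union>d. K d) R"
  proof (rule ideal_intro)
    fix a b assume "a \<in> (\<Union>d. K d)" "b \<in> (\<Union>d. K d)"
    then obtain d e where "a \<in> K d" "b \<in> K e" by auto
    hence "a \<in> K (max d e)" "b \<in> K (max d e)" using K_mono[of d "max d e"] K_mono[of e "max d e"] by auto
    hence "a \<oplus> b \<in> K (max d e)"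
      by (rule additive_subgroup.a_closed[OF ideal.axioms(1)[OF K_ideal]])
    thus "a \<oplus> b \<in> (\<Union>d. K d)" by auto
  next
    fix a r assume "a \<in> (\<Union>d. K d)" and r: "r \<in> carrier R"
    then obtain d where "a \<in> K d" by auto
    hence "r \<otimes> a \<in> K d" using ideal.I_l_closed[OF K_ideal] r by auto
    thus "r \<otimes> a \<in> (\<Union>d. K d)" by auto
  next
    show "(\<Union>d. K d) \<subseteq> carrier R" by (auto simp: K_def)
    show "\<zero> \<in> (\<Union>d. K d)" using additive_subgroup.zero_closed[OF ideal.axioms(1)[OF K_ideal]] by auto
  qed
  moreover have "h \<in> (\<Union>d. K d)" if "h \<in> carrier R" "x \<otimes> h \<in> (\<Union>d. K d)" for h
    using that K_Suc by auto
  ultimately have "finitely_generated (\<Union>d. K d)" by (rule finitely_generated_if_colon_closed)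
  then obtain F where F: "F \<subseteq> carrier R" "finite F" "(\<Union>d. K d) = Idl F"
    unfolding finitely_generated_def by auto
  have "\<forall>f\<in>F. \<exists>d. f \<in> K d" using genideal_self[OF F(1)] F(3) by auto
  then obtain e where e: "\<And>f. f \<in> F \<Longrightarrow> f \<in> K (e f)" by metis
  \<comment> \<open>The union is generated by finitely many elements, and the colon ideals increase,
    so one of them contains all generators and equals the union.\<close>
  define N where "N = Max (insert 0 (e ` F))"
  have "f \<in> K N" if "f \<in> F" for f
  proof -
    have "e f \<le> N" unfolding N_def using that F(2) by (intro Max_ge) auto
    thus ?thesis using e[OF that] K_mono[of "e f" N] by auto
  qed
  hence "Idl F \<subseteq> K N" by (intro genideal_minimal K_ideal) auto
  hence "K N = Idl F" using F(3) by auto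
  hence fgN: "finitely_generated (K N)" using F(1,2) unfolding finitely_generated_def by auto
  \<comment> \<open>Finite generation is passed down from \<open>K N\<close> to \<open>K 0\<close>,
    which is \<open>I\<close>; each \<open>K d\<close> has \<open>K (Suc d)\<close> as its colon
    ideal by \<open>x\<close>.\<close>
  have "finitely_generated (K (N - d))" for d
  proof (induction d)
    case (Suc d)
    show ?case
    proof (cases "d < N")
      case True
      hence "Suc (N - Suc d) = N - d" by simp
      thus ?thesis using Suc finitely_generated_if_colon[OF K_ideal, of "N - Suc d"] unfolding K_Suc by simp
    next
      case False
      thus ?thesis using Suc by simp
    qed
  qed (simp add: fgN)
  from this[of N] have "finitely_generated (K 0)" by simp
  moreover have "K 0 = I" unfolding K_def using ideal.Icarr[OF I] by auto
  ultimately show "\<exists>A\<subseteq>carrier R. finite A \<and> I = Idl A" unfolding finitely_generated_def by simp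
qed

text \<open>The geometric series shows that \<open>x\<close> lies in the Jacobson radical.\<close>

lemma Idl_insert_proper:
  assumes Q: "ideal Q R" "Q \<noteq> carrier R" shows "Idl (insert x Q) \<noteq> carrier R"
proof
  interpret Q: ideal Q R by fact
  have Qc: "Q \<subseteq> carrier R" using Q.Icarr by auto
  assume "Idl (insert x Q) = carrier R"
  hence "\<one> \<in> Idl (insert x Q)" by simp
  moreover have "Idl Q = Q" by (rule genideal_of_ideal[OF Q(1)])
  ultimately obtain r q where rq: "\<one> = r \<otimes> x \<oplus> q" "r \<in> carrier R" "q \<in> Q"
    unfolding Idl_insert[OF x_closed Qc] by auto
  have qc: "q \<in> carrier R" using rq Q.Icarr by auto
  have "\<exists>h. range h \<subseteq> carrier R \<and> (\<forall>j. h j = r [^] j \<oplus> x \<otimes> h (Suc j))"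
    using rq by (intro complete) auto
  then obtain h where h': "range h \<subseteq> carrier R \<and> (\<forall>j::nat. h j = r [^] j \<oplus> x \<otimes> h (Suc j))" ..
  \<comment> \<open>\<open>h j\<close> stands for the series with terms
    \<open>x [^] i \<otimes> r [^] (j + i)\<close>, so \<open>h 0\<close> should invert
    \<open>\<one> \<ominus> r \<otimes> x\<close>, which is \<open>q\<close>.\<close>
  have h: "h j \<in> carrier R" "h j = r [^] j \<oplus> x \<otimes> h (Suc j)" for j using h' by blast+
  \<comment> \<open>That passing to the next tail multiplies the series by \<open>r\<close> is
    formally obvious, but must be derived from the recursion by separatedness.\<close>
  have "(\<lambda>j. h (Suc j) \<ominus> r \<otimes> h j) 0 = \<zero>"
  proof (rule separated)
    show "range (\<lambda>j. h (Suc j) \<ominus> r \<otimes> h j) \<subseteq> carrier R" using h(1) rq by auto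
    fix j
    have "h (Suc j) \<ominus> r \<otimes> h j =
      (r [^] Suc j \<oplus> x \<otimes> h (Suc (Suc j))) \<ominus> r \<otimes> (r [^] j \<oplus> x \<otimes> h (Suc j))"
      unfolding h(2)[of j, symmetric] h(2)[of "Suc j", symmetric] ..
    also have "\<dots> = (r [^] j \<otimes> r \<oplus> x \<otimes> h (Suc (Suc j))) \<ominus> r \<otimes> (r [^] j \<oplus> x \<otimes> h (Suc j))" by simp
    also have "\<dots> = x \<otimes> (h (Suc (Suc j)) \<ominus> r \<otimes> h (Suc j))"
      using h(1)[of "Suc j"] h(1)[of "Suc (Suc j)"] x_closed rq(2) nat_pow_closed[OF rq(2), of j] by algebra
    finally show "h (Suc j) \<ominus> r \<otimes> h j = x \<otimes> (h (Suc (Suc j)) \<ominus> r \<otimes> h (Suc j))" .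
  qed
  hence h1: "h (Suc 0) = r \<otimes> h 0" using h(1)[of 0] h(1)[of "Suc 0"] rq(2) by simp
  have "h 0 = r [^] (0::nat) \<oplus> x \<otimes> (r \<otimes> h 0)" using h(2)[of 0] unfolding h1 .
  hence h0: "h 0 = \<one> \<oplus> x \<otimes> (r \<otimes> h 0)" by (simp only: nat_pow_0)
  have "q = \<one> \<ominus> r \<otimes> x" unfolding rq(1) using rq(2) x_closed qc by algebra
  hence "h 0 \<otimes> q = h 0 \<otimes> (\<one> \<ominus> r \<otimes> x)" by simp
  also have "\<dots> = h 0 \<ominus> x \<otimes> (r \<otimes> h 0)" using h(1)[of 0] rq(2) x_closed by algebra
  also have "\<dots> = (\<one> \<oplus> x \<otimes> (r \<otimes> h 0)) \<ominus> x \<otimes> (r \<otimes> h 0)" unfolding h0[symmetric] ..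
  also have "\<dots> = \<one>" using h(1)[of 0] rq(2) x_closed by algebra
  finally have "\<one> \<in> Q" using Q.I_l_closed[OF rq(3) h(1)[of 0]] by simp
  thus False using Q.one_imp_carrier Q(2) by simp
qed

end

section \<open>Polynomial extensions\<close>

text \<open>\<open>D d\<close> is the set of polynomials in \<open>x\<close> over the subring \<open>A\<close> of degree less than \<open>d\<close>.\<close>

locale polynomial_extension = cring R for R (structure) +
  fixes A :: "'a set" and x :: 'a and D :: "nat \<Rightarrow> 'a set"
  assumes A_subring: "subring A R"
    and A_noetherian: "noetherian_ring (R\<lparr>carrier := A\<rparr>)"
    and x_closed: "x \<in> carrier R"
    and D_0: "D 0 = {\<zero>}" and D_Suc_0: "D (Suc 0) = A"
    and D_Suc: "D d \<subseteq> D (Suc d)" and D_cover: "carrier R = (\<Union>d. D d)"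
    and D_add: "f \<in> D d \<Longrightarrow> g \<in> D d \<Longrightarrow> f \<oplus> g \<in> D d"
    and D_smult: "a \<in> A \<Longrightarrow> f \<in> D d \<Longrightarrow> a \<otimes> f \<in> D d"
    and D_shift: "f \<in> D d \<Longrightarrow> x \<otimes> f \<in> D (Suc d)"
    and D_lead: "f \<in> D (Suc d) \<Longrightarrow> \<exists>a\<in>A. f \<ominus> a \<otimes> x [^] d \<in> D d"
begin

abbreviation B where "B \<equiv> R\<lparr>carrier := A\<rparr>"

lemma A_subset: "A \<subseteq> carrier R" using subringE(1)[OF A_subring] .

lemma A_closed: "a \<in> A \<Longrightarrow> a \<in> carrier R" using A_subset by auto

lemma D_closed: "f \<in> D d \<Longrightarrow> f \<in> carrier R" using D_cover by auto

lemma B_cring: "cring B"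
  using subcring_iff[OF A_subset] subcringI'[OF A_subring] by simp

lemma B_noetherian_cring: "noetherian_cring B"
  using A_noetherian B_cring by (rule noetherian_cring.intro)

lemma D_mono: "d \<le> e \<Longrightarrow> D d \<subseteq> D e"
  using D_Suc by (metis lift_Suc_mono_le)

lemma D_minus:
  assumes "f \<in> D d" "g \<in> D d" shows "f \<ominus> g \<in> D d"
proof -
  have "(\<ominus> \<one>) \<otimes> g \<in> D d" using D_smult subringE(3,5)[OF A_subring] assms(2) by auto
  moreover have "(\<ominus> \<one>) \<otimes> g = \<ominus> g" using D_closed[OF assms(2)] by (simp add: l_minus)
  ultimately show ?thesis using D_add[OF assms(1)] by (simp add: a_minus_def)
qed

lemma D_shift_pow: "f \<in> D d \<Longrightarrow> x [^] k \<otimes> f \<in> D (d + k)"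
proof (induction k)
  case 0
  thus ?case using D_closed by simp
next
  case (Suc k)
  have "x [^] Suc k \<otimes> f = x \<otimes> (x [^] k \<otimes> f)"
    using D_closed[OF Suc.prems] x_closed by (simp add: m_ac)
  thus ?case using D_shift[OF Suc.IH[OF Suc.prems]] by simp
qed

lemma zero_in_D: "\<zero> \<in> D d"
  using D_mono[of 0 d] D_0 by auto

definition leading :: "'a set \<Rightarrow> nat \<Rightarrow> 'a set" where
  "leading I d = {a \<in> A. \<exists>f\<in>I. f \<in> D (Suc d) \<and> f \<ominus> a \<otimes> x [^] d \<in> D d}"

lemma leading_ideal:
  assumes "ideal I R" shows "ideal (leading I d) B"
proof -
  interpret I: ideal I R by fact
  interpret B: cring B by (rule B_cring)
  have xd: "x [^] d \<in> carrier R" using x_closed by simp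
  show ?thesis
  proof (rule B.ideal_intro)
    show "leading I d \<subseteq> carrier B" by (auto simp: leading_def)
    have "\<zero> \<ominus> \<zero> \<otimes> x [^] d = \<zero>" using xd by (simp add: a_minus_def)
    thus "\<zero>\<^bsub>B\<^esub> \<in> leading I d"
      using subringE(2)[OF A_subring] zero_in_D by (auto simp: leading_def intro!: bexI[of _ \<zero>])
  next
    fix a b assume "a \<in> leading I d" "b \<in> leading I d"
    then obtain f g where *: "a \<in> A" "b \<in> A" "f \<in> I" "g \<in> I" "f \<in> D (Suc d)" "g \<in> D (Suc d)"
      "f \<ominus> a \<otimes> x [^] d \<in> D d" "g \<ominus> b \<otimes> x [^] d \<in> D d" by (auto simp: leading_def)
    have "(f \<oplus> g) \<ominus> (a \<oplus> b) \<otimes> x [^] d = (f \<ominus> a \<otimes> x [^] d) \<oplus> (g \<ominus> b \<otimes> x [^] d)"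
      using A_closed[OF *(1)] A_closed[OF *(2)] D_closed[OF *(5)] D_closed[OF *(6)] xd by algebra
    hence "(f \<oplus> g) \<ominus> (a \<oplus> b) \<otimes> x [^] d \<in> D d" using D_add[OF *(7,8)] by simp
    moreover have "f \<oplus> g \<in> I" "f \<oplus> g \<in> D (Suc d)" "a \<oplus> b \<in> A"
      using * D_add subringE(7)[OF A_subring] by auto
    ultimately show "a \<oplus>\<^bsub>B\<^esub> b \<in> leading I d" by (auto simp: leading_def)
  next
    fix a r assume "a \<in> leading I d" "r \<in> carrier B"
    then obtain f where *: "a \<in> A" "r \<in> A" "f \<in> I" "f \<in> D (Suc d)"
      "f \<ominus> a \<otimes> x [^] d \<in> D d" by (auto simp: leading_def)
    have "(r \<otimes> f) \<ominus> (r \<otimes> a) \<otimes> x [^] d = r \<otimes> (f \<ominus> a \<otimes> x [^] d)"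
      using A_closed[OF *(1)] A_closed[OF *(2)] D_closed[OF *(4)] xd by algebra
    hence "(r \<otimes> f) \<ominus> (r \<otimes> a) \<otimes> x [^] d \<in> D d" using D_smult[OF *(2,5)] by simp
    moreover have "r \<otimes> f \<in> I" using I.I_l_closed[OF *(3) A_closed[OF *(2)]] .
    moreover have "r \<otimes> f \<in> D (Suc d)" using D_smult * by auto
    moreover have "r \<otimes> a \<in> A" using * subringE(6)[OF A_subring] by auto
    ultimately show "r \<otimes>\<^bsub>B\<^esub> a \<in> leading I d" by (auto simp: leading_def)
  qed
qed

lemma leading_Suc:
  assumes "ideal I R" shows "leading I d \<subseteq> leading I (Suc d)"
proof
  interpret I: ideal I R by fact
  fix a assume "a \<in> leading I d"
  then obtain f where *: "a \<in> A" "f \<in> I" "f \<in> D (Suc d)" "f \<ominus> a \<otimes> x [^] d \<in> D d"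
    by (auto simp: leading_def)
  have "(x \<otimes> f) \<ominus> a \<otimes> (x [^] d \<otimes> x) = x \<otimes> (f \<ominus> a \<otimes> x [^] d)"
    using A_closed[OF *(1)] D_closed[OF *(3)] x_closed nat_pow_closed[OF x_closed, of d] by algebra
  hence "(x \<otimes> f) \<ominus> a \<otimes> x [^] Suc d \<in> D (Suc d)" using D_shift[OF *(4)] by simp
  moreover have "x \<otimes> f \<in> I" "x \<otimes> f \<in> D (Suc (Suc d))" using I.I_l_closed[OF *(2) x_closed] D_shift[OF *(3)] by auto
  ultimately show "a \<in> leading I (Suc d)" using *(1) by (auto simp: leading_def)
qed

lemma leading_mono:
  assumes "ideal I R" "d \<le> e" shows "leading I d \<subseteq> leading I e"
  using lift_Suc_mono_le[of "leading I"] leading_Suc[OF assms(1)] assms(2) by auto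

text \<open>Subtracting a member of \<open>J\<close> with the same top coefficient lowers the
  degree, so induction on the degree exhausts \<open>I\<close>.\<close>

lemma subset_if_leading_subset:
  assumes I: "ideal I R" and J: "ideal J R" "J \<subseteq> I"
    and lead: "\<And>d. leading I d \<subseteq> leading J d"
  shows "I \<subseteq> J"
proof -
  interpret I: ideal I R by fact
  interpret J: ideal J R by fact
  have "f \<in> I \<Longrightarrow> f \<in> D d \<Longrightarrow> f \<in> J" for f d
  proof (induction d arbitrary: f)
    case 0
    thus ?case using D_0 by simp
  next
    case (Suc d)
    obtain a where a: "a \<in> A" "f \<ominus> a \<otimes> x [^] d \<in> D d" using D_lead[OF Suc.prems(2)] by auto
    hence "a \<in> leading J d" using lead[of d] Suc.prems by (auto simp: leading_def)
    then obtain g where g: "g \<in> J" "g \<in> D (Suc d)" "g \<ominus> a \<otimes> x [^] d \<in> D d" by (auto simp: leading_def)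
    have fc: "f \<in> carrier R" and gc: "g \<in> carrier R" using Suc.prems g D_closed by auto
    have "f \<ominus> g = (f \<ominus> a \<otimes> x [^] d) \<ominus> (g \<ominus> a \<otimes> x [^] d)"
      using fc gc A_closed[OF a(1)] nat_pow_closed[OF x_closed, of d] by algebra
    hence "f \<ominus> g \<in> D d" using D_minus[OF a(2) g(3)] by simp
    moreover have "f \<ominus> g \<in> I" using Suc.prems(1) g(1) J(2) by (intro I.minus_closed_ideal) auto
    ultimately have "f \<ominus> g \<in> J" using Suc.IH by simp
    hence "(f \<ominus> g) \<oplus> g \<in> J" using g(1) by simp
    thus ?case using minus_add_cancel[OF fc gc] by simp
  qed
  moreover have "\<exists>d. f \<in> D d" if "f \<in> I" for f using I.Icarr[OF that] D_cover by auto
  ultimately show ?thesis by blast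
qed

text \<open>Hilbert's basis theorem: the leading coefficient ideals increase with the degree and are
  constant from some \<open>N\<close> on, so polynomials realizing generators of those up to
  \<open>N\<close> suffice.\<close>

lemma noetherian: "noetherian_ring R"
proof (rule noetherian_ringI)
  fix I assume I: "ideal I R"
  interpret I: ideal I R by fact
  interpret B: noetherian_cring B by (rule B_noetherian_cring)
  have "\<exists>M\<in>range (leading I). \<forall>L\<in>range (leading I). M \<subseteq> L \<longrightarrow> L = M"
    using leading_ideal[OF I] by (intro B.maximal_ideal_in_family) auto
  then obtain N where N: "\<And>d. leading I N \<subseteq> leading I d \<Longrightarrow> leading I d = leading I N" by auto
  have "\<exists>F. F \<subseteq> carrier B \<and> finite F \<and> leading I d = Idl\<^bsub>B\<^esub> F" for d
    using B.finetely_gen[OF leading_ideal[OF I]] by auto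
  then obtain F where F: "\<And>d. F d \<subseteq> carrier B" "\<And>d. finite (F d)"
    "\<And>d. leading I d = Idl\<^bsub>B\<^esub> (F d)" by metis
  have FI: "F d \<subseteq> leading I d" for d unfolding F(3) by (rule B.genideal_self[OF F(1)])
  define w where "w d a = (SOME f. f \<in> I \<and> f \<in> D (Suc d) \<and> f \<ominus> a \<otimes> x [^] d \<in> D d)" for d a
  have w: "w d a \<in> I" "w d a \<in> D (Suc d)" "w d a \<ominus> a \<otimes> x [^] d \<in> D d" if "a \<in> F d" for d a
  proof -
    have "a \<in> leading I d" using FI that by (rule subsetD)
    hence "\<exists>f. f \<in> I \<and> f \<in> D (Suc d) \<and> f \<ominus> a \<otimes> x [^] d \<in> D d" unfolding leading_def by blast
    from someI_ex[OF this] show "w d a \<in> I" "w d a \<in> D (Suc d)" "w d a \<ominus> a \<otimes> x [^] d \<in> D d"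
      unfolding w_def by blast+
  qed
  define G where "G = (\<Union>d\<le>N. w d ` F d)"
  have "finite G" unfolding G_def using F(2) by auto
  have GI: "G \<subseteq> I" unfolding G_def using w(1) by auto
  have Gc: "G \<subseteq> carrier R" using GI I.Icarr by auto
  have J: "ideal (Idl G) R" by (rule genideal_ideal[OF Gc])
  have JI: "Idl G \<subseteq> I" by (rule genideal_minimal[OF I GI])
  have low: "leading I d \<subseteq> leading (Idl G) d" if "d \<le> N" for d
    unfolding F(3)
  proof (rule B.genideal_minimal[OF leading_ideal[OF J]])
    show "F d \<subseteq> leading (Idl G) d"
    proof
      fix a assume a: "a \<in> F d"
      hence "w d a \<in> Idl G" using genideal_self[OF Gc] that unfolding G_def by auto
      moreover have "a \<in> A" using a F(1) by auto
      ultimately show "a \<in> leading (Idl G) d" using w(2,3)[OF a] by (auto simp: leading_def)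
    qed
  qed
  have "leading I d \<subseteq> leading (Idl G) d" for d
  proof (cases "d \<le> N")
    case False
    hence "leading I d = leading I N" using N leading_mono[OF I, of N d] by simp
    thus ?thesis using low[of N] leading_mono[OF J, of N d] False by auto
  qed (rule low)
  hence "I = Idl G" using subset_if_leading_subset[OF I J JI] JI by auto
  thus "\<exists>A\<subseteq>carrier R. finite A \<and> I = Idl A" using Gc \<open>finite G\<close> by auto
qed

section \<open>Chains of primes in a polynomial extension by one variable\<close>

lemma exists_min_degree:
  assumes P: "ideal P R" and Q: "ideal Q R" and "P \<subset> Q"
  shows "\<exists>f d a. f \<in> Q \<and> f \<notin> P \<and> f \<in> D (Suc d) \<and> (\<forall>h\<in>Q. h \<in> D d \<longrightarrow> h \<in> P) \<and>
    a \<in> A \<and> a \<notin> P \<and> f \<ominus> a \<otimes> x [^] d \<in> D d"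
proof -
  interpret P: ideal P R by fact
  interpret Q: ideal Q R by fact
  let ?E = "\<lambda>e. \<exists>f. f \<in> Q \<and> f \<notin> P \<and> f \<in> D e"
  obtain f0 where "f0 \<in> Q" "f0 \<notin> P" using assms(3) by auto
  hence ex: "\<exists>e. ?E e" using D_cover Q.Icarr by fastforce
  define e where "e = (LEAST e. ?E e)"
  obtain f where f: "f \<in> Q" "f \<notin> P" "f \<in> D e" using LeastI_ex[OF ex] unfolding e_def by auto
  have "e \<noteq> 0" using f D_0 by (metis P.zero_closed singletonD)
  then obtain d where d: "e = Suc d" using not0_implies_Suc by auto
  have "\<not> ?E d" using not_less_Least[of d ?E] d unfolding e_def by simp
  hence min: "\<forall>h\<in>Q. h \<in> D d \<longrightarrow> h \<in> P" by auto
  obtain a where a: "a \<in> A" "f \<ominus> a \<otimes> x [^] d \<in> D d" using D_lead f(3) d by auto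
  \<comment> \<open>Otherwise removing the leading term would leave an element of \<open>Q\<close>
    outside \<open>P\<close> of smaller degree.\<close>
  have "a \<notin> P"
  proof
    assume "a \<in> P"
    hence aP: "a \<otimes> x [^] d \<in> P" using x_closed by (intro P.I_r_closed) auto
    hence "f \<ominus> a \<otimes> x [^] d \<in> Q" using f(1) assms(3) by (intro Q.minus_closed_ideal) auto
    hence "f \<ominus> a \<otimes> x [^] d \<in> P" using min a(2) by auto
    hence "(f \<ominus> a \<otimes> x [^] d) \<oplus> a \<otimes> x [^] d \<in> P" using aP by simp
    thus False using f minus_add_cancel[of f "a \<otimes> x [^] d"] Q.Icarr[OF f(1)] P.Icarr[OF aP] by simp
  qed
  thus ?thesis using f d min a by auto
qed

lemma pow_in_A: "a \<in> A \<Longrightarrow> a [^] (m::nat) \<in> A"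
  using subringE(3,6)[OF A_subring] by (induction m) auto

text \<open>Ordinary division with remainder, except that each step multiplies by the leading
  coefficient \<open>b\<close>, which need not be a unit. The bound \<open>k\<close> on the quotient
  is recorded because the fibre argument compares its degree with that of \<open>f\<close>.\<close>

lemma pseudo_division:
  assumes b: "b \<in> A" and g: "g \<in> D (Suc e)" "g \<ominus> b \<otimes> x [^] e \<in> D e"
  shows "f \<in> D (e + k) \<Longrightarrow> \<exists>m q r. q \<in> D k \<and> r \<in> D e \<and> b [^] (m::nat) \<otimes> f = q \<otimes> g \<oplus> r"
proof (induction k arbitrary: f)
  case 0
  thus ?case using D_closed[of f e] D_closed[OF g(1)] zero_in_D
    by (intro exI[of _ 0] exI[of _ \<zero>] exI[of _ f]) auto
next
  case (Suc k)
  obtain c where c: "c \<in> A" "f \<ominus> c \<otimes> x [^] (e + k) \<in> D (e + k)" using D_lead Suc.prems by auto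
  have carr: "b \<in> carrier R" "c \<in> carrier R" "g \<in> carrier R" "f \<in> carrier R"
    "x [^] e \<in> carrier R" "x [^] k \<in> carrier R"
    using b c(1) A_closed D_closed g(1) Suc.prems x_closed by auto
  have pow: "x [^] (e + k) = x [^] k \<otimes> x [^] e" using x_closed by (simp add: nat_pow_mult add.commute)
  have "b \<otimes> f \<ominus> c \<otimes> (x [^] k \<otimes> g) =
    b \<otimes> (f \<ominus> c \<otimes> x [^] (e + k)) \<ominus> c \<otimes> (x [^] k \<otimes> (g \<ominus> b \<otimes> x [^] e))"
    unfolding pow using carr by algebra
  moreover have "b \<otimes> (f \<ominus> c \<otimes> x [^] (e + k)) \<in> D (e + k)" using D_smult b c by auto
  moreover have "c \<otimes> (x [^] k \<otimes> (g \<ominus> b \<otimes> x [^] e)) \<in> D (e + k)"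
    using D_smult[OF c(1) D_shift_pow[OF g(2)]] .
  ultimately have "b \<otimes> f \<ominus> c \<otimes> (x [^] k \<otimes> g) \<in> D (e + k)" using D_minus by auto
  then obtain m q r where mqr: "q \<in> D k" "r \<in> D e"
    "b [^] (m::nat) \<otimes> (b \<otimes> f \<ominus> c \<otimes> (x [^] k \<otimes> g)) = q \<otimes> g \<oplus> r" using Suc.IH by blast
  let ?u = "b [^] m \<otimes> c \<otimes> x [^] k"
  have "b [^] m \<otimes> c \<in> A" using pow_in_A[OF b] c(1) subringE(6)[OF A_subring] by auto
  moreover have "x [^] k \<otimes> \<one> \<in> D (Suc 0 + k)" using D_Suc_0 subringE(3)[OF A_subring] by (intro D_shift_pow) simp
  hence "x [^] k \<in> D (Suc k)" using carr by simp
  ultimately have u: "?u \<in> D (Suc k)" by (rule D_smult)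
  have carr': "q \<in> carrier R" "r \<in> carrier R" "b [^] m \<in> carrier R" using mqr D_closed carr by auto
  have "b [^] Suc m \<otimes> f = b [^] m \<otimes> b \<otimes> f" by simp
  also have "\<dots> = b [^] m \<otimes> (b \<otimes> f \<ominus> c \<otimes> (x [^] k \<otimes> g)) \<oplus> ?u \<otimes> g"
    using carr carr' by algebra
  also have "\<dots> = (q \<oplus> ?u) \<otimes> g \<oplus> r" unfolding mqr(3) using carr carr' by algebra
  finally have "b [^] Suc m \<otimes> f = (q \<oplus> ?u) \<otimes> g \<oplus> r" .
  moreover have "q \<oplus> ?u \<in> D (Suc k)" using D_add[OF _ u] D_mono[of k "Suc k"] mqr(1) by auto
  ultimately show ?case using mqr(2) by (intro exI[of _ "Suc m"] exI[of _ "q \<oplus> ?u"] exI[of _ r]) auto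
qed

text \<open>Geometrically, the fibres are spectra of polynomial rings in one variable over fields
  and have dimension at most one. Here polynomials \<open>f\<close> and \<open>g\<close> of least
  degree in the two differences of primes are compared: if \<open>f\<close> has no larger degree, it
  cancels the leading term of \<open>g\<close>; otherwise \<open>f\<close> is pseudo-divided by
  \<open>g\<close>.\<close>

lemma no_three_primes_in_fibre:
  assumes Q0: "primeideal Q0 R" and Q1: "primeideal Q1 R" and Q2: "primeideal Q2 R"
    and "Q0 \<subset> Q1" "Q1 \<subset> Q2" and fibre: "Q2 \<inter> A \<subseteq> Q0"
  shows False
proof -
  interpret Q0: primeideal Q0 R by fact
  interpret Q1: primeideal Q1 R by fact
  interpret Q2: primeideal Q2 R by fact
  obtain f d a where f: "f \<in> Q1" "f \<notin> Q0" "f \<in> D (Suc d)" "\<And>h. h \<in> Q1 \<Longrightarrow> h \<in> D d \<Longrightarrow> h \<in> Q0"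
    and a: "a \<in> A" "a \<notin> Q0" "f \<ominus> a \<otimes> x [^] d \<in> D d"
    using exists_min_degree[OF Q0.is_ideal Q1.is_ideal assms(4)] by auto
  obtain g e b where g: "g \<in> Q2" "g \<notin> Q1" "g \<in> D (Suc e)" "\<And>h. h \<in> Q2 \<Longrightarrow> h \<in> D e \<Longrightarrow> h \<in> Q1"
    and b: "b \<in> A" "b \<notin> Q1" "g \<ominus> b \<otimes> x [^] e \<in> D e"
    using exists_min_degree[OF Q1.is_ideal Q2.is_ideal assms(5)] by auto
  have sub: "u \<in> Q0 \<Longrightarrow> u \<in> Q1" "u \<in> Q1 \<Longrightarrow> u \<in> Q2" for u using assms(4,5) by auto
  have carr: "a \<in> carrier R" "b \<in> carrier R" "g \<in> carrier R" "f \<in> carrier R"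
    using a(1) b(1) A_closed D_closed g(3) f(3) by auto
  show False
  proof (cases "d \<le> e")
    case True
    have pows: "x [^] d \<in> carrier R" "x [^] (e - d) \<in> carrier R" using x_closed by auto
    have pow: "x [^] e = x [^] (e - d) \<otimes> x [^] d" using x_closed True by (simp add: nat_pow_mult)
    \<comment> \<open>The leading terms \<open>a x [^] d\<close> and \<open>b x [^] e\<close>
      cancel, so \<open>?h\<close> has smaller degree than \<open>g\<close> and must lie in
      \<open>Q1\<close>; this leaves \<open>a \<otimes> g\<close> in \<open>Q1\<close>, against the
      choice of \<open>a\<close> and \<open>g\<close>.\<close>
    let ?h = "a \<otimes> g \<ominus> b \<otimes> (x [^] (e - d) \<otimes> f)"
    have bf: "b \<otimes> (x [^] (e - d) \<otimes> f) \<in> Q1" using f(1) carr pows by (intro Q1.I_l_closed) auto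
    have "?h = a \<otimes> (g \<ominus> b \<otimes> x [^] e) \<ominus> b \<otimes> (x [^] (e - d) \<otimes> (f \<ominus> a \<otimes> x [^] d))"
      unfolding pow using carr pows by algebra
    moreover have "a \<otimes> (g \<ominus> b \<otimes> x [^] e) \<in> D e" using D_smult[OF a(1) b(3)] .
    moreover have "b \<otimes> (x [^] (e - d) \<otimes> (f \<ominus> a \<otimes> x [^] d)) \<in> D e"
      using D_smult[OF b(1) D_shift_pow[OF a(3), of "e - d"]] True by simp
    ultimately have "?h \<in> D e" using D_minus by auto
    moreover have "?h \<in> Q2"
      by (rule Q2.minus_closed_ideal[OF Q2.I_l_closed[OF g(1) carr(1)] sub(2)[OF bf]])
    ultimately have "?h \<in> Q1" using g(4) by auto
    hence "?h \<oplus> b \<otimes> (x [^] (e - d) \<otimes> f) \<in> Q1" using bf by simp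
    hence "a \<otimes> g \<in> Q1" using carr pows minus_add_cancel[of "a \<otimes> g" "b \<otimes> (x [^] (e - d) \<otimes> f)"] by simp
    hence "a \<in> Q1" using Q1.I_prime[OF carr(1,3)] g(2) by auto
    thus False using sub(2) a fibre by auto
  next
    case False
    have "f \<in> D (e + (Suc d - e))" using f(3) False by simp
    then obtain m q r where mqr: "q \<in> D (Suc d - e)" "r \<in> D e" "b [^] (m::nat) \<otimes> f = q \<otimes> g \<oplus> r"
      using pseudo_division[OF b(1) g(3) b(3)] by blast
    have carr': "q \<in> carrier R" "r \<in> carrier R" "b [^] m \<in> carrier R" using mqr D_closed carr by auto
    have bf: "b [^] m \<otimes> f \<in> Q1" using f(1) carr' by (intro Q1.I_l_closed) auto
    have qg: "q \<otimes> g \<in> carrier R" using carr carr' by simp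
    have "r \<oplus> q \<otimes> g \<in> Q2" using sub(2)[OF bf] unfolding mqr(3) a_comm[OF qg carr'(2)] .
    hence "r \<in> Q2" using Q2.I_l_closed[OF g(1) carr'(1)] carr'(2) by (rule Q2.add_cancel_ideal)
    hence rQ1: "r \<in> Q1" using g(4) mqr(2) by auto
    have "q \<otimes> g \<in> Q1" using bf[unfolded mqr(3)] rQ1 qg by (rule Q1.add_cancel_ideal)
    hence qQ1: "q \<in> Q1" using Q1.I_prime[OF carr'(1) carr(3)] g(2) by auto
    show False
    \<comment> \<open>For \<open>e = 0\<close> the quotient need not have smaller degree than
      \<open>f\<close>; but then \<open>g\<close> is a constant and contradicts the hypothesis on
      the fibre directly.\<close>
    proof (cases "e = 0")
      case True
      hence "g \<in> A" using g(3) D_Suc_0 by simp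
      thus False using g(1,2) fibre sub(1) by auto
    next
      case e: False
      have "Suc d - e \<le> d" "e \<le> d" using e False by linarith+
      hence "q \<in> D d" "r \<in> D d" using mqr(1,2) D_mono[of "Suc d - e" d] D_mono[of e d] by auto
      hence "q \<in> Q0" "r \<in> Q0" using f(4) qQ1 rQ1 by auto
      hence "b [^] m \<otimes> f \<in> Q0" unfolding mqr(3) using carr(3) by (intro Q0.a_closed Q0.I_r_closed)
      hence "b [^] m \<in> Q0" using Q0.I_prime[OF carr'(3) carr(4)] f(2) by auto
      hence "b \<in> Q0" using primeideal_pow_iff[OF Q0 carr(2)] by simp
      thus False using b(2) sub(1) by auto
    qed
  qed
qed

lemma prime_inter_A:
  assumes "primeideal Q R" shows "primeideal (Q \<inter> A) B"
proof -
  interpret Q: primeideal Q R by fact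
  interpret B: cring B by (rule B_cring)
  have "ideal (Q \<inter> A) B"
    using subringE(2,6,7)[OF A_subring] Q.I_l_closed A_closed by (intro B.ideal_intro) auto
  thus ?thesis
  proof (rule primeidealI[OF _ B_cring])
    show "carrier B \<noteq> Q \<inter> A"
      using primeideal_one_notin[OF assms] subringE(3)[OF A_subring] by auto
  qed (use Q.I_prime A_closed in auto)
qed

text \<open>If there are three members, the third contracts to something outside the first, so some
  \<open>a\<close> in \<open>A\<close> separates the first from the last prime. Moving
  \<open>a\<close> into the second member makes the first step strict after contraction, and the
  induction proceeds with the remaining chain.\<close>

lemma prime_chain_contract:
  assumes "prime_chain R Qs"
  shows "\<exists>Ps. prime_chain B Ps \<and> hd Ps = hd Qs \<inter> A \<and> length Qs \<le> Suc (length Ps)"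
  using assms
proof (induction "length Qs" arbitrary: Qs rule: less_induct)
  case less
  interpret noetherian_cring R using noetherian is_cring by (rule noetherian_cring.intro)
  have prime: "primeideal Q R" if "Q \<in> set Qs" for Q using less.prems that by (simp add: prime_chain_def)
  have ne: "Qs \<noteq> []" using less.prems by (simp add: prime_chain_def)
  show ?case
  \<comment> \<open>Only here can a member be lost: two primes may have the same
    contraction.\<close>
  proof (cases "length Qs \<le> 2")
    case True
    thus ?thesis using prime_inter_A[OF prime] ne
      by (intro exI[of _ "[hd Qs \<inter> A]"]) (auto intro: prime_chain_singleton)
  next
    case False
    hence "Suc (Suc (Suc 0)) \<le> length Qs" by simp
    then obtain Q0 Q1 Q2 Rs where Qs: "Qs = Q0 # Q1 # Q2 # Rs" by (auto simp: Suc_le_length_iff)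
    have chain: "prime_chain R (Q0 # Q1 # Q2 # Rs)" using less.prems Qs by simp
    have sub: "Q0 \<subset> Q1" "Q1 \<subset> Q2" using chain by (auto simp: prime_chain_def)
    have Q2: "Q2 \<subseteq> last Qs" using Qs by (intro prime_chain_subset_last[OF less.prems]) simp
    have "\<not> Q2 \<inter> A \<subseteq> Q0"
      using no_three_primes_in_fibre[OF _ _ _ sub] prime Qs by auto
    then obtain a where a: "a \<in> A" "a \<notin> Q0" "a \<in> last Qs" using Q2 by auto
    have "a \<in> last (Q1 # Q2 # Rs)" using a(3) Qs by simp
    from prime_chain_second_contains[OF chain this]
    obtain Q' Ps' where Q': "prime_chain R (Q0 # Q' # Ps')" "length Ps' = length (Q2 # Rs)" "a \<in> Q'"
      by auto
    have chain': "prime_chain R (Q' # Ps')" and Q0Q': "Q0 \<subset> Q'" and Q0p: "primeideal Q0 R"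
      using Q'(1) unfolding prime_chain_Cons by auto
    have "length (Q' # Ps') < length Qs" using Q'(2) Qs by simp
    from less.hyps[OF this chain'] obtain Ps where
      Ps: "prime_chain B Ps" "hd Ps = Q' \<inter> A" "length (Q' # Ps') \<le> Suc (length Ps)" by auto
    obtain P Ps'' where PsP: "Ps = P # Ps''" using Ps(1) by (cases Ps) (auto simp: prime_chain_def)
    have "Q0 \<inter> A \<subset> P" using Ps(2) PsP Q0Q' a Q'(3) by auto
    hence "prime_chain B ((Q0 \<inter> A) # Ps)"
      using Ps(1) PsP prime_inter_A[OF Q0p] by (simp add: prime_chain_Cons)
    thus ?thesis using Ps(3) Q'(2) Qs by (intro exI[of _ "(Q0 \<inter> A) # Ps"]) auto
  qed
qed

end

section \<open>Power series\<close>

text \<open>By \<open>split\<close> every element is congruent modulo \<open>x\<close> to one of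
  \<open>A\<close>, so an ideal modulo \<open>x\<close> is controlled by its trace on the Noetherian
  ring \<open>A\<close>; generators of the trace are lifted back to the ideal.\<close>

lemma (in cring) generators_mod_of_subring:
  assumes A: "subring A R" "noetherian_ring (R\<lparr>carrier := A\<rparr>)" and x: "x \<in> carrier R"
    and split: "\<And>f. f \<in> carrier R \<Longrightarrow> \<exists>p\<in>A. \<exists>h\<in>carrier R. f = p \<oplus> x \<otimes> h"
    and J: "ideal J R"
  shows "\<exists>F. finite F \<and> F \<subseteq> J \<and> (\<forall>f\<in>J. \<exists>g\<in>Idl F. \<exists>h\<in>carrier R. f = g \<oplus> x \<otimes> h)"
proof -
  let ?B = "R\<lparr>carrier := A\<rparr>"
  have Ac: "a \<in> carrier R" if "a \<in> A" for a using subringE(1)[OF A(1)] that by auto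
  interpret J: ideal J R by (rule J)
  interpret B: cring ?B using subcring_iff[of A] subcringI'[OF A(1)] subringE(1)[OF A(1)] by simp
  interpret B: noetherian_ring ?B by (rule A(2))
  \<comment> \<open>\<open>red K\<close> is the intersection of \<open>A\<close> with the sum of
    \<open>K\<close> and the multiples of \<open>x\<close>.\<close>
  define red where "red K = {p \<in> A. \<exists>g\<in>K. \<exists>h\<in>carrier R. p = g \<oplus> x \<otimes> h}" for K
  have redI: "p \<in> red K" if "p = g \<oplus> x \<otimes> h" "p \<in> A" "g \<in> K" "h \<in> carrier R" for p g h K
    using that unfolding red_def by blast
  have redE: "\<exists>g h. p \<in> A \<and> g \<in> K \<and> h \<in> carrier R \<and> p = g \<oplus> x \<otimes> h" if "p \<in> red K" for p K
    using that unfolding red_def by blast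
  have red_ideal: "ideal (red K) ?B" if "ideal K R" for K
  proof -
    interpret K: ideal K R by fact
    show ?thesis
    proof (rule B.ideal_intro)
      show "red K \<subseteq> carrier ?B" by (auto simp: red_def)
      have "\<zero> = \<zero> \<oplus> x \<otimes> \<zero>" using x by simp
      hence "\<zero> \<in> red K" using subringE(2)[OF A(1)] K.zero_closed zero_closed by (rule redI)
      thus "\<zero>\<^bsub>?B\<^esub> \<in> red K" by simp
    next
      fix p p' assume p: "p \<in> red K" "p' \<in> red K"
      obtain g h where 1: "p \<in> A" "g \<in> K" "h \<in> carrier R" "p = g \<oplus> x \<otimes> h" using redE[OF p(1)] by blast
      obtain g' h' where 2: "p' \<in> A" "g' \<in> K" "h' \<in> carrier R" "p' = g' \<oplus> x \<otimes> h'" using redE[OF p(2)] by blast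
      note * = 1(1) 2(1) 1(2) 2(2) 1(3) 2(3) 1(4) 2(4)
      have "p \<oplus> p' = (g \<oplus> g') \<oplus> x \<otimes> (h \<oplus> h')"
        unfolding *(7,8) using *(5,6) K.Icarr[OF *(3)] K.Icarr[OF *(4)] x by algebra
      moreover have "p \<oplus> p' \<in> A" "g \<oplus> g' \<in> K" "h \<oplus> h' \<in> carrier R"
        using *(1-6) subringE(7)[OF A(1)] by auto
      ultimately have "p \<oplus> p' \<in> red K" by (rule redI)
      thus "p \<oplus>\<^bsub>?B\<^esub> p' \<in> red K" by simp
    next
      fix p r assume p: "p \<in> red K" and "r \<in> carrier ?B"
      then obtain g h where *: "p \<in> A" "r \<in> A" "g \<in> K" "h \<in> carrier R" "p = g \<oplus> x \<otimes> h"
        using redE[OF p] by auto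
      have "r \<otimes> p = r \<otimes> g \<oplus> x \<otimes> (r \<otimes> h)"
        unfolding *(5) using *(4) Ac[OF *(2)] K.Icarr[OF *(3)] x by algebra
      moreover have "r \<otimes> p \<in> A" "r \<otimes> g \<in> K" "r \<otimes> h \<in> carrier R"
        using *(1-4) Ac[OF *(2)] subringE(6)[OF A(1)] K.I_l_closed by auto
      ultimately have "r \<otimes> p \<in> red K" by (rule redI)
      thus "r \<otimes>\<^bsub>?B\<^esub> p \<in> red K" by simp
    qed
  qed
  obtain P where P: "P \<subseteq> carrier ?B" "finite P" "red J = Idl\<^bsub>?B\<^esub> P"
    using B.finetely_gen[OF red_ideal[OF J]] by auto
  have "P \<subseteq> red J" unfolding P(3) by (rule B.genideal_self[OF P(1)])
  hence "\<forall>p\<in>P. \<exists>g. g \<in> J \<and> (\<exists>h\<in>carrier R. p = g \<oplus> x \<otimes> h)" unfolding red_def by blast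
  from bchoice[OF this] obtain w where w: "\<forall>p\<in>P. w p \<in> J \<and> (\<exists>h\<in>carrier R. p = w p \<oplus> x \<otimes> h)" ..
  define F where "F = w ` P"
  have FJ: "F \<subseteq> J" unfolding F_def using w by auto
  have Fc: "F \<subseteq> carrier R" using FJ J.Icarr by auto
  have FI: "ideal (Idl F) R" by (rule genideal_ideal[OF Fc])
  have "P \<subseteq> red (Idl F)"
  proof
    fix p assume p: "p \<in> P"
    hence "w p \<in> Idl F" using genideal_self[OF Fc] unfolding F_def by auto
    moreover have "p \<in> A" using p P(1) by auto
    ultimately show "p \<in> red (Idl F)" unfolding red_def using w p by blast
  qed
  hence red: "red J \<subseteq> red (Idl F)" unfolding P(3) by (rule B.genideal_minimal[OF red_ideal[OF FI]])
  have "\<exists>g\<in>Idl F. \<exists>h\<in>carrier R. f = g \<oplus> x \<otimes> h" if f: "f \<in> J" for f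
  proof -
    obtain p h where ph: "p \<in> A" "h \<in> carrier R" "f = p \<oplus> x \<otimes> h" using split[OF J.Icarr[OF f]] by blast
    have pc: "p \<in> carrier R" using Ac[OF ph(1)] .
    have "p = f \<oplus> x \<otimes> (\<ominus> h)" unfolding ph(3) using ph(2) pc x by algebra
    hence "p \<in> red J" using ph(1) f a_inv_closed[OF ph(2)] by (rule redI)
    hence "p \<in> red (Idl F)" using red by blast
    then obtain g h' where g: "g \<in> Idl F" "h' \<in> carrier R" "p = g \<oplus> x \<otimes> h'" using redE by blast
    have "f = g \<oplus> x \<otimes> (h' \<oplus> h)"
      unfolding ph(3) unfolding g(3) using ideal.Icarr[OF FI g(1)] g(2) ph(2) x by algebra
    thus ?thesis using g(1) a_closed[OF g(2) ph(2)] by blast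
  qed
  thus ?thesis using FJ P(2) unfolding F_def by (intro exI[of _ F]) (auto simp: F_def)
qed

text \<open>The start of both inductions on the number of variables: without variables a series is
  just its constant coefficient.\<close>

lemma (in series_subring) noetherian_no_variables:
  assumes "noetherian_ring R" "n = 0" shows "noetherian_ring S"
proof (rule S.noetherian_ringI)
  interpret noetherian_ring R by fact
  interpret hom: ring_hom_ring R S const
    by (rule ring_hom_ringI2[OF ring_axioms S.ring_axioms const_hom])
  fix K assume K: "ideal K S"
  have "ideal (contraction K) R" unfolding contraction_def by (rule hom.ideal_vimage[OF K])
  from finetely_gen[OF this]
  obtain F where F: "F \<subseteq> carrier R" "finite F" "contraction K = Idl F" by auto
  interpret I: ideal "Idl F" R by (rule genideal_ideal[OF F(1)])
  have "K = avoiding 0 (Idl F)"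
  proof (intro subset_antisym subsetI)
    fix f assume f: "f \<in> K"
    have fC: "f \<in> C" using ideal.Icarr[OF K f] by (simp add: S_simps(1))
    have "f {#} \<in> Idl F" using mem_iff_const_coeff[OF K _ fC] f assms(2) F(3) by simp
    moreover have "f m = \<zero>" if "m \<noteq> {#}" for m using coeff_vars[OF fC, of m] that assms(2) by simp
    ultimately have "f m \<in> Idl F" for m using I.zero_closed by (cases "m = {#}") simp_all
    thus "f \<in> avoiding 0 (Idl F)" using fC by (intro avoidingI)
  next
    fix f assume f: "f \<in> avoiding 0 (Idl F)"
    hence "f {#} \<in> contraction K" unfolding F(3) by (rule avoidingD(2)) simp
    thus "f \<in> K" using mem_iff_const_coeff[OF K _ avoidingD(1)[OF f]] assms(2) by simp
  qed
  thus "\<exists>A\<subseteq>carrier S. finite A \<and> K = Idl\<^bsub>S\<^esub> A"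
    unfolding Idl_const_image[OF F(2,1), symmetric]
    using F const_in_C by (intro exI[of _ "const ` F"]) (auto simp: S_simps(1))
qed

section \<open>Power series and polynomials as rings of formal series\<close>

context cring
begin

lemma formal_mult_zero_if:
  assumes "\<And>m. f m \<in> carrier R" "\<And>m. g m \<in> carrier R"
    and "\<And>k. k \<subseteq># m \<Longrightarrow> f k = \<zero> \<or> g (m - k) = \<zero>"
  shows "(f \<otimes>\<^bsub>formal_series_ring R\<^esub> g) m = \<zero>"
proof -
  have "(\<Oplus>k\<in>{k. k \<subseteq># m}. f k \<otimes> g (m - k)) = (\<Oplus>k\<in>{k. k \<subseteq># m}. \<zero>)"
    using assms by (intro finsum_cong') (auto dest: assms(3))
  thus ?thesis by (simp add: formal_series_ring_simps)
qed

lemma formal_mult_closed: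
  assumes "\<And>m. f m \<in> carrier R" "\<And>m. g m \<in> carrier R"
  shows "(f \<otimes>\<^bsub>formal_series_ring R\<^esub> g) m \<in> carrier R"
  unfolding formal_series_ring_simps using assms by (auto intro!: finsum_closed)

lemma carrier_power_series_ring:
  "f \<in> carrier (power_series_ring R n) \<longleftrightarrow>
    (\<forall>m. f m \<in> carrier R) \<and> (\<forall>m. \<not> set_mset m \<subseteq> {..<n} \<longrightarrow> f m = \<zero>)"
  by (simp add: power_series_ring_def)

lemma carrier_polynomial_ring:
  "f \<in> carrier (polynomial_ring R n) \<longleftrightarrow>
    f \<in> carrier (power_series_ring R n) \<and> finite {m. f m \<noteq> \<zero>}"
  by (simp add: polynomial_ring_def)

lemma power_series_subring: "series_subring R n (carrier (power_series_ring R n))"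
proof (unfold_locales, unfold carrier_power_series_ring)
  fix f g
  assume f: "(\<forall>m. f m \<in> carrier R) \<and> (\<forall>m. \<not> set_mset m \<subseteq> {..<n} \<longrightarrow> f m = \<zero>)"
    and g: "(\<forall>m. g m \<in> carrier R) \<and> (\<forall>m. \<not> set_mset m \<subseteq> {..<n} \<longrightarrow> g m = \<zero>)"
  let ?fg = "f \<otimes>\<^bsub>formal_series_ring R\<^esub> g"
  show "(\<forall>m. ?fg m \<in> carrier R) \<and>
    (\<forall>m. \<not> set_mset m \<subseteq> {..<n} \<longrightarrow> ?fg m = \<zero>)"
  proof (intro conjI allI impI)
    fix m show "?fg m \<in> carrier R" using f g by (intro formal_mult_closed) auto
    assume m: "\<not> set_mset m \<subseteq> {..<n}"
    have "\<not> set_mset k \<subseteq> {..<n} \<or> \<not> set_mset (m - k) \<subseteq> {..<n}" if "k \<subseteq># m" for k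
    proof -
      have "set_mset m = set_mset k \<union> set_mset (m - k)"
        using that by (metis set_mset_union subset_mset.add_diff_inverse)
      thus ?thesis using m by auto
    qed
    hence "f k = \<zero> \<or> g (m - k) = \<zero>" if "k \<subseteq># m" for k using f g that by blast
    thus "?fg m = \<zero>" using f g by (intro formal_mult_zero_if) auto
  qed
qed (auto simp: monomial_def)

lemma polynomial_subring: "series_subring R n (carrier (polynomial_ring R n))"
proof -
  interpret P: series_subring R n "carrier (power_series_ring R n)" by (rule power_series_subring)
  show ?thesis
  proof (unfold_locales, unfold carrier_polynomial_ring)
    fix f g
    assume f: "f \<in> carrier (power_series_ring R n) \<and> finite {m. f m \<noteq> \<zero>}"
      and g: "g \<in> carrier (power_series_ring R n) \<and> finite {m. g m \<noteq> \<zero>}"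
    let ?fg = "f \<otimes>\<^bsub>formal_series_ring R\<^esub> g"
    have "{m. f m \<oplus> g m \<noteq> \<zero>} \<subseteq> {m. f m \<noteq> \<zero>} \<union> {m. g m \<noteq> \<zero>}" by auto
    hence "finite {m. f m \<oplus> g m \<noteq> \<zero>}" using f g by (meson finite_UnI finite_subset)
    thus "(\<lambda>m. f m \<oplus> g m) \<in> carrier (power_series_ring R n) \<and> finite {m. f m \<oplus> g m \<noteq> \<zero>}"
      using f g P.C_add by simp
    have "{m. ?fg m \<noteq> \<zero>} \<subseteq>
      (\<lambda>(k, l). k + l) ` ({m. f m \<noteq> \<zero>} \<times> {m. g m \<noteq> \<zero>})"
    proof
      fix m assume m: "m \<in> {m. ?fg m \<noteq> \<zero>}"
      have "\<not> (\<forall>k. k \<subseteq># m \<longrightarrow> f k = \<zero> \<or> g (m - k) = \<zero>)"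
        using formal_mult_zero_if[of f g m] m f g carrier_power_series_ring by auto
      then obtain k where "k \<subseteq># m" "f k \<noteq> \<zero>" "g (m - k) \<noteq> \<zero>" by auto
      thus "m \<in> (\<lambda>(k, l). k + l) ` ({m. f m \<noteq> \<zero>} \<times> {m. g m \<noteq> \<zero>})"
        by (intro image_eqI[of _ _ "(k, m - k)"]) auto
    qed
    hence "finite {m. ?fg m \<noteq> \<zero>}"
      using f g by (meson finite_SigmaI finite_imageI finite_subset)
    thus "?fg \<in> carrier (power_series_ring R n) \<and>
      finite {m. ?fg m \<noteq> \<zero>}" using f g P.C_mult by simp
  next
    have mon: "finite {m. monomial R d \<one> m \<noteq> \<zero>}" for d
      by (rule finite_subset[of _ "{d}"]) (auto simp: monomial_def)
    show "monomial R {#} \<one> \<in> carrier (power_series_ring R n) \<and> finite {m. monomial R {#} \<one> m \<noteq> \<zero>}"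
      using mon P.C_one by simp
    show "monomial R {#j#} \<one> \<in> carrier (power_series_ring R n) \<and> finite {m. monomial R {#j#} \<one> m \<noteq> \<zero>}"
      if "j < n" for j using mon P.C_var[OF that] by simp
  next
    fix f g
    assume f: "f \<in> carrier (power_series_ring R n) \<and> finite {m. f m \<noteq> \<zero>}"
      and g: "\<And>m. g m \<in> carrier R" "\<And>m. f m = \<zero> \<Longrightarrow> g m = \<zero>"
    have "{m. g m \<noteq> \<zero>} \<subseteq> {m. f m \<noteq> \<zero>}" using g(2) by auto
    thus "g \<in> carrier (power_series_ring R n) \<and> finite {m. g m \<noteq> \<zero>}"
      using f P.C_solid[of f g] g finite_subset by auto
  next
    fix f j
    assume f: "f \<in> carrier (power_series_ring R n) \<and> finite {m. f m \<noteq> \<zero>}"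
    have "finite (add_mset j -` {m. f m \<noteq> \<zero>})" using f by (intro finite_vimageI) (auto simp: inj_def)
    thus "(\<lambda>m. f (add_mset j m)) \<in> carrier (power_series_ring R n) \<and> finite {m. f (add_mset j m) \<noteq> \<zero>}"
      using f P.C_shift by (simp add: vimage_def)
  qed (auto simp: carrier_power_series_ring)
qed

lemma S_power_series: "series_subring.S R (carrier (power_series_ring R n)) = power_series_ring R n"
  unfolding series_subring.S_def[OF power_series_subring]
  by (simp add: formal_series_ring_def power_series_ring_def)

lemma S_polynomial: "series_subring.S R (carrier (polynomial_ring R n)) = polynomial_ring R n"
  unfolding series_subring.S_def[OF polynomial_subring]
  by (simp add: formal_series_ring_def power_series_ring_def polynomial_ring_def)

lemma power_series_ideal_eq:
  "power_series_ideal R n I = series_subring.avoiding (carrier (power_series_ring R n)) 0 I"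
  unfolding series_subring.avoiding_def[OF power_series_subring] power_series_ideal_def by auto

lemma polynomial_ideal_eq:
  "polynomial_ideal R n I = series_subring.avoiding (carrier (polynomial_ring R n)) 0 I"
  unfolding series_subring.avoiding_def[OF polynomial_subring] polynomial_ideal_def by auto

end

locale power_series = cring R for R (structure) + fixes n :: nat
begin

sublocale series_subring R n "carrier (power_series_ring R n)"
  rewrites "series_subring.S R (carrier (power_series_ring R n)) = power_series_ring R n"
  by (rule power_series_subring) (rule S_power_series)

abbreviation T where "T \<equiv> power_series_ring R n"

text \<open>The coefficients of the series \<open>a j + x (a (j + 1) + x (a (j + 2) + \<dots>))\<close>, where
  \<open>x\<close> is the variable with index \<open>i\<close>; the first argument is the exponent of \<open>x\<close>.\<close>

primrec adic_sum :: "nat \<Rightarrow> nat \<Rightarrow> (nat \<Rightarrow> nat multiset \<Rightarrow> 'a) \<Rightarrow> nat \<Rightarrow> nat multiset \<Rightarrow> 'a" where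
  "adic_sum 0 i a j m = a j m"
| "adic_sum (Suc c) i a j m = a j m \<oplus> adic_sum c i a (Suc j) (m - {#i#})"

lemma var_complete:
  assumes i: "i < n" and a: "range a \<subseteq> carrier T"
  shows "\<exists>h. range h \<subseteq> carrier T \<and> (\<forall>j::nat. h j = a j \<oplus>\<^bsub>T\<^esub> var i \<otimes>\<^bsub>T\<^esub> h (Suc j))"
proof -
  have aT: "a j \<in> carrier T" for j using a by auto
  have closed: "adic_sum c i a j m \<in> carrier R" for c j m
    by (induction c arbitrary: j m) (simp_all add: coeff_closed[OF aT])
  have vars: "adic_sum c i a j m = \<zero>" if "\<not> set_mset m \<subseteq> {..<n}" for c j m
    using that
  proof (induction c arbitrary: j m)
    case (Suc c)
    obtain l where l: "l \<in># m" "\<not> l < n" using Suc.prems by auto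
    hence "l \<in># m - {#i#}" using i by (metis in_diff_count count_single gr_implies_not0 in_diff_count neq0_conv count_greater_zero_iff)
    hence "\<not> set_mset (m - {#i#}) \<subseteq> {..<n}" using l by auto
    thus ?case using Suc.IH coeff_vars[OF aT Suc.prems] by simp
  qed (simp add: coeff_vars[OF aT])
  \<comment> \<open>A power of the variable contributes to the coefficient at \<open>m\<close> only
    up to the exponent \<open>count m i\<close>, so that many recursion steps give the whole
    infinite sum.\<close>
  define h where "h j m = adic_sum (count m i) i a j m" for j m
  have hT: "h j \<in> carrier T" for j
    unfolding carrier_power_series_ring h_def using closed vars by simp
  have "h j = a j \<oplus>\<^bsub>T\<^esub> var i \<otimes>\<^bsub>T\<^esub> h (Suc j)" for j
  proof
    fix m
    have aj: "a j m \<in> carrier R" by (rule coeff_closed[OF aT])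
    show "h j m = (a j \<oplus>\<^bsub>T\<^esub> var i \<otimes>\<^bsub>T\<^esub> h (Suc j)) m"
    proof (cases "count m i")
      case 0
      hence "i \<notin># m" by (simp add: not_in_iff)
      thus ?thesis unfolding var_mult[OF hT] S_simps(5) using 0 aj by (simp add: h_def)
    next
      case (Suc c)
      hence "i \<in># m" by (simp add: in_countE count_greater_zero_iff[symmetric] del: count_greater_zero_iff)
      thus ?thesis unfolding var_mult[OF hT] S_simps(5) using Suc by (simp add: h_def)
    qed
  qed
  thus ?thesis using hT by (intro exI[of _ h] conjI allI image_subsetI)
qed

text \<open>Multiplication by the variable takes each coefficient from a monomial of smaller
  exponent in it, or makes it zero; so all coefficients vanish by induction on that exponent,
  simultaneously for all \<open>j\<close>.\<close>

lemma var_separated: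
  fixes g :: "nat \<Rightarrow> nat multiset \<Rightarrow> 'a"
  assumes "range g \<subseteq> carrier T" "\<And>j. g j = var i \<otimes>\<^bsub>T\<^esub> g (Suc j)"
  shows "g 0 = \<zero>\<^bsub>T\<^esub>"
proof -
  have gT: "g j \<in> carrier T" for j using assms(1) by auto
  have "g j m = \<zero>" for j m
  proof (induction "count m i" arbitrary: j m)
    case 0
    hence "i \<notin># m" by (simp add: not_in_iff)
    thus ?case by (subst assms(2)) (simp add: var_mult[OF gT])
  next
    case (Suc c)
    hence "c = count (m - {#i#}) i" by simp
    hence "g (Suc j) (m - {#i#}) = \<zero>" by (rule Suc.hyps(1))
    thus ?case by (subst assms(2)) (simp add: var_mult[OF gT])
  qed
  thus ?thesis by (simp add: S_simps(4) fun_eq_iff)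
qed

end

text \<open>The next ring is viewed as complete with respect to its last variable, with the series
  in the earlier variables as the Noetherian subring of representatives. Since series in different
  numbers of variables have the same type, this is a genuine subring and no iterated power series
  ring occurs.\<close>

lemma (in noetherian_cring) power_series_noetherian: "noetherian_ring (power_series_ring R n)"
proof (induction n)
  case 0
  interpret P: power_series R 0 by (rule power_series.intro[OF is_cring])
  show ?case by (rule P.noetherian_no_variables[OF noetherian_ring_axioms]) simp
next
  case (Suc n)
  interpret P: power_series R "Suc n" by (rule power_series.intro[OF is_cring])
  interpret Q: power_series R n by (rule power_series.intro[OF is_cring])
  let ?A = "carrier (power_series_ring R n)"
  have eq: "P.T\<lparr>carrier := ?A\<rparr> = power_series_ring R n"
    by (simp add: power_series_ring_def)
  have sub: "?A \<subseteq> carrier P.T"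
    unfolding subset_iff carrier_power_series_ring by (auto simp: subset_iff less_Suc_eq)
  have "cring (P.T\<lparr>carrier := ?A\<rparr>)" unfolding eq by (rule Q.S.is_cring)
  hence subring: "subring ?A P.T"
    using P.S.subcring_iff[OF sub] subcring.axioms(1) by blast
  have split: "\<exists>p\<in>?A. \<exists>h\<in>carrier P.T.
    f = p \<oplus>\<^bsub>P.T\<^esub> P.var n \<otimes>\<^bsub>P.T\<^esub> h"
    if f: "f \<in> carrier P.T" for f
  proof (intro bexI)
    let ?p = "\<lambda>m. if n \<in># m then \<zero> else f m" and ?h = "\<lambda>m. f (add_mset n m)"
    show h: "?h \<in> carrier P.T" by (rule P.C_shift[OF f])
    show p: "?p \<in> ?A"
      unfolding carrier_power_series_ring
    proof (intro conjI allI impI)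
      fix m show "(if n \<in># m then \<zero> else f m) \<in> carrier R" using P.coeff_closed[OF f] by simp
      assume m: "\<not> set_mset m \<subseteq> {..<n}"
      show "(if n \<in># m then \<zero> else f m) = \<zero>"
      proof (cases "n \<in># m")
        case False
        then obtain l where l: "l \<in># m" "\<not> l < n" "l \<noteq> n" using m by auto
        hence "\<not> set_mset m \<subseteq> {..<Suc n}" by auto
        thus ?thesis using P.coeff_vars[OF f] by simp
      qed simp
    qed
    have "P.var n \<in> carrier P.T" by (rule P.C_var) simp
    hence "P.var n \<otimes>\<^bsub>P.T\<^esub> ?h \<in> carrier P.T"
      using h by (rule P.S.m_closed)
    moreover have "?p \<in> carrier P.T" using p sub by auto
    ultimately show "f = ?p \<oplus>\<^bsub>P.T\<^esub> P.var n \<otimes>\<^bsub>P.T\<^esub> ?h"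
      using P.S.a_comm P.var_decomposition[OF f, of n] by simp
  qed
  interpret adically_complete_ring "P.T" "P.var n"
  proof (intro adically_complete_ring.intro adically_complete_ring_axioms.intro)
    show "cring P.T" by (rule P.S.is_cring)
    show v: "P.var n \<in> carrier P.T" by (rule P.C_var) simp
    fix J assume "ideal J P.T"
    thus "\<exists>F. finite F \<and> F \<subseteq> J \<and> (\<forall>f\<in>J. \<exists>g\<in>Idl\<^bsub>P.T\<^esub> F.
      \<exists>h\<in>carrier P.T.
        f = g \<oplus>\<^bsub>P.T\<^esub> P.var n \<otimes>\<^bsub>P.T\<^esub> h)"
      using Suc.IH eq by (intro P.S.generators_mod_of_subring[OF subring _ v split]) simp_all
  next
    fix a :: "nat \<Rightarrow> nat multiset \<Rightarrow> 'a"
    assume "range a \<subseteq> carrier P.T"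
    thus "\<exists>h. range h \<subseteq> carrier P.T \<and> (\<forall>j::nat. h j = a j
      \<oplus>\<^bsub>P.T\<^esub> P.var n \<otimes>\<^bsub>P.T\<^esub> h (Suc j))"
      by (rule P.var_complete[rotated]) simp
  next
    fix g :: "nat \<Rightarrow> nat multiset \<Rightarrow> 'a"
    assume "range g \<subseteq> carrier P.T"
      "\<And>j. g j = P.var n \<otimes>\<^bsub>P.T\<^esub> g (Suc j)"
    thus "g 0 = \<zero>\<^bsub>P.T\<^esub>" by (rule P.var_separated)
  qed
  show ?case by (rule noetherian)
qed

locale noetherian_power_series = power_series + noetherian_ring R
begin

sublocale noetherian_series_subring R n "carrier (power_series_ring R n)"
  rewrites "series_subring.S R (carrier (power_series_ring R n)) = power_series_ring R n"
proof -
  interpret noetherian_cring R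
    by (rule noetherian_cring.intro[OF noetherian_ring_axioms is_cring])
  show "noetherian_series_subring R n (carrier (power_series_ring R n))"
    using power_series_noetherian[of n] series_subring_axioms
    by (intro noetherian_series_subring.intro noetherian_series_subring_axioms.intro)
      (simp_all add: noetherian_ring_axioms S_power_series)
qed (rule S_power_series)

text \<open>Before, completeness along the last variable was a means to prove the Noetherian
  property. With this property known, generators modulo a variable are trivial (\<open>h\<close> is
  zero), and completeness along every variable places all of them in the Jacobson radical.\<close>

lemma var_adically_complete:
  assumes i: "i < n" shows "adically_complete_ring T (var i)"
proof (intro adically_complete_ring.intro adically_complete_ring_axioms.intro)
  show "cring T" by (rule S.is_cring)
  show v: "var i \<in> carrier T" by (rule C_var[OF i])
  fix J assume J: "ideal J T"
  interpret J: ideal J T by fact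
  obtain F where F: "F \<subseteq> carrier T" "finite F" "J = Idl\<^bsub>T\<^esub> F" using S.finetely_gen[OF J] by auto
  have "f = f \<oplus>\<^bsub>T\<^esub> var i \<otimes>\<^bsub>T\<^esub> \<zero>\<^bsub>T\<^esub>" if "f \<in> J" for f
    using J.Icarr[OF that] v by simp
  hence "\<forall>f\<in>J. \<exists>g\<in>Idl\<^bsub>T\<^esub> F. \<exists>h\<in>carrier T. f = g \<oplus>\<^bsub>T\<^esub> var i \<otimes>\<^bsub>T\<^esub> h"
    using F(3) S.zero_closed by blast
  moreover have "F \<subseteq> J" unfolding F(3) by (rule S.genideal_self[OF F(1)])
  ultimately show "\<exists>F. finite F \<and> F \<subseteq> J \<and> (\<forall>f\<in>J. \<exists>g\<in>Idl\<^bsub>T\<^esub> F. \<exists>h\<in>carrier T.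
    f = g \<oplus>\<^bsub>T\<^esub> var i \<otimes>\<^bsub>T\<^esub> h)" using F(2) by (intro exI[of _ F]) simp
next
  fix a :: "nat \<Rightarrow> nat multiset \<Rightarrow> 'a"
  assume "range a \<subseteq> carrier T"
  thus "\<exists>h. range h \<subseteq> carrier T \<and> (\<forall>j::nat. h j = a j \<oplus>\<^bsub>T\<^esub> var i \<otimes>\<^bsub>T\<^esub> h (Suc j))"
    by (rule var_complete[OF i])
next
  fix g :: "nat \<Rightarrow> nat multiset \<Rightarrow> 'a"
  assume "range g \<subseteq> carrier T" "\<And>j. g j = var i \<otimes>\<^bsub>T\<^esub> g (Suc j)"
  thus "g 0 = \<zero>\<^bsub>T\<^esub>" by (rule var_separated)
qed

text \<open>Adjoining an element of the Jacobson radical keeps a proper ideal proper, so the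
  variables can be included one after the other, passing to a larger prime each time.\<close>

lemma exists_prime_with_vars:
  assumes "primeideal Q T" "j \<le> n"
  shows "\<exists>Q'. primeideal Q' T \<and> Q \<subseteq> Q' \<and> (\<forall>i<j. var i \<in> Q')"
  using assms(2)
proof (induction j)
  case 0
  thus ?case using assms(1) by auto
next
  case (Suc j)
  then obtain Q' where Q': "primeideal Q' T" "Q \<subseteq> Q'" "\<forall>i<j. var i \<in> Q'" by auto
  interpret Q': primeideal Q' T by (rule Q'(1))
  interpret adically_complete_ring T "var j" using Suc.prems by (intro var_adically_complete) simp
  have sub: "insert (var j) Q' \<subseteq> carrier T" using x_closed primeideal_subset[OF Q'(1)] by simp
  obtain M where M: "primeideal M T" "Idl\<^bsub>T\<^esub> (insert (var j) Q') \<subseteq> M"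
    using S.exists_prime_above[OF S.genideal_ideal[OF sub] Idl_insert_proper[OF Q'.is_ideal]] Q'.I_notcarr
    by metis
  have "insert (var j) Q' \<subseteq> M" using S.genideal_self[OF sub] M(2) by (rule subset_trans)
  thus ?case using M(1) Q'(2,3) by (intro exI[of _ M]) (auto simp: less_Suc_eq)
qed

text \<open>A prime containing all variables is put on top of the chain unless the last member
  already is such a prime. This can only lengthen the chain and leaves its head unchanged, so the
  general descent applies.\<close>

lemma prime_chain_descend_power_series:
  assumes "ideal J R" "prime_chain T Qs" "avoiding 0 J \<subseteq> hd Qs"
  shows "\<exists>Ps. prime_chain R Ps \<and> J \<subseteq> hd Ps \<and> length Qs \<le> length Ps + n"
proof -
  have ne: "Qs \<noteq> []" using assms(2) by (simp add: prime_chain_def)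
  hence "primeideal (last Qs) T" using assms(2) by (simp add: prime_chain_def)
  then obtain Q where Q: "primeideal Q T" "last Qs \<subseteq> Q" "\<forall>i<n. var i \<in> Q"
    using exists_prime_with_vars[of "last Qs" n] by auto
  obtain Qs' where Qs': "prime_chain T Qs'" "last Qs' = Q" "hd Qs' = hd Qs" "length Qs \<le> length Qs'"
  proof (cases "Q = last Qs")
    case True
    thus thesis using that[of Qs] assms(2) by simp
  next
    case False
    thus thesis using that[of "Qs @ [Q]"] prime_chain_snoc[OF assms(2) Q(1)] Q(2) ne by auto
  qed
  obtain Ps where Ps: "prime_chain R Ps" "contraction (hd Qs') \<subseteq> hd Ps" "length Qs' \<le> length Ps + n"
    using prime_chain_descend[OF Qs'(1)] Qs'(2) Q(3) by auto
  have "J \<subseteq> contraction (hd Qs')"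
    using contraction_mono[OF assms(3)] unfolding contraction_avoiding[OF assms(1)] Qs'(3) .
  thus ?thesis using Ps Qs'(4) by (intro exI[of _ Ps]) auto
qed

end

section \<open>Polynomials\<close>

locale polynomials = cring R for R (structure) + fixes n :: nat
begin

sublocale series_subring R n "carrier (polynomial_ring R n)"
  rewrites "series_subring.S R (carrier (polynomial_ring R n)) = polynomial_ring R n"
  by (rule polynomial_subring) (rule S_polynomial)

abbreviation T where "T \<equiv> polynomial_ring R n"

lemma var_pow:
  assumes "i < n" shows "var i [^]\<^bsub>T\<^esub> (d::nat) = monomial R (replicate_mset d i) \<one>"
proof (induction d)
  case 0
  thus ?case by (simp add: S_simps(3))
next
  case (Suc d)
  have v: "var i \<in> carrier T" by (rule C_var[OF assms])
  have p: "monomial R (replicate_mset d i) \<one> \<in> carrier T"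
    unfolding Suc.IH[symmetric] using v by (rule S.nat_pow_closed)
  have "var i [^]\<^bsub>T\<^esub> Suc d = var i \<otimes>\<^bsub>T\<^esub> monomial R (replicate_mset d i) \<one>"
    using S.m_comm[OF v p] Suc.IH by simp
  also have "\<dots> = monomial R (replicate_mset (Suc d) i) \<one>"
    unfolding var_mult[OF p] by (auto simp: monomial_def fun_eq_iff dest: multi_member_split)
  finally show ?case .
qed

text \<open>These are the sets \<open>D d\<close> for adjoining the variable \<open>i\<close>; a
  strict degree bound leaves only the zero polynomial at \<open>d = 0\<close>.\<close>

definition degree_less :: "nat \<Rightarrow> nat \<Rightarrow> (nat multiset \<Rightarrow> 'a) set" where
  "degree_less i d = {f \<in> carrier T. \<forall>m. f m \<noteq> \<zero> \<longrightarrow> count m i < d}"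

lemma degree_lessI:
  "f \<in> carrier T \<Longrightarrow> (\<And>m. d \<le> count m i \<Longrightarrow> f m = \<zero>) \<Longrightarrow> f \<in> degree_less i d"
  unfolding degree_less_def using not_less by blast

lemma degree_lessD:
  assumes "f \<in> degree_less i d"
  shows "f \<in> carrier T" "d \<le> count m i \<Longrightarrow> f m = \<zero>"
  using assms unfolding degree_less_def by auto

end

lemma (in cring) polynomial_subring_Suc:
  "carrier (polynomial_ring R n) \<subseteq> carrier (polynomial_ring R (Suc n))"
  unfolding subset_iff carrier_polynomial_ring carrier_power_series_ring by (auto simp: subset_iff less_Suc_eq)

lemma (in noetherian_cring) polynomial_extension_polynomials:
  assumes "noetherian_ring (polynomial_ring R n)"
  shows "polynomial_extension (polynomial_ring R (Suc n)) (carrier (polynomial_ring R n))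
    (monomial R {#n#} \<one>) (polynomials.degree_less R (Suc n) n)"
proof -
  interpret P: polynomials R "Suc n" by (rule polynomials.intro[OF is_cring])
  interpret Q: polynomials R n by (rule polynomials.intro[OF is_cring])
  let ?A = "carrier (polynomial_ring R n)"
  note sub = polynomial_subring_Suc[of n]
  have eq: "P.T\<lparr>carrier := ?A\<rparr> = Q.T"
    by (simp add: polynomial_ring_def power_series_ring_def)
  have "cring (P.T\<lparr>carrier := ?A\<rparr>)" unfolding eq by (rule Q.S.is_cring)
  hence subring: "subring ?A P.T"
    using P.S.subcring_iff[OF sub] subcring.axioms(1) by blast
  have A_iff: "f \<in> ?A \<longleftrightarrow> f \<in> carrier P.T \<and> (\<forall>m. n \<in># m \<longrightarrow> f m = \<zero>)" for f
  proof
    assume f: "f \<in> ?A"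
    hence "f m = \<zero>" if "n \<in># m" for m using that by (intro Q.coeff_vars) auto
    thus "f \<in> carrier P.T \<and> (\<forall>m. n \<in># m \<longrightarrow> f m = \<zero>)" using f sub by auto
  next
    assume f: "f \<in> carrier P.T \<and> (\<forall>m. n \<in># m \<longrightarrow> f m = \<zero>)"
    have "f m = \<zero>" if m: "\<not> set_mset m \<subseteq> {..<n}" for m
    proof (cases "n \<in># m")
      case False
      then obtain l where l: "l \<in># m" "\<not> l < n" "l \<noteq> n" using m by auto
      hence "\<not> set_mset m \<subseteq> {..<Suc n}" by auto
      thus ?thesis using f P.coeff_vars by simp
    qed (use f in simp)
    thus "f \<in> ?A" using f unfolding carrier_polynomial_ring carrier_power_series_ring by simp
  qed
  have v: "P.var n \<in> carrier P.T" by (rule P.C_var) simp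
  show ?thesis
  proof (intro polynomial_extension.intro polynomial_extension_axioms.intro)
    show "cring P.T" by (rule P.S.is_cring)
    show "subring ?A P.T" by (rule subring)
    show "noetherian_ring (P.T\<lparr>carrier := ?A\<rparr>)" unfolding eq by (rule assms)
    show "P.var n \<in> carrier P.T" by (rule v)
    show "P.degree_less n 0 = {\<zero>\<^bsub>P.T\<^esub>}"
    proof (intro subset_antisym subsetI)
      fix f assume f: "f \<in> P.degree_less n 0"
      have "f m = \<zero>" for m by (rule P.degree_lessD(2)[OF f]) simp
      thus "f \<in> {\<zero>\<^bsub>P.T\<^esub>}" by (simp add: P.S_simps(4) fun_eq_iff)
    next
      fix f assume "f \<in> {\<zero>\<^bsub>P.T\<^esub>}"
      hence "f = \<zero>\<^bsub>P.T\<^esub>" by simp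
      thus "f \<in> P.degree_less n 0"
        using P.S.zero_closed by (intro P.degree_lessI) (simp_all add: P.S_simps(4))
    qed
    show "P.degree_less n (Suc 0) = ?A"
    proof (intro subset_antisym subsetI)
      fix f assume f: "f \<in> P.degree_less n (Suc 0)"
      have "f m = \<zero>" if "n \<in># m" for m
        using that by (intro P.degree_lessD(2)[OF f]) (simp add: Suc_le_eq)
      thus "f \<in> ?A" unfolding A_iff using P.degree_lessD(1)[OF f] by simp
    next
      fix f assume f: "f \<in> ?A"
      show "f \<in> P.degree_less n (Suc 0)"
      proof (rule P.degree_lessI)
        show "f \<in> carrier P.T" using f A_iff by simp
        fix m assume "Suc 0 \<le> count m n"
        hence "n \<in># m" by (simp add: Suc_le_eq)
        thus "f m = \<zero>" using f A_iff by simp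
      qed
    qed
    show "carrier P.T = (\<Union>d. P.degree_less n d)"
    proof (intro subset_antisym subsetI)
      fix f assume f: "f \<in> carrier P.T"
      hence "finite ((\<lambda>m. count m n) ` {m. f m \<noteq> \<zero>})" by (simp add: carrier_polynomial_ring)
      then obtain d where d: "\<forall>c\<in>(\<lambda>m. count m n) ` {m. f m \<noteq> \<zero>}. c < d"
        unfolding finite_nat_set_iff_bounded by auto
      have "f \<in> P.degree_less n d" using f
      proof (rule P.degree_lessI)
        fix m assume "d \<le> count m n"
        thus "f m = \<zero>" using d by fastforce
      qed
      thus "f \<in> (\<Union>d. P.degree_less n d)" by auto
    qed (auto dest: P.degree_lessD(1))
  next
    fix d show "P.degree_less n d \<subseteq> P.degree_less n (Suc d)"
    proof
      fix f assume f: "f \<in> P.degree_less n d"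
      show "f \<in> P.degree_less n (Suc d)"
        using P.degree_lessD(1)[OF f] by (rule P.degree_lessI) (rule P.degree_lessD(2)[OF f], simp)
    qed
  next
    fix f g d assume f: "f \<in> P.degree_less n d" and g: "g \<in> P.degree_less n d"
    show "f \<oplus>\<^bsub>P.T\<^esub> g \<in> P.degree_less n d"
    proof (rule P.degree_lessI)
      show "f \<oplus>\<^bsub>P.T\<^esub> g \<in> carrier P.T" by (intro P.S.a_closed P.degree_lessD(1)[OF f] P.degree_lessD(1)[OF g])
      fix m assume m: "d \<le> count m n"
      show "(f \<oplus>\<^bsub>P.T\<^esub> g) m = \<zero>"
        unfolding P.S_simps(5) P.degree_lessD(2)[OF f m] P.degree_lessD(2)[OF g m] by simp
    qed
  next
    fix a f d assume a: "a \<in> ?A" and f: "f \<in> P.degree_less n d"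
    have aT: "a \<in> carrier P.T" using a sub by auto
    show "a \<otimes>\<^bsub>P.T\<^esub> f \<in> P.degree_less n d"
    proof (rule P.degree_lessI)
      show "a \<otimes>\<^bsub>P.T\<^esub> f \<in> carrier P.T" by (rule P.S.m_closed[OF aT P.degree_lessD(1)[OF f]])
      fix m assume m: "d \<le> count m n"
      have "a k = \<zero> \<or> f (m - k) = \<zero>" if "k \<subseteq># m" for k
      proof (cases "n \<in># k")
        case True
        thus ?thesis using a A_iff by simp
      next
        case False
        hence "count k n = 0" by (simp add: not_in_iff)
        hence "d \<le> count (m - k) n" using m by simp
        thus ?thesis using P.degree_lessD(2)[OF f] by simp
      qed
      hence "(a \<otimes>\<^bsub>formal_series_ring R\<^esub> f) m = \<zero>"
        using P.coeff_closed[OF aT] P.coeff_closed[OF P.degree_lessD(1)[OF f]]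
        by (intro formal_mult_zero_if)
      thus "(a \<otimes>\<^bsub>P.T\<^esub> f) m = \<zero>" by (simp only: P.S_simps(2) formal_series_ring_simps(2))
    qed
  next
    fix f d assume f: "f \<in> P.degree_less n d"
    note fT = P.degree_lessD(1)[OF f]
    show "P.var n \<otimes>\<^bsub>P.T\<^esub> f \<in> P.degree_less n (Suc d)"
    proof (rule P.degree_lessI)
      show "P.var n \<otimes>\<^bsub>P.T\<^esub> f \<in> carrier P.T" by (rule P.S.m_closed[OF v fT])
      fix m assume m: "Suc d \<le> count m n"
      hence "d \<le> count (m - {#n#}) n" by simp
      hence "f (m - {#n#}) = \<zero>" by (rule P.degree_lessD(2)[OF f])
      thus "(P.var n \<otimes>\<^bsub>P.T\<^esub> f) m = \<zero>" unfolding P.var_mult[OF fT] by simp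
    qed
  next
    fix f d assume f: "f \<in> P.degree_less n (Suc d)"
    note fT = P.degree_lessD(1)[OF f]
    let ?r = "replicate_mset d n" and ?xd = "P.var n [^]\<^bsub>P.T\<^esub> d"
    \<comment> \<open>The coefficient of \<open>x [^] d\<close> in \<open>f\<close>, where
      \<open>x\<close> is variable \<open>n\<close>: monomials are shifted by \<open>d\<close>
      copies of \<open>n\<close>, and those still containing \<open>n\<close> are suppressed so that
      \<open>a\<close> belongs to the smaller polynomial ring.\<close>
    define a where "a m = (if n \<in># m then \<zero> else f (m + ?r))" for m
    have "finite ((\<lambda>m. m + ?r) -` {m. f m \<noteq> \<zero>})"
      using fT by (intro finite_vimageI) (auto simp: inj_def carrier_polynomial_ring)
    hence fin: "finite {m. a m \<noteq> \<zero>}"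
      by (rule finite_subset[rotated]) (auto simp: a_def split: if_splits)
    have ac: "a m \<in> carrier R" for m using P.coeff_closed[OF fT] by (simp add: a_def)
    have "a m = \<zero>" if m: "\<not> set_mset m \<subseteq> {..<n}" for m
    proof (cases "n \<in># m")
      case False
      then obtain l where l: "l \<in># m" "\<not> l < n" "l \<noteq> n" using m by auto
      hence "\<not> set_mset (m + ?r) \<subseteq> {..<Suc n}" by auto
      thus ?thesis using P.coeff_vars[OF fT] by (simp add: a_def)
    qed (simp add: a_def)
    hence aA: "a \<in> ?A" using fin ac unfolding carrier_polynomial_ring carrier_power_series_ring by simp
    hence aT: "a \<in> carrier P.T" using sub by auto
    have pT: "?xd \<in> carrier P.T" using v by (rule P.S.nat_pow_closed)
    have prod: "a \<otimes>\<^bsub>P.T\<^esub> ?xd = (\<lambda>m. if ?r \<subseteq># m then a (m - ?r) else \<zero>)"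
    proof -
      have "a \<otimes>\<^bsub>P.T\<^esub> ?xd = ?xd \<otimes>\<^bsub>P.T\<^esub> a"
        by (rule P.S.m_comm[OF aT pT])
      also have "\<dots> = (\<lambda>m. if ?r \<subseteq># m then \<one> \<otimes> a (m - ?r) else \<zero>)"
        unfolding P.var_pow[OF lessI] by (rule P.S_monomial_mult[OF one_closed aT])
      also have "\<dots> = (\<lambda>m. if ?r \<subseteq># m then a (m - ?r) else \<zero>)" unfolding l_one[OF ac] ..
      finally show ?thesis .
    qed
    have "f \<ominus>\<^bsub>P.T\<^esub> a \<otimes>\<^bsub>P.T\<^esub> ?xd \<in> P.degree_less n d"
    proof (rule P.degree_lessI)
      have apT: "a \<otimes>\<^bsub>P.T\<^esub> ?xd \<in> carrier P.T" by (rule P.S.m_closed[OF aT pT])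
      show "f \<ominus>\<^bsub>P.T\<^esub> a \<otimes>\<^bsub>P.T\<^esub> ?xd \<in> carrier P.T" by (rule P.S.minus_closed[OF fT apT])
      fix m assume m: "d \<le> count m n"
      hence r: "?r \<subseteq># m" by (simp add: count_le_replicate_mset_subset_eq)
      have fm: "f m \<in> carrier R" by (rule P.coeff_closed[OF fT])
      have "a (m - ?r) = f m"
      proof (cases "count m n = d")
        case True
        hence "n \<notin># m - ?r" by (simp add: not_in_iff)
        thus ?thesis using r by (simp add: a_def)
      next
        case False
        hence "0 < count (m - ?r) n" using m by simp
        hence "n \<in># m - ?r" by (simp only: count_greater_zero_iff)
        moreover have "f m = \<zero>" using m False by (intro P.degree_lessD(2)[OF f]) simp
        ultimately show ?thesis by (simp add: a_def)
      qed
      thus "(f \<ominus>\<^bsub>P.T\<^esub> a \<otimes>\<^bsub>P.T\<^esub> ?xd) m = \<zero>"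
        unfolding P.S_minus[OF fT apT] unfolding prod using r fm by (simp add: r_neg a_minus_def)
    qed
    thus "\<exists>a\<in>?A. f \<ominus>\<^bsub>P.T\<^esub> a \<otimes>\<^bsub>P.T\<^esub> ?xd \<in> P.degree_less n d" using aA by (rule bexI)
  qed
qed

lemma (in noetherian_cring) polynomial_ring_noetherian: "noetherian_ring (polynomial_ring R n)"
proof (induction n)
  case 0
  interpret P: polynomials R 0 by (rule polynomials.intro[OF is_cring])
  show ?case by (rule P.noetherian_no_variables[OF noetherian_ring_axioms]) simp
next
  case (Suc n)
  show ?case by (rule polynomial_extension.noetherian[OF polynomial_extension_polynomials[OF Suc.IH]])
qed

locale noetherian_polynomials = polynomials + noetherian_ring R
begin

sublocale noetherian_series_subring R n "carrier (polynomial_ring R n)"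
  rewrites "series_subring.S R (carrier (polynomial_ring R n)) = polynomial_ring R n"
proof -
  interpret noetherian_cring R
    by (rule noetherian_cring.intro[OF noetherian_ring_axioms is_cring])
  show "noetherian_series_subring R n (carrier (polynomial_ring R n))"
    using polynomial_ring_noetherian[of n] series_subring_axioms
    by (intro noetherian_series_subring.intro noetherian_series_subring_axioms.intro)
      (simp_all add: noetherian_ring_axioms S_polynomial)
qed (rule S_polynomial)

end

text \<open>Each variable removed by contraction costs at most one member, and the head continues to
  contain the extension of \<open>J\<close> to the smaller polynomial ring.\<close>

lemma (in noetherian_cring) prime_chain_descend_polynomials:
  assumes J: "ideal J R"
    and "prime_chain (polynomial_ring R n) Qs" "polynomial_ideal R n J \<subseteq> hd Qs"
  shows "\<exists>Ps. prime_chain R Ps \<and> J \<subseteq> hd Ps \<and> length Qs \<le> length Ps + n"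
  using assms(2,3)
proof (induction n arbitrary: Qs)
  \<comment> \<open>Without variables the condition of the general descent on the last prime is
    vacuous and nothing is lost.\<close>
  case 0
  interpret P: noetherian_polynomials R 0
    by (rule noetherian_polynomials.intro[OF polynomials.intro[OF is_cring] noetherian_ring_axioms])
  obtain Ps where Ps: "prime_chain R Ps" "P.contraction (hd Qs) \<subseteq> hd Ps" "length Qs \<le> length Ps + 0"
    using P.prime_chain_descend[OF 0(1)] by auto
  have "J \<subseteq> P.contraction (hd Qs)"
    using P.contraction_mono[OF 0(2)] unfolding polynomial_ideal_eq P.contraction_avoiding[OF J] .
  thus ?case using Ps by (intro exI[of _ Ps]) auto
next
  case (Suc n)
  interpret E: polynomial_extension "polynomial_ring R (Suc n)" "carrier (polynomial_ring R n)"
    "monomial R {#n#} \<one>" "polynomials.degree_less R (Suc n) n"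
    by (rule polynomial_extension_polynomials[OF polynomial_ring_noetherian])
  have eq: "(polynomial_ring R (Suc n))\<lparr>carrier := carrier (polynomial_ring R n)\<rparr> = polynomial_ring R n"
    by (simp add: polynomial_ring_def power_series_ring_def)
  obtain Qs' where Qs': "prime_chain (polynomial_ring R n) Qs'"
    "hd Qs' = hd Qs \<inter> carrier (polynomial_ring R n)" "length Qs \<le> Suc (length Qs')"
    using E.prime_chain_contract[OF Suc.prems(1)] unfolding eq by auto
  have "polynomial_ideal R n J \<subseteq> hd Qs'"
    unfolding Qs'(2) using Suc.prems(2) polynomial_subring_Suc[of n]
    unfolding polynomial_ideal_def by auto
  from Suc.IH[OF Qs'(1) this] obtain Ps
    where "prime_chain R Ps" "J \<subseteq> hd Ps" "length Qs' \<le> length Ps + n" by auto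
  thus ?case using Qs'(3) by (intro exI[of _ Ps]) auto
qed

section \<open>Relative Cohen-Macaulayness of power series and polynomial rings\<close>

theorem corollary2p17:
  fixes R :: "('a, 'm) ring_scheme" and n :: nat and I P :: "'a set"
  assumes "cring R" and "noetherian_ring R" and "n \<ge> 1"
    and "ideal I R" and "I \<noteq> carrier R"
    and "primeideal P R"
    and "grade R I = height R I"
    and "grade R P = height R P"
  shows "(cohen_macaulay_wrt R I \<longleftrightarrow>
            cohen_macaulay_wrt (power_series_ring R n) (power_series_ideal R n I)) \<and>
         (cohen_macaulay_wrt R P \<longleftrightarrow>
            cohen_macaulay_wrt (polynomial_ring R n) (polynomial_ideal R n P))"
proof
  interpret noetherian_cring R by (rule noetherian_cring.intro[OF assms(2,1)])
  interpret S: noetherian_power_series R n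
    by (rule noetherian_power_series.intro[OF power_series.intro[OF assms(1)] assms(2)])
  interpret T: noetherian_polynomials R n
    by (rule noetherian_polynomials.intro[OF polynomials.intro[OF assms(1)] assms(2)])
  show "cohen_macaulay_wrt R I \<longleftrightarrow>
    cohen_macaulay_wrt (power_series_ring R n) (power_series_ideal R n I)"
    unfolding power_series_ideal_eq
    using assms(4,5,7) S.prime_chain_descend_power_series by (rule S.cohen_macaulay_avoiding_iff)
  have P: "ideal P R" "P \<noteq> carrier R"
    using assms(6) by (auto simp: primeideal_def primeideal_axioms_def)
  show "cohen_macaulay_wrt R P \<longleftrightarrow>
    cohen_macaulay_wrt (polynomial_ring R n) (polynomial_ideal R n P)"
    unfolding polynomial_ideal_eq
    using P assms(8) prime_chain_descend_polynomials[unfolded polynomial_ideal_eq]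
    by (rule T.cohen_macaulay_avoiding_iff)
qed

end
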